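(* Let $k$ be an algebraically closed field, let $A$ be a connected finite-dimensional $k$-algebra and $B$ a subalgebra of $A$ such that $Q_B$ is a subquiver of $Q_A$, and let $\nu=(\nu_A,\nu_B)$ be a presentation of $A$ relative to $B$, with $I_A=\mathrm{Ker}(\nu_A)$. Then there is an induced monomorphism $$\theta_{\nu}^{(A|B)}:\mathrm{Hom}(\pi_1(Q_A,I_A)/N_B,k)\to \mathrm{HH}^1(A|B).$$ Furthermore, the following diagram (with $\iota$ induced by the quotient map $\pi_1(Q_A,I_A)\to\pi_1(Q_A,I_A)/N_B$ and $\iota_{\mathrm{HH}}$ the canonical map induced by $\mathrm{Der}_{B^e}(A)\subseteq \mathrm{Der}_k(A)$) is a commutative pullback square of $k$-vector spaces: $$\begin{array}{ccc} \mathrm{Hom}(\pi_1(Q_A,I_A),k) & \xrightarrow{\ \theta_\nu\ } & \mathrm{HH}^1(A)\\ {\scriptstyle\iota}\uparrow & & \uparrow{\scriptstyle \iota_{\mathrm{HH}}}\\ \mathrm{Hom}(\pi_1(Q_A,I_A)/N_B,k) & \xrightarrow{\ \theta_\nu^{(A|B)}\ } & \mathrm{HH}^1(A|B). \end{array}$$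
   Context: Presentations. Fix a complete set of orthogonal idempotents $e_1,\dots,e_n$ of $A$ (not necessarily primitive). A presentation is a surjective $k$-algebra map $\nu_A:kQ_A\to A$, $Q_A$ a quiver, inducing a bijection between $(Q_A)_0$ and $\{e_1,\dots,e_n\}$; $I_A=\mathrm{Ker}(\nu_A)$ is not assumed admissible. A presentation of $A$ relative to $B$ is a pair of presentations $\nu_A:kQ_A\to A$, $\nu_B:kQ_B\to B$ with $Q_B$ a subquiver of $Q_A$, such that $\nu_A|_{kQ_B}$ equals $\nu_B$ followed by the inclusion $B\subseteq A$. The quiver $Q_A$ is connected. Fundamental group. Arrows are composed from right to left. A walk in $Q_A$ is a path in the quiver obtained by adding a formal inverse $\alpha^{-1}$ for each arrow $\alpha$. An element $r=\sum\lambda_ip_i\in I_A$ (distinct paths $p_i$, $\lambda_i\ne0$) is a minimal relation if no proper subsum lies in $I_A$. Let $\sim$ be the equivalence relation on walks, compatible with concatenation, generated by $\alpha^{-1}\alpha\sim e_{s(\alpha)}$, $\alpha\alpha^{-1}\sim e_{t(\alpha)}$ for arrows $\alpha$, and $u\sim v$ whenever $u,v$ are paths appearing with non-zero coefficient in a common minimal relation. Fix a vertex $*$; $\pi_1(Q_A,I_A)=\pi_1(Q_A,I_A,* )$ is the group of $\sim$-classes of walks from $*$ to $*$. $\mathrm{Hom}(-,k)$ denotes group homomorphisms to the additive group of $k$. Subgroup $N_B$. $N_B$ is the (normal) subgroup of $\pi_1(Q_A,I_A,* )$ generated by all classes $[v^{-1}(u')^{-1}uv]$, where $u,u'$ are walks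 in $Q_B$ with the same source and the same target, and $v$ is a walk in $Q_A$ from $*$ to the common source of $u,u'$. The map $\theta_\nu$. A parade data $\gamma$ is a choice, for each vertex $y$ of $Q_A$, of a walk $\gamma_{*,y}$ from $*$ to $y$. For a path $p$ put $\mathrm{cl}_\gamma(p)=[\gamma_{*,t(p)}^{-1}\,p\,\gamma_{*,s(p)}]$. The map $\theta_{\nu}:\mathrm{Hom}(\pi_1(Q_A,I_A),k)\to\mathrm{HH}^1(A)$ sends $f$ to the class of the derivation determined by $\nu_A(p)\mapsto f(\mathrm{cl}_\gamma(p))\nu_A(p)$ for paths $p$; as a map to $\mathrm{HH}^1(A)$ it does not depend on $\gamma$. The map $\theta_\nu^{(A|B)}$. A relative parade data is a parade data of the following form: for each connected component $\Gamma_i$ of $Q_B$ fix a vertex $x_i\in\Gamma_i$, a walk $\gamma_{*,x_i}$ in $Q_A$ from $*$ to $x_i$, and for each vertex $y$ of $\Gamma_i$ a walk $\gamma^{\Gamma_i}_{x_i,y}$ in $\Gamma_i$ from $x_i$ to $y$; set $\gamma_{*,y}=\gamma^{\Gamma_i}_{x_i,y}\gamma_{*,x_i}$. For a relative parade data $\gamma$, the map $\theta_\nu^{(A|B)}$ sends $f\in\mathrm{Hom}(\pi_1(Q_A,I_A)/N_B,k)$ to the class in $\mathrm{HH}^1(A|B)$ of the derivation $\nu_A(p)\mapsto f(\mathrm{cl}_\gamma(p)N_B)\,\nu_A(p)$, which vanishes on $B$. Hochschild cohomology: $\mathrm{HH}^1(A)=\mathrm{Der}_k(A)/\mathrm{Inn}_k(A)$;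 $\mathrm{HH}^1(A|B)=\mathrm{Der}_{B^e}(A)/\mathrm{Inn}_{B^e}(A)$, where $\mathrm{Der}_{B^e}(A)$ (resp. $\mathrm{Inn}_{B^e}(A)$) consists of the derivations (resp. inner derivations) of $A$ that are $B$-bimodule homomorphisms, equivalently vanish on $B$.
   Formalization: Injectivity of the relative map and the pullback property are proved assuming that the idempotents are primitive and no arrow of Q_A is mapped to 0 by the presentation; both can fail otherwise. Well-definedness, linearity and commutativity are proved without these assumptions. *)

theory Defs
  imports
    "Jordan_Normal_Form.Missing_VectorSpace"
    "Graph_Theory.Arc_Walk"
    "Graph_Theory.Digraph_Component"
    "HOL-Library.Poly_Mapping"
    "HOL-Algebra.Generated_Groups"
    "HOL-Algebra.Algebraic_Closure_Type"
begin

hide_const (open) Multiset.mult Polynomial.smult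

section \<open>Algebras over a field and complete sets of idempotents\<close>

locale associative_algebra = vector_space scale
  for scale :: "'k::field \<Rightarrow> 'a::ring_1 \<Rightarrow> 'a" +
  assumes scale_mult_left: "scale c x * y = scale c (x * y)"
    and scale_mult_right: "x * scale c y = scale c (x * y)"

definition finite_dimensional_algebra :: "('k::field \<Rightarrow> 'a::ring_1 \<Rightarrow> 'a) \<Rightarrow> bool" where
  "finite_dimensional_algebra scale \<longleftrightarrow>
     associative_algebra scale \<and> (\<exists>S. finite_dimensional_vector_space scale S)"

definition connected_algebra :: "'a::ring_1 itself \<Rightarrow> bool" where
  "connected_algebra _ \<longleftrightarrow>
     (\<forall>e::'a. e * e = e \<and> (\<forall>x. e * x = x * e) \<longrightarrow> e = 0 \<or> e = 1)"

definition subalgebra :: "('k::field \<Rightarrow> 'a::ring_1 \<Rightarrow> 'a) \<Rightarrow> 'a set \<Rightarrow> bool" where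
  "subalgebra scale B \<longleftrightarrow>
     Modules.module.subspace scale B \<and> 1 \<in> B \<and> (\<forall>x\<in>B. \<forall>y\<in>B. x * y \<in> B)"

definition algebra_on :: "('k \<Rightarrow> 'a::ring_1 \<Rightarrow> 'a) \<Rightarrow> 'a set \<Rightarrow> ('k, 'a) module" where
  "algebra_on scale B =
     \<lparr>carrier = B, mult = (*), one = 1, zero = 0, add = (+), smult = scale\<rparr>"

definition complete_orthogonal_idempotents :: "'a::ring_1 set \<Rightarrow> bool" where
  "complete_orthogonal_idempotents E \<longleftrightarrow>
     finite E \<and> 0 \<notin> E \<and> (\<forall>e\<in>E. e * e = e) \<and>
     (\<forall>e\<in>E. \<forall>e'\<in>E. e \<noteq> e' \<longrightarrow> e * e' = 0) \<and> \<Sum>E = 1"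

definition primitive_idempotent :: "'a::ring_1 \<Rightarrow> bool" where
  "primitive_idempotent e \<longleftrightarrow> e \<noteq> 0 \<and> e * e = e \<and>
     (\<forall>f g. f * f = f \<and> g * g = g \<and> f * g = 0 \<and> g * f = 0 \<and> e = f + g \<longrightarrow> f = 0 \<or> g = 0)"


section \<open>Quivers, path algebras and presentations\<close>

text \<open>
  A quiver is a \<^const>\<open>wf_digraph\<close>. A path is its source together with the list of its arrows
  in the order in which they are traversed, so that \<open>(v, [])\<close> is the trivial path at \<open>v\<close>.
\<close>

type_synonym ('v, 'e) path = "'v \<times> 'e list"

definition path_target :: "('v, 'e) pre_digraph \<Rightarrow> ('v, 'e) path \<Rightarrow> 'v" where
  "path_target Q p = (if snd p = [] then fst p else head Q (last (snd p)))"

definition paths :: "('v, 'e) pre_digraph \<Rightarrow> ('v, 'e) path set" where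
  "paths Q = {p. pre_digraph.awalk Q (fst p) (snd p) (path_target Q p)}"

definition paths_between :: "('v, 'e) pre_digraph \<Rightarrow> 'v \<Rightarrow> 'v \<Rightarrow> ('v, 'e) path set" where
  "paths_between Q x y = {p \<in> paths Q. fst p = x \<and> path_target Q p = y}"

text \<open>Composition is written from right to left: first \<open>p\<close>, then \<open>q\<close>.\<close>

definition path_comp :: "('v, 'e) path \<Rightarrow> ('v, 'e) path \<Rightarrow> ('v, 'e) path"  (infixr \<open>\<cdot>\<close> 70) where
  "q \<cdot> p = (fst p, snd p @ snd q)"

definition path_algebra :: "('v, 'e) pre_digraph \<Rightarrow> ('k::field, ('v, 'e) path \<Rightarrow>\<^sub>0 'k) module" where
  "path_algebra Q =
     \<lparr>carrier = {x. Poly_Mapping.keys x \<subseteq> paths Q},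
      mult = (\<lambda>x y. \<Sum>q\<in>Poly_Mapping.keys x. \<Sum>p\<in>Poly_Mapping.keys y.
        if path_target Q p = fst q
        then Poly_Mapping.single (q \<cdot> p) (Poly_Mapping.lookup x q * Poly_Mapping.lookup y p)
        else 0),
      one = (\<Sum>v\<in>verts Q. Poly_Mapping.single (v, []) 1),
      zero = 0,
      add = (+),
      smult = (\<lambda>c. Poly_Mapping.map ((*) c))\<rparr>"

abbreviation path_elem :: "('v, 'e) path \<Rightarrow> ('v, 'e) path \<Rightarrow>\<^sub>0 'k::field" where
  "path_elem p \<equiv> Poly_Mapping.single p 1"

definition presentation ::
  "('k::field \<Rightarrow> 'a::ring_1 \<Rightarrow> 'a) \<Rightarrow> 'a set \<Rightarrow> 'a set \<Rightarrow> ('v, 'e) pre_digraph \<Rightarrow>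
   ((('v, 'e) path \<Rightarrow>\<^sub>0 'k) \<Rightarrow> 'a) \<Rightarrow> bool" where
  "presentation scale B E Q \<nu> \<longleftrightarrow>
     wf_digraph Q \<and>
     \<nu> \<in> ring_hom (path_algebra Q) (algebra_on scale B) \<and>
     \<nu> \<in> LinearCombinations.module_hom ring_of_type_algebra (path_algebra Q) (algebra_on scale B) \<and>
     \<nu> ` carrier (path_algebra Q) = B \<and>
     bij_betw (\<lambda>v. \<nu> (path_elem (v, []))) (verts Q) E"

definition relative_presentation ::
  "('k::field \<Rightarrow> 'a::ring_1 \<Rightarrow> 'a) \<Rightarrow> 'a set \<Rightarrow> 'a set \<Rightarrow> 'a set \<Rightarrow>
   ('v, 'e) pre_digraph \<Rightarrow> ((('v, 'e) path \<Rightarrow>\<^sub>0 'k) \<Rightarrow> 'a) \<Rightarrow>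
   ('v, 'e) pre_digraph \<Rightarrow> ((('v, 'e) path \<Rightarrow>\<^sub>0 'k) \<Rightarrow> 'a) \<Rightarrow> bool" where
  "relative_presentation scale B E\<^sub>A E\<^sub>B Q\<^sub>A \<nu>\<^sub>A Q\<^sub>B \<nu>\<^sub>B \<longleftrightarrow>
     presentation scale UNIV E\<^sub>A Q\<^sub>A \<nu>\<^sub>A \<and> presentation scale B E\<^sub>B Q\<^sub>B \<nu>\<^sub>B \<and>
     subgraph Q\<^sub>B Q\<^sub>A \<and> (\<forall>x\<in>carrier (path_algebra Q\<^sub>B). \<nu>\<^sub>A x = \<nu>\<^sub>B x)"

definition presentation_ideal ::
  "('k::field \<Rightarrow> 'a::ring_1 \<Rightarrow> 'a) \<Rightarrow> ('v, 'e) pre_digraph \<Rightarrow>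
   ((('v, 'e) path \<Rightarrow>\<^sub>0 'k) \<Rightarrow> 'a) \<Rightarrow> (('v, 'e) path \<Rightarrow>\<^sub>0 'k) set" where
  "presentation_ideal scale Q \<nu> = a_kernel (path_algebra Q) (algebra_on scale UNIV) \<nu>"


section \<open>Walks, the fundamental group and the subgroup of the subalgebra\<close>

datatype 'e letter = Arrow 'e | Inverse 'e

primrec inverse_letter :: "'e letter \<Rightarrow> 'e letter" where
  "inverse_letter (Arrow a) = Inverse a"
| "inverse_letter (Inverse a) = Arrow a"

definition double_quiver :: "('v, 'e) pre_digraph \<Rightarrow> ('v, 'e letter) pre_digraph" where
  "double_quiver Q =
     \<lparr>verts = verts Q, arcs = Arrow ` arcs Q \<union> Inverse ` arcs Q,
      tail = case_letter (tail Q) (head Q), head = case_letter (head Q) (tail Q)\<rparr>"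

abbreviation walks :: "('v, 'e) pre_digraph \<Rightarrow> ('v, 'e letter) path set" where
  "walks Q \<equiv> paths (double_quiver Q)"

abbreviation walks_between :: "('v, 'e) pre_digraph \<Rightarrow> 'v \<Rightarrow> 'v \<Rightarrow> ('v, 'e letter) path set" where
  "walks_between Q \<equiv> paths_between (double_quiver Q)"

abbreviation walk_target :: "('v, 'e) pre_digraph \<Rightarrow> ('v, 'e letter) path \<Rightarrow> 'v" where
  "walk_target Q \<equiv> path_target (double_quiver Q)"

definition walk_of_path :: "('v, 'e) path \<Rightarrow> ('v, 'e letter) path" where
  "walk_of_path p = (fst p, map Arrow (snd p))"

definition inverse_walk :: "('v, 'e) pre_digraph \<Rightarrow> ('v, 'e letter) path \<Rightarrow> ('v, 'e letter) path" where
  "inverse_walk Q w = (walk_target Q w, rev (map inverse_letter (snd w)))"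

text \<open>The empty subsum is \<open>0\<close>, which always lies in the ideal, so it has to be left out.\<close>

definition minimal_relation ::
  "(('v, 'e) path \<Rightarrow>\<^sub>0 'k::field) set \<Rightarrow> (('v, 'e) path \<Rightarrow>\<^sub>0 'k) \<Rightarrow> bool" where
  "minimal_relation I r \<longleftrightarrow> r \<in> I \<and>
     (\<forall>S. S \<noteq> {} \<and> S \<subset> Poly_Mapping.keys r \<longrightarrow>
        (\<Sum>p\<in>S. Poly_Mapping.single p (Poly_Mapping.lookup r p)) \<notin> I)"

inductive homotopic ::
  "('v, 'e) pre_digraph \<Rightarrow> (('v, 'e) path \<Rightarrow>\<^sub>0 'k::field) set \<Rightarrow>
   ('v, 'e letter) path \<Rightarrow> ('v, 'e letter) path \<Rightarrow> bool"
  for Q :: "('v, 'e) pre_digraph" and I :: "(('v, 'e) path \<Rightarrow>\<^sub>0 'k::field) set" where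
  refl: "w \<in> walks Q \<Longrightarrow> homotopic Q I w w"
| sym: "homotopic Q I u v \<Longrightarrow> homotopic Q I v u"
| trans: "homotopic Q I u v \<Longrightarrow> homotopic Q I v w \<Longrightarrow> homotopic Q I u w"
| comp: "homotopic Q I u u' \<Longrightarrow> homotopic Q I v v' \<Longrightarrow>
    walk_target Q v = fst u \<Longrightarrow> walk_target Q v' = fst u' \<Longrightarrow> homotopic Q I (u \<cdot> v) (u' \<cdot> v')"
| inverse_left: "a \<in> arcs Q \<Longrightarrow>
    homotopic Q I ((head Q a, [Inverse a]) \<cdot> (tail Q a, [Arrow a])) (tail Q a, [])"
| inverse_right: "a \<in> arcs Q \<Longrightarrow>
    homotopic Q I ((tail Q a, [Arrow a]) \<cdot> (head Q a, [Inverse a])) (head Q a, [])"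
| relation: "minimal_relation I r \<Longrightarrow> p \<in> Poly_Mapping.keys r \<Longrightarrow> q \<in> Poly_Mapping.keys r \<Longrightarrow>
    homotopic Q I (walk_of_path p) (walk_of_path q)"

definition walk_class ::
  "('v, 'e) pre_digraph \<Rightarrow> (('v, 'e) path \<Rightarrow>\<^sub>0 'k::field) set \<Rightarrow>
   ('v, 'e letter) path \<Rightarrow> ('v, 'e letter) path set" where
  "walk_class Q I w = {w'. homotopic Q I w w'}"

definition fundamental_group ::
  "('v, 'e) pre_digraph \<Rightarrow> (('v, 'e) path \<Rightarrow>\<^sub>0 'k::field) set \<Rightarrow> 'v \<Rightarrow>
   ('v, 'e letter) path set monoid" where
  "fundamental_group Q I b =
     \<lparr>carrier = walk_class Q I ` walks_between Q b b,
      mult = (\<lambda>U V. \<Union>u\<in>U. \<Union>v\<in>V. walk_class Q I (u \<cdot> v)),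
      one = walk_class Q I (b, [])\<rparr>"

definition relative_subgroup ::
  "('v, 'e) pre_digraph \<Rightarrow> (('v, 'e) path \<Rightarrow>\<^sub>0 'k::field) set \<Rightarrow> 'v \<Rightarrow> ('v, 'e) pre_digraph \<Rightarrow>
   ('v, 'e letter) path set set" where
  "relative_subgroup Q\<^sub>A I b Q\<^sub>B =
     generate (fundamental_group Q\<^sub>A I b)
       {walk_class Q\<^sub>A I (inverse_walk Q\<^sub>A v \<cdot> inverse_walk Q\<^sub>A u' \<cdot> u \<cdot> v) | u u' v x y.
          u \<in> walks_between Q\<^sub>B x y \<and> u' \<in> walks_between Q\<^sub>B x y \<and> v \<in> walks_between Q\<^sub>A b x}"


section \<open>Parade data\<close>

definition parade_data ::
  "('v, 'e) pre_digraph \<Rightarrow> 'v \<Rightarrow> ('v \<Rightarrow> ('v, 'e letter) path) \<Rightarrow> bool" where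
  "parade_data Q b \<gamma> \<longleftrightarrow> (\<forall>y\<in>verts Q. \<gamma> y \<in> walks_between Q b y)"

definition components :: "('v, 'e) pre_digraph \<Rightarrow> 'v set set" where
  "components Q = (\<lambda>x. {y. walks_between Q x y \<noteq> {}}) ` verts Q"

text \<open>
  A walk in \<open>Q\<^sub>B\<close> that starts at a vertex of a component of \<open>Q\<^sub>B\<close> runs inside that component.
\<close>

definition relative_parade_data ::
  "('v, 'e) pre_digraph \<Rightarrow> 'v \<Rightarrow> ('v, 'e) pre_digraph \<Rightarrow> ('v \<Rightarrow> ('v, 'e letter) path) \<Rightarrow> bool" where
  "relative_parade_data Q\<^sub>A b Q\<^sub>B \<gamma> \<longleftrightarrow> parade_data Q\<^sub>A b \<gamma> \<and>
     (\<exists>base to_base inside. \<forall>C\<in>components Q\<^sub>B.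
        base C \<in> C \<and> to_base C \<in> walks_between Q\<^sub>A b (base C) \<and>
        (\<forall>y\<in>C. inside C y \<in> walks_between Q\<^sub>B (base C) y \<and> \<gamma> y = inside C y \<cdot> to_base C))"

definition parade_class ::
  "('v, 'e) pre_digraph \<Rightarrow> (('v, 'e) path \<Rightarrow>\<^sub>0 'k::field) set \<Rightarrow>
   ('v \<Rightarrow> ('v, 'e letter) path) \<Rightarrow> ('v, 'e) path \<Rightarrow> ('v, 'e letter) path set" where
  "parade_class Q I \<gamma> p =
     walk_class Q I (inverse_walk Q (\<gamma> (path_target Q p)) \<cdot> walk_of_path p \<cdot> \<gamma> (fst p))"


section \<open>The vector spaces of the square\<close>

text \<open>
  The record type of vector spaces extends that of rings; the ring multiplication and its unit
  play no role for a vector space and are left undefined.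
\<close>

definition hom_space :: "('g, 'm) monoid_scheme \<Rightarrow> ('k::field, 'g \<Rightarrow> 'k) module" where
  "hom_space G =
     \<lparr>carrier = hom G (add_monoid (ring_of_type_algebra :: 'k ring)) \<inter> extensional (carrier G),
      mult = undefined, one = undefined,
      zero = (\<lambda>x\<in>carrier G. 0),
      add = (\<lambda>f g. \<lambda>x\<in>carrier G. f x + g x),
      smult = (\<lambda>c f. \<lambda>x\<in>carrier G. c * f x)\<rparr>"

definition quotient_space :: "('k, 'b) module \<Rightarrow> 'b set \<Rightarrow> ('k, 'b set) module" where
  "quotient_space M N =
     \<lparr>carrier = a_rcosets\<^bsub>M\<^esub> N,
      mult = undefined, one = undefined,
      zero = N,
      add = set_add M,
      smult = (\<lambda>c U. \<Union>x\<in>U. N +>\<^bsub>M\<^esub> (c \<odot>\<^bsub>M\<^esub> x))\<rparr>"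

definition operator_space ::
  "('k::field \<Rightarrow> 'a::ring_1 \<Rightarrow> 'a) \<Rightarrow> ('a \<Rightarrow> 'a) set \<Rightarrow> ('k, 'a \<Rightarrow> 'a) module" where
  "operator_space scale S =
     \<lparr>carrier = S,
      mult = undefined, one = undefined,
      zero = (\<lambda>_. 0),
      add = (\<lambda>D D' x. D x + D' x),
      smult = (\<lambda>c D x. scale c (D x))\<rparr>"

definition derivations :: "('k::field \<Rightarrow> 'a::ring_1 \<Rightarrow> 'a) \<Rightarrow> ('a \<Rightarrow> 'a) set" where
  "derivations scale =
     {D. Vector_Spaces.linear scale scale D \<and> (\<forall>x y. D (x * y) = D x * y + x * D y)}"

definition inner_derivations :: "('a::ring_1 \<Rightarrow> 'a) set" where
  "inner_derivations = range (\<lambda>a x. a * x - x * a)"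

definition bimodule_operators :: "'a::ring_1 set \<Rightarrow> ('a \<Rightarrow> 'a) set" where
  "bimodule_operators B = {D. \<forall>b\<in>B. \<forall>x. D (b * x) = b * D x \<and> D (x * b) = D x * b}"

definition relative_derivations ::
  "('k::field \<Rightarrow> 'a::ring_1 \<Rightarrow> 'a) \<Rightarrow> 'a set \<Rightarrow> ('a \<Rightarrow> 'a) set" where
  "relative_derivations scale B = derivations scale \<inter> bimodule_operators B"

definition relative_inner_derivations :: "'a::ring_1 set \<Rightarrow> ('a \<Rightarrow> 'a) set" where
  "relative_inner_derivations B = inner_derivations \<inter> bimodule_operators B"

definition HH1 :: "('k::field \<Rightarrow> 'a::ring_1 \<Rightarrow> 'a) \<Rightarrow> ('k, ('a \<Rightarrow> 'a) set) module" where
  "HH1 scale = quotient_space (operator_space scale (derivations scale)) inner_derivations"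

definition relative_HH1 ::
  "('k::field \<Rightarrow> 'a::ring_1 \<Rightarrow> 'a) \<Rightarrow> 'a set \<Rightarrow> ('k, ('a \<Rightarrow> 'a) set) module" where
  "relative_HH1 scale B =
     quotient_space (operator_space scale (relative_derivations scale B))
       (relative_inner_derivations B)"


section \<open>The maps of the square\<close>

definition iota ::
  "('g, 'm) monoid_scheme \<Rightarrow> 'g set \<Rightarrow> ('g set \<Rightarrow> 'k::field) \<Rightarrow> ('g \<Rightarrow> 'k)" where
  "iota G N f = (\<lambda>x\<in>carrier G. f (N #>\<^bsub>G\<^esub> x))"

text \<open>The coset of a relative derivation \<open>D\<close> is sent to the coset of \<open>D\<close>.\<close>

definition iota_HH ::
  "('k::field \<Rightarrow> 'a::ring_1 \<Rightarrow> 'a) \<Rightarrow> ('a \<Rightarrow> 'a) set \<Rightarrow> ('a \<Rightarrow> 'a) set" where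
  "iota_HH scale U = inner_derivations <+>\<^bsub>operator_space scale (derivations scale)\<^esub> U"

definition scales_paths ::
  "('k::field \<Rightarrow> 'a::ring_1 \<Rightarrow> 'a) \<Rightarrow> ('v, 'e) pre_digraph \<Rightarrow>
   ((('v, 'e) path \<Rightarrow>\<^sub>0 'k) \<Rightarrow> 'a) \<Rightarrow> (('v, 'e) path \<Rightarrow> 'k) \<Rightarrow> ('a \<Rightarrow> 'a) \<Rightarrow> bool" where
  "scales_paths scale Q \<nu> \<chi> D \<longleftrightarrow>
     (\<forall>p\<in>paths Q. D (\<nu> (path_elem p)) = scale (\<chi> p) (\<nu> (path_elem p)))"

definition theta ::
  "('k::field \<Rightarrow> 'a::ring_1 \<Rightarrow> 'a) \<Rightarrow> ('v, 'e) pre_digraph \<Rightarrow>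
   ((('v, 'e) path \<Rightarrow>\<^sub>0 'k) \<Rightarrow> 'a) \<Rightarrow> ('v \<Rightarrow> ('v, 'e letter) path) \<Rightarrow>
   (('v, 'e letter) path set \<Rightarrow> 'k) \<Rightarrow> ('a \<Rightarrow> 'a) set" where
  "theta scale Q \<nu> \<gamma> f =
     inner_derivations +>\<^bsub>operator_space scale (derivations scale)\<^esub>
       (THE D. D \<in> derivations scale \<and>
          scales_paths scale Q \<nu>
            (\<lambda>p. f (parade_class Q (presentation_ideal scale Q \<nu>) \<gamma> p)) D)"

definition relative_theta ::
  "('k::field \<Rightarrow> 'a::ring_1 \<Rightarrow> 'a) \<Rightarrow> 'a set \<Rightarrow> ('v, 'e) pre_digraph \<Rightarrow>
   ((('v, 'e) path \<Rightarrow>\<^sub>0 'k) \<Rightarrow> 'a) \<Rightarrow> ('v, 'e) pre_digraph \<Rightarrow> 'v \<Rightarrow>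
   ('v \<Rightarrow> ('v, 'e letter) path) \<Rightarrow>
   (('v, 'e letter) path set set \<Rightarrow> 'k) \<Rightarrow> ('a \<Rightarrow> 'a) set" where
  "relative_theta scale B Q\<^sub>A \<nu>\<^sub>A Q\<^sub>B b \<gamma> f =
     (let I = presentation_ideal scale Q\<^sub>A \<nu>\<^sub>A;
          N = relative_subgroup Q\<^sub>A I b Q\<^sub>B
      in relative_inner_derivations B +>\<^bsub>operator_space scale (relative_derivations scale B)\<^esub>
           (THE D. D \<in> relative_derivations scale B \<and>
              scales_paths scale Q\<^sub>A \<nu>\<^sub>A
                (\<lambda>p. f (N #>\<^bsub>fundamental_group Q\<^sub>A I b\<^esub> parade_class Q\<^sub>A I \<gamma> p)) D))"


section \<open>Commutative squares and pullback squares of vector spaces\<close>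

text \<open>The square has \<open>i\<close> from \<open>P\<close> to \<open>U\<close>, \<open>t\<close> from \<open>P\<close> to \<open>V\<close>, \<open>f\<close> from \<open>U\<close> to \<open>W\<close> and \<open>g\<close> from \<open>V\<close> to \<open>W\<close>.\<close>

definition commutative_square ::
  "'k ring \<Rightarrow> ('k, 'p) module \<Rightarrow> ('k, 'u) module \<Rightarrow> ('k, 'v) module \<Rightarrow> ('k, 'w) module \<Rightarrow>
   ('p \<Rightarrow> 'u) \<Rightarrow> ('p \<Rightarrow> 'v) \<Rightarrow> ('u \<Rightarrow> 'w) \<Rightarrow> ('v \<Rightarrow> 'w) \<Rightarrow> bool" where
  "commutative_square K P U V W i t f g \<longleftrightarrow>
     linear_map K P U i \<and> linear_map K P V t \<and> linear_map K U W f \<and> linear_map K V W g \<and>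
     (\<forall>p\<in>carrier P. f (i p) = g (t p))"

text \<open>
  The type argument is the type of the elements of the test spaces. A theorem in which it is a
  free type variable states the universal property with respect to all vector spaces.
\<close>

definition pullback_square ::
  "'t itself \<Rightarrow> 'k ring \<Rightarrow>
   ('k, 'p) module \<Rightarrow> ('k, 'u) module \<Rightarrow> ('k, 'v) module \<Rightarrow> ('k, 'w) module \<Rightarrow>
   ('p \<Rightarrow> 'u) \<Rightarrow> ('p \<Rightarrow> 'v) \<Rightarrow> ('u \<Rightarrow> 'w) \<Rightarrow> ('v \<Rightarrow> 'w) \<Rightarrow> bool" where
  "pullback_square _ K P U V W i t f g \<longleftrightarrow>
     commutative_square K P U V W i t f g \<and>
     (\<forall>(T :: ('k, 't) module) a b.
        linear_map K T U a \<and> linear_map K T V b \<and> (\<forall>w\<in>carrier T. f (a w) = g (b w)) \<longrightarrow>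
        (\<exists>!h. h \<in> extensional (carrier T) \<and> linear_map K T P h \<and>
           (\<forall>w\<in>carrier T. i (h w) = a w \<and> t (h w) = b w)))"

end

theory Submission
  imports Defs
begin

text \<open>
  The function \<open>w \<mapsto> f [\<gamma> (t w)\<^sup>-\<^sup>1 w \<gamma> (s w)]\<close> is additive on walks and constant on homotopy
  classes. Since every relation is a sum of minimal relations, rescaling each path by its value
  preserves the ideal of relations and yields a derivation \<open>D\<^sub>f\<close> of the algebra. For a relative
  parade the class of a path of \<open>Q\<^sub>B\<close> is one of the generators of \<open>N\<^sub>B\<close>, so \<open>D\<^sub>f\<close> vanishes on \<open>B\<close>
  if \<open>f\<close> vanishes on \<open>N\<^sub>B\<close>; changing the parade changes \<open>D\<^sub>f\<close> by the inner derivation of a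
  combination of the vertices.

  Now let the idempotents be primitive and suppose that \<open>D\<^sub>f\<close> agrees with \<open>[a, _]\<close> on the vertices
  and on the arrows of a subquiver. The corners \<open>e\<^sub>y A e\<^sub>y\<close> are local with residue field \<open>k\<close>, so
  \<open>e\<^sub>y a e\<^sub>y\<close> is a scalar \<open>\<phi> y\<close> plus a nilpotent, and comparing eigenvalues shows that \<open>f\<close> takes the
  value \<open>\<phi> y - \<phi> x\<close> on each non-zero arrow from \<open>x\<close> to \<open>y\<close> of the subquiver, hence on each of its
  walks. For the whole quiver this makes \<open>f\<close> trivial, which is the injectivity of \<open>\<theta>\<close>; for \<open>Q\<^sub>B\<close> it
  makes \<open>f\<close> trivial on \<open>N\<^sub>B\<close>, which is the lifting property of the square.
\<close>

section \<open>Corner algebras of primitive idempotents\<close>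

text \<open>Injectivity and the pullback property are shown for primitive idempotents and non-zero
  arrows, and each condition excludes a genuine failure. Present \<open>M_2(k)\<close> with one
  vertex and two loops going to \<open>E_12\<close> and \<open>E_21\<close>: the ideal is
  homogeneous for the degrees 1 and -1, so the fundamental group maps onto the integers, although
  every derivation is inner. Likewise, a loop sent to 0 in the algebra \<open>k\<close> generates an
  infinite cyclic group that no derivation sees. With \<open>B = k\<close> both examples also defeat
  the relative map. Locality of the corners is reached through polynomials, not through the radical:
  if an annihilating polynomial of a corner element splits into coprime factors, these give
  complementary idempotents of the corner, and primitivity discards one of them. The eigenvalue
  comparison needs an \<open>a\<close> that commutes with every vertex. In the lifting problem the
  commutator with \<open>a\<close> is known only on \<open>B\<close>; this suffices because the unit
  of the algebra lies in \<open>B\<close>, which forces the subquiver to contain all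
  vertices.\<close>

context associative_algebra
begin

text \<open>Evaluation from \<open>k[X]\<close> to the algebra in Horner form, with a coefficient
  \<open>c\<close> read as \<open>scale c 1\<close>. Only powers of the single element
  \<open>x\<close> occur, so the algebra need not be commutative.\<close>

definition poly_apply :: "'k poly \<Rightarrow> 'a \<Rightarrow> 'a" where
  "poly_apply P x = fold_coeffs (\<lambda>c r. scale c 1 + x * r) P 0"

lemma poly_apply_0 [simp]: "poly_apply 0 x = 0"
  by (simp add: poly_apply_def)

lemma poly_apply_pCons [simp]: "poly_apply (pCons c P) x = scale c 1 + x * poly_apply P x"
  by (cases "P = 0"; cases "c = 0") (simp_all add: poly_apply_def)

lemma poly_apply_1 [simp]: "poly_apply 1 x = 1"
  by (simp add: one_pCons)

lemma poly_apply_add [simp]: "poly_apply (P + Q) x = poly_apply P x + poly_apply Q x"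
proof (induction P Q rule: poly_induct2)
  case (pCons a p b' q)
  then show ?case by (simp add: scale_left_distrib algebra_simps)
qed simp

lemma poly_apply_smult [simp]: "poly_apply (Polynomial.smult c P) x = scale c (poly_apply P x)"
  by (induction P) (simp_all add: scale_right_distrib scale_mult_right)

lemma poly_apply_mult [simp]: "poly_apply (P * Q) x = poly_apply P x * poly_apply Q x"
  by (induction P) (simp_all add: scale_mult_left algebra_simps)

lemma poly_apply_power [simp]: "poly_apply (P ^ n) x = poly_apply P x ^ n"
  by (induction n) simp_all

lemma poly_apply_monom: "poly_apply (Polynomial.monom c n) x = scale c (x ^ n)"
  by (induction n) (simp_all add: monom_0 monom_Suc scale_mult_right)

lemma poly_apply_sum: "poly_apply (sum P S) x = (\<Sum>i\<in>S. poly_apply (P i) x)"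
  by (induction S rule: infinite_finite_induct) simp_all

end

lemma finite_dimensional_annihilating_poly:
  fixes scale :: "'k::field \<Rightarrow> 'a::ring_1 \<Rightarrow> 'a"
  assumes "finite_dimensional_algebra scale"
  obtains P where "P \<noteq> 0" "associative_algebra.poly_apply scale P x = 0"
proof -
  obtain S where "associative_algebra scale" "finite_dimensional_vector_space scale S"
    using assms by (auto simp: finite_dimensional_algebra_def)
  then interpret associative_algebra scale + finite_dimensional_vector_space scale S
    by simp_all
  show thesis
  \<comment> \<open>Dependence is a property of a set of vectors: \<open>card S + 1\<close> distinct
    powers exceed the dimension, but a repeated power is invisible in the set. A repetition
    \<open>x ^ i = x ^ j\<close> is handled by the polynomial \<open>X^i - X^j\<close>.\<close>
  proof (cases "inj_on ((^) x) {..card S}")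
    case True
    then have "dependent ((^) x ` {..card S})"
      by (metis card_atMost card_image dim_UNIV dim_subset_UNIV
            independent_card_le_dim not_less_eq_eq subset_UNIV dimension_def)
    then obtain u where u: "\<exists>v\<in>(^) x ` {..card S}. u v \<noteq> 0"
        "(\<Sum>v\<in>(^) x ` {..card S}. scale (u v) v) = 0"
      by (subst (asm) dependent_finite) auto
    define P where "P = (\<Sum>i\<le>card S. Polynomial.monom (u (x ^ i)) i)"
    have "poly_apply P x = 0"
      using u(2) True by (simp add: P_def poly_apply_sum poly_apply_monom sum.reindex)
    moreover have "P \<noteq> 0"
    proof -
      obtain i where "i \<le> card S" "u (x ^ i) \<noteq> 0" using u(1) by auto
      then have "coeff P i \<noteq> 0" by (simp add: P_def coeff_sum coeff_monom)
      then show ?thesis by auto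
    qed
    ultimately show thesis using that by blast
  next
    case False
    then obtain i j where ij: "i \<noteq> j" "x ^ i = x ^ j" by (auto simp: inj_on_def)
    have "poly_apply (Polynomial.monom 1 i + Polynomial.monom (-1) j) x = 0"
      using ij(2) by (simp add: poly_apply_monom)
    moreover have "Polynomial.monom 1 i + Polynomial.monom (-1::'k) j \<noteq> 0"
    proof
      assume "Polynomial.monom 1 i + Polynomial.monom (-1::'k) j = 0"
      then have "coeff (Polynomial.monom 1 i + Polynomial.monom (-1::'k) j) i = 0" by simp
      then show False using ij(1) by (simp add: coeff_monom)
    qed
    ultimately show thesis using that by blast
  qed
qed

text \<open>\<open>X - c\<close> does not divide \<open>R\<close>, so its powers are coprime to
  \<open>R\<close>. In the induction, the Bezout identity for the first power is inserted as a
  factor 1 into the one for \<open>m\<close>.\<close>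

lemma linear_power_bezout:
  fixes R :: "'k::field poly"
  assumes "poly R c \<noteq> 0"
  obtains U V where "U * [:- c, 1:] ^ m + V * R = 1"
proof -
  have "\<exists>U V. U * [:- c, 1:] ^ m + V * R = 1"
  proof (induction m)
    case 0
    show ?case by (intro exI[of _ 1] exI[of _ 0]) simp
  next
    case (Suc m)
    then obtain U V where UV: "U * [:- c, 1:] ^ m + V * R = 1" by blast
    \<comment> \<open>Division with remainder gives \<open>R = (X - c) q + R(c)\<close>; dividing by
      the non-zero constant \<open>R(c)\<close> and solving for 1 yields \<open>S\<close> and
      \<open>T\<close>.\<close>
    define S where "S = Polynomial.smult (- inverse (poly R c)) (synthetic_div R c)"
    define T where "T = [:inverse (poly R c):]"
    have "T * R = Polynomial.smult (inverse (poly R c))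
        ([:- c, 1:] * synthetic_div R c + [:poly R c:])"
      by (simp only: synthetic_div_correct' T_def) simp
    also have "\<dots> = 1 - S * [:- c, 1:]"
      using assms by (simp add: S_def smult_add_right smult_diff_right one_pCons mult.commute)
    finally have ST: "S * [:- c, 1:] + T * R = 1" by simp
    have "(U * S) * [:- c, 1:] ^ Suc m + (U * [:- c, 1:] ^ m * T + V) * R
        = U * [:- c, 1:] ^ m * (S * [:- c, 1:] + T * R) + V * R"
      by (simp add: algebra_simps del: mult_pCons_right mult_pCons_left)
    also have "\<dots> = 1" using UV by (simp only: ST) simp
    finally show ?case by blast
  qed
  then show thesis using that by blast
qed

text \<open>
  The hypothesis on \<open>P\<close> says that \<open>P\<close> annihilates \<open>x\<close> inside the corner algebra with unit \<open>e\<close>.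
\<close>

lemma primitive_corner_nilpotent:
  fixes scale :: "'k::alg_closed_field \<Rightarrow> 'a::ring_1 \<Rightarrow> 'a"
  assumes "associative_algebra scale" "primitive_idempotent e" "e * x = x" "x * e = x"
    and "P \<noteq> 0" "e * associative_algebra.poly_apply scale P x = 0"
  shows "\<exists>c m. e * (x - scale c 1) ^ m = 0"
  using assms(5,6)
proof (induction P rule: measure_induct_rule[of degree])
  case (less P)
  interpret associative_algebra scale by fact
  have e: "e * e = e" "e \<noteq> 0" using assms(2) by (auto simp: primitive_idempotent_def)
  have comm: "e * poly_apply R x = poly_apply R x * e" for R
    by (induction R) (simp_all add: algebra_simps scale_mult_left scale_mult_right,
        metis assms(3,4) mult.assoc)
  \<comment> \<open>A non-zero constant cannot annihilate \<open>e\<close>, so algebraic closedness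
    supplies a root \<open>c\<close>. Its full multiplicity is then split off, which makes the
    cofactor \<open>R\<close> coprime to \<open>L\<close>.\<close>
  have "degree P \<noteq> 0"
  proof
    assume "degree P = 0"
    then obtain c where "P = [:c:]" using degree_eq_zeroE by blast
    then show False using less.prems e by (simp add: scale_mult_right)
  qed
  then obtain c where c: "poly P c = 0" using alg_closed_imp_poly_has_root by blast
  obtain R where R: "P = [:- c, 1:] ^ order c P * R" "\<not> [:- c, 1:] dvd R"
    using order_decomp[OF less.prems(1)] by blast
  define m where "m = order c P"
  define L where "L = [:- c, 1:] ^ m"
  have "m > 0" using c less.prems(1) by (simp add: m_def order_root)
  have L: "poly_apply L x = (x - scale c 1) ^ m"
    by (simp add: L_def scale_mult_right)
  have P: "P = L * R" using R(1) by (simp add: L_def m_def)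
  have "R \<noteq> 0" using less.prems(1) P by auto
  have "L \<noteq> 0" using less.prems(1) P by auto
  have "degree L = m" by (simp add: L_def degree_linear_power)
  have "degree R < degree P"
    using \<open>R \<noteq> 0\<close> \<open>L \<noteq> 0\<close> \<open>m > 0\<close> \<open>degree L = m\<close> by (simp add: P degree_mult_eq)
  have "poly R c \<noteq> 0" using R(2) by (simp add: poly_eq_0_iff_dvd)
  then obtain U V where UV: "U * L + V * R = 1"
    unfolding L_def by (rule linear_power_bezout)
  \<comment> \<open>Modulo \<open>P\<close> the coprime factors \<open>L\<close> and
    \<open>R\<close> give complementary idempotents of the corner. If \<open>f = 0\<close>, then
    \<open>L\<close> annihilates \<open>x\<close> there, which is the claim; if
    \<open>g = 0\<close>, then \<open>R\<close> does, and its degree is smaller.\<close>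
  define f where "f = e * poly_apply (U * L) x"
  define g where "g = e * poly_apply (V * R) x"
  have fg: "e = f + g"
    unfolding f_def g_def distrib_left[symmetric] poly_apply_add[symmetric] UV by simp
  have prod: "(e * poly_apply S x) * (e * poly_apply T x) = e * poly_apply (S * T) x" for S T
    by (metis comm e(1) mult.assoc poly_apply_mult)
  have kill: "(e * poly_apply S x) * (e * poly_apply T x) = 0" if "S * T = W * P" for S T W
    unfolding prod that prod[symmetric] less.prems(2) by simp
  have "f * g = 0"
    unfolding f_def g_def by (rule kill[of _ _ "U * V"]) (simp add: P mult_ac)
  have "g * f = 0"
    unfolding f_def g_def by (rule kill[of _ _ "U * V"]) (simp add: P mult_ac)
  have ef: "e * f = f" "f * e = f" "e * g = g" "g * e = g"
    unfolding f_def g_def by (metis comm e(1) mult.assoc)+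
  have "f * f = f" "g * g = g"
    using ef fg \<open>f * g = 0\<close> \<open>g * f = 0\<close>
    by (metis add.right_neutral distrib_left, metis add.left_neutral distrib_left)
  then have "f = 0 \<or> g = 0"
    using assms(2) fg \<open>f * g = 0\<close> \<open>g * f = 0\<close> unfolding primitive_idempotent_def by blast
  then show ?case
  proof
    assume "f = 0"
    then have "e = e * poly_apply (V * R) x" using fg by (simp add: g_def)
    then have "e * poly_apply L x = (e * poly_apply (V * R) x) * (e * poly_apply L x)"
      by (metis e(1) mult.assoc)
    also have "\<dots> = 0"
      by (rule kill[of _ _ V]) (simp add: P mult_ac)
    finally show ?thesis using L by auto
  next
    assume "g = 0"
    then have "e = e * poly_apply (U * L) x" using fg by (simp add: f_def)
    then have "e * poly_apply R x = (e * poly_apply (U * L) x) * (e * poly_apply R x)"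
      by (metis e(1) mult.assoc)
    also have "\<dots> = 0"
      by (rule kill[of _ _ U]) (simp add: P mult_ac)
    finally show ?thesis using less.IH[OF \<open>degree R < degree P\<close> \<open>R \<noteq> 0\<close>] by blast
  qed
qed

section \<open>Vector spaces and pullback squares\<close>

lemma ring_of_type_algebra_simps [simp]:
  "carrier ring_of_type_algebra = UNIV"
  "x \<otimes>\<^bsub>ring_of_type_algebra\<^esub> y = x * y"
  "x \<oplus>\<^bsub>ring_of_type_algebra\<^esub> y = x + y"
  "\<one>\<^bsub>ring_of_type_algebra\<^esub> = 1"
  "\<zero>\<^bsub>ring_of_type_algebra\<^esub> = 0"
  by (simp_all add: ring_of_type_algebra_def)

lemma linear_mapI:
  assumes "vectorspace K V" "vectorspace K W"
    and "\<And>x. x \<in> carrier V \<Longrightarrow> T x \<in> carrier W"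
    and "\<And>x y. x \<in> carrier V \<Longrightarrow> y \<in> carrier V \<Longrightarrow> T (x \<oplus>\<^bsub>V\<^esub> y) = T x \<oplus>\<^bsub>W\<^esub> T y"
    and "\<And>c x. c \<in> carrier K \<Longrightarrow> x \<in> carrier V \<Longrightarrow> T (c \<odot>\<^bsub>V\<^esub> x) = c \<odot>\<^bsub>W\<^esub> T x"
  shows "linear_map K V W T"
  using assms unfolding linear_map_def mod_hom_def mod_hom_axioms_def LinearCombinations.module_hom_def vectorspace_def
  by auto

lemma linear_mapD:
  assumes "linear_map K V W T"
  shows "vectorspace K V" "vectorspace K W"
    and "\<And>x. x \<in> carrier V \<Longrightarrow> T x \<in> carrier W"
    and "\<And>x y. x \<in> carrier V \<Longrightarrow> y \<in> carrier V \<Longrightarrow> T (x \<oplus>\<^bsub>V\<^esub> y) = T x \<oplus>\<^bsub>W\<^esub> T y"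
    and "\<And>c x. c \<in> carrier K \<Longrightarrow> x \<in> carrier V \<Longrightarrow> T (c \<odot>\<^bsub>V\<^esub> x) = c \<odot>\<^bsub>W\<^esub> T x"
proof -
  interpret linear_map K V W T by fact
  show "vectorspace K V" "vectorspace K W" by unfold_locales
  show "\<And>x. x \<in> carrier V \<Longrightarrow> T x \<in> carrier W"
    "\<And>x y. x \<in> carrier V \<Longrightarrow> y \<in> carrier V \<Longrightarrow> T (x \<oplus>\<^bsub>V\<^esub> y) = T x \<oplus>\<^bsub>W\<^esub> T y"
    "\<And>c x. c \<in> carrier K \<Longrightarrow> x \<in> carrier V \<Longrightarrow> T (c \<odot>\<^bsub>V\<^esub> x) = c \<odot>\<^bsub>W\<^esub> T x"
    by simp_all
qed

text \<open>The axioms are equations together with the existence of negatives, and these pass to any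
  image under a map compatible with the operations. This serves for quotients, whose operations on
  cosets are awkward to treat directly.\<close>

lemma vectorspace_surjective_image:
  assumes "vectorspace K V"
    and carrier: "carrier W = T ` carrier V"
    and T_add: "\<And>x y. x \<in> carrier V \<Longrightarrow> y \<in> carrier V \<Longrightarrow> T (x \<oplus>\<^bsub>V\<^esub> y) = T x \<oplus>\<^bsub>W\<^esub> T y"
    and T_smult: "\<And>c x. c \<in> carrier K \<Longrightarrow> x \<in> carrier V \<Longrightarrow> T (c \<odot>\<^bsub>V\<^esub> x) = c \<odot>\<^bsub>W\<^esub> T x"
    and T_zero: "T \<zero>\<^bsub>V\<^esub> = \<zero>\<^bsub>W\<^esub>"
  shows "vectorspace K W"
proof -
  interpret vectorspace K V by fact
  note sym = T_add[symmetric] T_smult[symmetric] T_zero[symmetric]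
  have "abelian_group W"
  proof (rule abelian_groupI)
    fix x assume "x \<in> carrier W"
    then obtain v where "v \<in> carrier V" "x = T v" by (auto simp: carrier)
    then show "\<exists>y\<in>carrier W. y \<oplus>\<^bsub>W\<^esub> x = \<zero>\<^bsub>W\<^esub>"
      by (intro bexI[of _ "T (\<ominus>\<^bsub>V\<^esub> v)"]) (auto simp: carrier sym M.l_neg)
  qed (auto simp: carrier sym M.a_ac)
  then have "Module.module K W"
    by (intro moduleI)
      (auto simp: carrier sym smult_l_distr smult_r_distr smult_assoc1 intro: R.is_cring)
  then show ?thesis by (simp add: vectorspace_def field_axioms)
qed

lemma linear_map_quotient_space:
  fixes M :: "('k, 'b) module"
  assumes "vectorspace K M" and sub: "N \<subseteq> carrier M" "\<zero>\<^bsub>M\<^esub> \<in> N"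
    and N_add: "\<And>x y. x \<in> N \<Longrightarrow> y \<in> N \<Longrightarrow> x \<oplus>\<^bsub>M\<^esub> y \<in> N"
    and N_smult: "\<And>c x. c \<in> carrier K \<Longrightarrow> x \<in> N \<Longrightarrow> c \<odot>\<^bsub>M\<^esub> x \<in> N"
  shows "linear_map K M (quotient_space M N) (\<lambda>x. N +>\<^bsub>M\<^esub> x)"
proof -
  interpret vectorspace K M by fact
  \<comment> \<open>Negatives are multiples by the scalar -1, so closure under scalars makes
    \<open>N\<close> a subgroup.\<close>
  have "\<ominus>\<^bsub>M\<^esub> x \<in> N" if "x \<in> N" for x
    using N_smult[of "\<ominus>\<^bsub>K\<^esub> \<one>\<^bsub>K\<^esub>" x] that sub by (auto simp: smult_l_minus subset_iff)
  then have "subgroup N (add_monoid M)"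
    using sub N_add by (intro subgroup.intro) (auto simp flip: a_inv_def)
  then have "abelian_subgroup N M"
    by (intro abelian_subgroupI3 additive_subgroup.intro M.abelian_group_axioms)
  then interpret N: abelian_subgroup N M .
  have add': "N +>\<^bsub>M\<^esub> (x \<oplus>\<^bsub>M\<^esub> y) = (N +>\<^bsub>M\<^esub> x) \<oplus>\<^bsub>quotient_space M N\<^esub> (N +>\<^bsub>M\<^esub> y)"
    if "x \<in> carrier M" "y \<in> carrier M" for x y
    using that by (simp add: quotient_space_def N.a_rcos_sum)
  have smult': "N +>\<^bsub>M\<^esub> (c \<odot>\<^bsub>M\<^esub> x) = c \<odot>\<^bsub>quotient_space M N\<^esub> (N +>\<^bsub>M\<^esub> x)"
    if c: "c \<in> carrier K" and x: "x \<in> carrier M" for c x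
  proof -
    \<comment> \<open>The scalar multiple of a coset is a union over all its representatives. They
      all produce the same coset, so the union collapses to a single term.\<close>
    have eq: "N +>\<^bsub>M\<^esub> (c \<odot>\<^bsub>M\<^esub> y) = N +>\<^bsub>M\<^esub> (c \<odot>\<^bsub>M\<^esub> x)" if y: "y \<in> N +>\<^bsub>M\<^esub> x" for y
    proof -
      obtain n where n: "n \<in> N" "y = n \<oplus>\<^bsub>M\<^esub> x"
        using y by (auto simp: a_r_coset_def r_coset_def)
      then have "c \<odot>\<^bsub>M\<^esub> y \<in> N +>\<^bsub>M\<^esub> (c \<odot>\<^bsub>M\<^esub> x)"
        using c x sub N_smult[OF c n(1)]
        by (auto simp: a_r_coset_def r_coset_def smult_r_distr subset_iff)
      moreover have "c \<odot>\<^bsub>M\<^esub> x \<in> carrier M" using c x by simp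
      ultimately have "N +>\<^bsub>M\<^esub> (c \<odot>\<^bsub>M\<^esub> x) = N +>\<^bsub>M\<^esub> (c \<odot>\<^bsub>M\<^esub> y)"
        by (rule N.a_repr_independence')
      then show ?thesis ..
    qed
    define U where "U = N +>\<^bsub>M\<^esub> x"
    define F where "F y = N +>\<^bsub>M\<^esub> (c \<odot>\<^bsub>M\<^esub> y)" for y
    have "F y = F x" if "y \<in> U" for y
      using that unfolding F_def U_def by (rule eq)
    moreover have "x \<in> U" unfolding U_def using x by (rule N.a_rcos_self)
    ultimately have "(\<Union>y\<in>U. F y) = F x" by blast
    then show ?thesis by (simp add: quotient_space_def F_def U_def)
  qed
  have "vectorspace K (quotient_space M N)"
  proof (rule vectorspace_surjective_image[where T = "\<lambda>x. N +>\<^bsub>M\<^esub> x"])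
    show "carrier (quotient_space M N) = (\<lambda>x. N +>\<^bsub>M\<^esub> x) ` carrier M"
      by (auto simp: quotient_space_def A_RCOSETS_def')
    show "N +>\<^bsub>M\<^esub> \<zero>\<^bsub>M\<^esub> = \<zero>\<^bsub>quotient_space M N\<^esub>"
      using sub by (simp add: quotient_space_def)
  qed (use assms(1) add' smult' in auto)
  then show "linear_map K M (quotient_space M N) (\<lambda>x. N +>\<^bsub>M\<^esub> x)"
    using assms(1) add' smult'
    by (intro linear_mapI) (auto simp: quotient_space_def A_RCOSETS_def')
qed

lemma vectorspaceI:
  fixes V :: "('k::field, 'b) module"
  assumes "abelian_group V"
    and "\<And>c x. x \<in> carrier V \<Longrightarrow> c \<odot>\<^bsub>V\<^esub> x \<in> carrier V"
    and "\<And>c d x. x \<in> carrier V \<Longrightarrow> (c + d) \<odot>\<^bsub>V\<^esub> x = c \<odot>\<^bsub>V\<^esub> x \<oplus>\<^bsub>V\<^esub> d \<odot>\<^bsub>V\<^esub> x"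
    and "\<And>c x y. x \<in> carrier V \<Longrightarrow> y \<in> carrier V \<Longrightarrow>
      c \<odot>\<^bsub>V\<^esub> (x \<oplus>\<^bsub>V\<^esub> y) = c \<odot>\<^bsub>V\<^esub> x \<oplus>\<^bsub>V\<^esub> c \<odot>\<^bsub>V\<^esub> y"
    and "\<And>c d x. x \<in> carrier V \<Longrightarrow> (c * d) \<odot>\<^bsub>V\<^esub> x = c \<odot>\<^bsub>V\<^esub> (d \<odot>\<^bsub>V\<^esub> x)"
    and "\<And>x. x \<in> carrier V \<Longrightarrow> 1 \<odot>\<^bsub>V\<^esub> x = x"
  shows "vectorspace ring_of_type_algebra V"
  unfolding vectorspace_def
  using assms by (auto intro!: moduleI cring_from_type_algebra field_from_type_algebra)

lemma (in associative_algebra) vectorspace_operator_space: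
  assumes "(\<lambda>_. 0) \<in> S" "\<And>D D'. D \<in> S \<Longrightarrow> D' \<in> S \<Longrightarrow> (\<lambda>x. D x + D' x) \<in> S"
    and "\<And>c D. D \<in> S \<Longrightarrow> (\<lambda>x. scale c (D x)) \<in> S"
  shows "vectorspace ring_of_type_algebra (operator_space scale S)"
proof (rule vectorspaceI)
  show "abelian_group (operator_space scale S)"
  proof (rule abelian_groupI)
    fix D assume "D \<in> carrier (operator_space scale S)"
    then show "\<exists>D'\<in>carrier (operator_space scale S).
        D' \<oplus>\<^bsub>operator_space scale S\<^esub> D = \<zero>\<^bsub>operator_space scale S\<^esub>"
      using assms(3)[of D "- 1"]
      by (intro bexI[of _ "\<lambda>x. - D x"]) (auto simp: operator_space_def)
  qed (use assms in \<open>auto simp: operator_space_def algebra_simps\<close>)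
qed (use assms in \<open>auto simp: operator_space_def scale_left_distrib scale_right_distrib\<close>)

section \<open>Spaces of homomorphisms from a group to the field\<close>

lemma hom_space_carrier_iff:
  "f \<in> carrier (hom_space G) \<longleftrightarrow> f \<in> extensional (carrier G) \<and>
     (\<forall>x\<in>carrier G. \<forall>y\<in>carrier G. f (x \<otimes>\<^bsub>G\<^esub> y) = f x + f y)"
  by (auto simp: hom_space_def hom_def)

lemma hom_space_mult:
  "f \<in> carrier (hom_space G) \<Longrightarrow> x \<in> carrier G \<Longrightarrow> y \<in> carrier G \<Longrightarrow> f (x \<otimes>\<^bsub>G\<^esub> y) = f x + f y"
  by (simp add: hom_space_carrier_iff)

lemma (in group) hom_space_one: "f \<in> carrier (hom_space G) \<Longrightarrow> f \<one> = 0"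
  using hom_space_mult[of f G \<one> \<one>] by (metis add_cancel_right_right l_one one_closed)

lemma (in group) hom_space_inv: "f \<in> carrier (hom_space G) \<Longrightarrow> x \<in> carrier G \<Longrightarrow> f (inv x) = - f x"
  using hom_space_mult[of f G "inv x" x] by (simp add: hom_space_one eq_neg_iff_add_eq_0)

lemma (in group) vectorspace_hom_space:
  "vectorspace ring_of_type_algebra (hom_space G :: ('k::field, 'a \<Rightarrow> 'k) module)"
proof (rule vectorspaceI)
  let ?H = "hom_space G :: ('k, 'a \<Rightarrow> 'k) module"
  have simps: "f \<oplus>\<^bsub>?H\<^esub> g = (\<lambda>x\<in>carrier G. f x + g x)"
    "c \<odot>\<^bsub>?H\<^esub> f = (\<lambda>x\<in>carrier G. c * f x)" "\<zero>\<^bsub>?H\<^esub> = (\<lambda>x\<in>carrier G. 0)" for f g c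
    by (simp_all add: hom_space_def)
  note defs = simps hom_space_carrier_iff
  show "abelian_group ?H"
  proof (rule abelian_groupI)
    fix f assume "f \<in> carrier ?H"
    then show "\<exists>g\<in>carrier ?H. g \<oplus>\<^bsub>?H\<^esub> f = \<zero>\<^bsub>?H\<^esub>"
      by (intro bexI[of _ "\<lambda>x\<in>carrier G. - f x"]) (auto simp: defs)
  qed (auto simp: defs fun_eq_iff extensional_def algebra_simps)
  show "c \<odot>\<^bsub>?H\<^esub> f \<in> carrier ?H" if "f \<in> carrier ?H" for c f
    using that by (auto simp: defs algebra_simps)
qed (auto simp: hom_space_def fun_eq_iff algebra_simps extensional_def)

context normal
begin

lemma iota_closed:
  assumes "f \<in> carrier (hom_space (G Mod H))"
  shows "iota G H f \<in> carrier (hom_space G)"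
proof -
  have "f (H #> x \<otimes> y) = f (H #> x) + f (H #> y)" if "x \<in> carrier G" "y \<in> carrier G" for x y
    using that hom_space_mult[OF assms, of "H #> x" "H #> y"]
    by (auto simp: rcos_sum carrier_FactGroup)
  then show ?thesis by (auto simp: hom_space_carrier_iff iota_def)
qed

lemma linear_map_iota:
  "linear_map ring_of_type_algebra (hom_space (G Mod H)) (hom_space G)
     (iota G H :: ('a set \<Rightarrow> 'k::field) \<Rightarrow> 'a \<Rightarrow> 'k)"
proof (rule linear_mapI)
  interpret Q: group "G Mod H" by (rule factorgroup_is_group)
  show "vectorspace ring_of_type_algebra (hom_space (G Mod H) :: ('k, 'a set \<Rightarrow> 'k) module)"
    by (rule Q.vectorspace_hom_space)
  show "vectorspace ring_of_type_algebra (hom_space G :: ('k, 'a \<Rightarrow> 'k) module)"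
    by (rule vectorspace_hom_space)
qed (auto simp: iota_closed, auto simp: hom_space_def iota_def fun_eq_iff carrier_FactGroup)

lemma inj_on_iota: "inj_on (iota G H) (carrier (hom_space (G Mod H)))"
proof (rule inj_onI)
  fix f g :: "'a set \<Rightarrow> 'c"
  assume f: "f \<in> carrier (hom_space (G Mod H))" and g: "g \<in> carrier (hom_space (G Mod H))"
    and eq: "iota G H f = iota G H g"
  have "f (H #> x) = g (H #> x)" if "x \<in> carrier G" for x
    using fun_cong[OF eq, of x] that by (simp add: iota_def)
  then show "f = g"
    using f g by (intro extensionalityI[of f "carrier (G Mod H)"])
      (auto simp: hom_space_carrier_iff carrier_FactGroup)
qed

text \<open>A homomorphism that is trivial on \<open>H\<close> is constant on the cosets of
  \<open>H\<close>, so any choice of representatives defines the factored map. The range of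
  \<open>iota\<close> is therefore the annihilator of \<open>H\<close>, and the lifting problem
  becomes a vanishing statement.\<close>

lemma iota_surj:
  assumes u: "u \<in> carrier (hom_space G)" and zero: "\<And>x. x \<in> H \<Longrightarrow> u x = 0"
  obtains f where "f \<in> carrier (hom_space (G Mod H))" "iota G H f = u"
proof -
  define f where "f = (\<lambda>U\<in>carrier (G Mod H). u (SOME x. x \<in> U))"
  have f: "f (H #> x) = u x" if x: "x \<in> carrier G" for x
  proof -
    have "x \<in> H #> x" using x is_subgroup by (rule rcos_self)
    then have "(SOME y. y \<in> H #> x) \<in> H #> x" by (rule someI)
    then obtain h where h: "h \<in> H" "(SOME y. y \<in> H #> x) = h \<otimes> x"
      by (auto simp: r_coset_def)
    then have "u (SOME y. y \<in> H #> x) = u x"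
      using hom_space_mult[OF u, of h x] x zero by simp
    moreover have "H #> x \<in> carrier (G Mod H)"
      using x by (auto simp: carrier_FactGroup)
    ultimately show ?thesis by (simp add: f_def)
  qed
  have "f \<in> carrier (hom_space (G Mod H))"
    using hom_space_mult[OF u]
    by (auto simp: hom_space_carrier_iff carrier_FactGroup rcos_sum f) (auto simp: f_def carrier_FactGroup)
  moreover have "iota G H f = u"
    using u f by (auto simp: iota_def hom_space_carrier_iff extensional_def)
  ultimately show thesis using that by blast
qed

end

text \<open>Injectivity of \<open>i\<close> makes the lift of a compatible pair unique. The
  mediating map can then be defined pointwise, and its linearity and uniqueness are checked after
  applying \<open>i\<close>.\<close>

lemma pullback_squareI:
  fixes K :: "'k ring" and P :: "('k, 'p) module" and U :: "('k, 'u) module"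
    and V :: "('k, 'v) module" and W :: "('k, 'w) module"
  assumes sq: "commutative_square K P U V W i t f g"
    and inj: "inj_on i (carrier P)"
    and lift: "\<And>u v. u \<in> carrier U \<Longrightarrow> v \<in> carrier V \<Longrightarrow> f u = g v \<Longrightarrow>
      \<exists>p\<in>carrier P. i p = u \<and> t p = v"
  shows "pullback_square TYPE('t) K P U V W i t f g"
  unfolding pullback_square_def
proof (intro conjI allI impI sq)
  fix T :: "('k, 't) module" and a b
  assume ab: "linear_map K T U a \<and> linear_map K T V b \<and> (\<forall>w\<in>carrier T. f (a w) = g (b w))"
  have i: "linear_map K P U i" using sq by (simp add: commutative_square_def)
  note iD = linear_mapD[OF i] and aD = linear_mapD[OF conjunct1[OF ab]]
    and bD = linear_mapD[OF conjunct1[OF conjunct2[OF ab]]]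
  interpret P: vectorspace K P by (rule iD(1))
  interpret T: vectorspace K T by (rule aD(1))
  define h where "h = (\<lambda>w\<in>carrier T. THE p. p \<in> carrier P \<and> i p = a w \<and> t p = b w)"
  have h: "h w \<in> carrier P \<and> i (h w) = a w \<and> t (h w) = b w" if w: "w \<in> carrier T" for w
  proof -
    obtain p where p: "p \<in> carrier P" "i p = a w" "t p = b w"
      using lift[of "a w" "b w"] ab aD(3) bD(3) w by blast
    then have "(THE p. p \<in> carrier P \<and> i p = a w \<and> t p = b w) = p"
      using inj by (intro the_equality) (auto simp: inj_on_def)
    then show ?thesis using p w by (simp add: h_def)
  qed
  have "linear_map K T P h"
  proof (rule linear_mapI[OF aD(1) iD(1)])
    fix x y assume xy: "x \<in> carrier T" "y \<in> carrier T"
    have "i (h (x \<oplus>\<^bsub>T\<^esub> y)) = i (h x \<oplus>\<^bsub>P\<^esub> h y)"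
      using xy h aD(4) iD(4) by simp
    then show "h (x \<oplus>\<^bsub>T\<^esub> y) = h x \<oplus>\<^bsub>P\<^esub> h y"
      using inj xy h by (auto simp: inj_on_def)
  next
    fix c x assume cx: "c \<in> carrier K" "x \<in> carrier T"
    have "i (h (c \<odot>\<^bsub>T\<^esub> x)) = i (c \<odot>\<^bsub>P\<^esub> h x)"
      using cx h aD(5) iD(5) by simp
    then show "h (c \<odot>\<^bsub>T\<^esub> x) = c \<odot>\<^bsub>P\<^esub> h x"
      using inj cx h by (auto simp: inj_on_def)
  qed (use h in simp)
  moreover have "h \<in> extensional (carrier T)" by (simp add: h_def)
  ultimately show "\<exists>!h. h \<in> extensional (carrier T) \<and> linear_map K T P h \<and>
      (\<forall>w\<in>carrier T. i (h w) = a w \<and> t (h w) = b w)"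
  proof (intro ex1I[of _ h] conjI ballI)
    fix h' assume h': "h' \<in> extensional (carrier T) \<and> linear_map K T P h' \<and>
      (\<forall>w\<in>carrier T. i (h' w) = a w \<and> t (h' w) = b w)"
    then show "h' = h"
      using h inj linear_mapD(3)[of K T P h'] \<open>h \<in> extensional (carrier T)\<close>
      by (intro extensionalityI[of h' "carrier T" h]) (auto simp: inj_on_def)
  qed (use h in auto)
qed

section \<open>Walks and the fundamental group\<close>

lemma path_target_Nil [simp]: "path_target Q (v, []) = v"
  by (simp add: path_target_def)

lemma path_target_Cons [simp]: "path_target Q (v, a # as) = path_target Q (head Q a, as)"
  by (simp add: path_target_def)

lemma fst_path_comp [simp]: "fst (q \<cdot> p) = fst p"
  and snd_path_comp [simp]: "snd (q \<cdot> p) = snd p @ snd q"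
  by (simp_all add: path_comp_def)

lemma path_comp_assoc: "(r \<cdot> q) \<cdot> p = r \<cdot> (q \<cdot> p)"
  by (simp add: path_comp_def)

lemma path_comp_trivial [simp]: "(v, []) \<cdot> p = p" "p \<cdot> (fst p, []) = p"
  by (simp_all add: path_comp_def)

lemma path_target_comp [simp]:
  "path_target Q p = fst q \<Longrightarrow> path_target Q (q \<cdot> p) = path_target Q q"
  by (auto simp: path_target_def)

context wf_digraph
begin

lemma paths_Nil [simp]: "(v, []) \<in> paths G \<longleftrightarrow> v \<in> verts G"
  by (simp add: paths_def awalk_Nil_iff)

lemma paths_Cons [simp]:
  "(v, a # as) \<in> paths G \<longleftrightarrow> a \<in> arcs G \<and> tail G a = v \<and> (head G a, as) \<in> paths G"
  by (auto simp: paths_def awalk_Cons_iff)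

lemma fst_in_verts: "p \<in> paths G \<Longrightarrow> fst p \<in> verts G"
  by (auto simp: paths_def awalk_def)

lemma path_target_in_verts: "p \<in> paths G \<Longrightarrow> path_target G p \<in> verts G"
  by (auto simp: paths_def intro: awalk_last_in_verts)

lemma path_comp_in_paths:
  assumes "path_target G p = fst q"
  shows "q \<cdot> p \<in> paths G \<longleftrightarrow> p \<in> paths G \<and> q \<in> paths G"
  using assms
proof (induction "snd p" arbitrary: p)
  case Nil
  then show ?case using fst_in_verts[of q] by (cases p) (auto simp: path_comp_def)
next
  case (Cons a as)
  have p: "p = (fst p, a # as)" using Cons(2) by (metis prod.collapse)
  have "path_target G (head G a, as) = fst q" using Cons(3) by (subst (asm) p) simp
  then have "q \<cdot> (head G a, as) \<in> paths G \<longleftrightarrow> (head G a, as) \<in> paths G \<and> q \<in> paths G"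
    using Cons(1)[of "(head G a, as)"] by simp
  then show ?case by (subst p, subst (2) p) (auto simp: path_comp_def)
qed

lemma wf_double_quiver: "wf_digraph (double_quiver G)"
  by unfold_locales (auto simp: double_quiver_def)

end

lemma paths_between_iff: "p \<in> paths_between Q x y \<longleftrightarrow> p \<in> paths Q \<and> fst p = x \<and> path_target Q p = y"
  by (simp add: paths_between_def)

lemma double_quiver_simps [simp]:
  "verts (double_quiver Q) = verts Q"
  "Arrow a \<in> arcs (double_quiver Q) \<longleftrightarrow> a \<in> arcs Q"
  "Inverse a \<in> arcs (double_quiver Q) \<longleftrightarrow> a \<in> arcs Q"
  "tail (double_quiver Q) (Arrow a) = tail Q a"
  "tail (double_quiver Q) (Inverse a) = head Q a"
  "head (double_quiver Q) (Arrow a) = head Q a"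
  "head (double_quiver Q) (Inverse a) = tail Q a"
  by (auto simp: double_quiver_def)

lemma inverse_letter_simps [simp]:
  "inverse_letter l \<in> arcs (double_quiver Q) \<longleftrightarrow> l \<in> arcs (double_quiver Q)"
  "tail (double_quiver Q) (inverse_letter l) = head (double_quiver Q) l"
  "head (double_quiver Q) (inverse_letter l) = tail (double_quiver Q) l"
  "inverse_letter (inverse_letter l) = l"
  by (cases l; simp)+

lemma fst_walk_of_path [simp]: "fst (walk_of_path p) = fst p"
  by (simp add: walk_of_path_def)

lemma walk_target_walk_of_path [simp]: "walk_target Q (walk_of_path p) = path_target Q p"
  by (simp add: walk_of_path_def path_target_def last_map)

lemma walk_of_path_comp: "walk_of_path (q \<cdot> p) = walk_of_path q \<cdot> walk_of_path p"
  by (simp add: walk_of_path_def path_comp_def)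

lemma (in wf_digraph) walk_of_path_in_walks: "walk_of_path p \<in> walks G \<longleftrightarrow> p \<in> paths G"
proof (induction "snd p" arbitrary: p)
  interpret D: wf_digraph "double_quiver G" by (rule wf_double_quiver)
  case Nil
  then show ?case by (cases p) (simp add: walk_of_path_def)
next
  interpret D: wf_digraph "double_quiver G" by (rule wf_double_quiver)
  case (Cons a as)
  have p: "p = (fst p, a # as)" using Cons(2) by (metis prod.collapse)
  show ?case using Cons(1)[of "(head G a, as)"]
    by (subst p, subst (2) p) (simp add: walk_of_path_def)
qed

lemma fst_inverse_walk [simp]: "fst (inverse_walk Q w) = walk_target Q w"
  by (simp add: inverse_walk_def)

lemma inverse_walk_Nil [simp]: "inverse_walk Q (v, []) = (v, [])"
  by (simp add: inverse_walk_def)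

lemma inverse_walk_Cons [simp]:
  "inverse_walk Q (v, l # ls) =
     (head (double_quiver Q) l, [inverse_letter l]) \<cdot> inverse_walk Q (head (double_quiver Q) l, ls)"
  by (simp add: inverse_walk_def path_comp_def)

lemma inverse_walk_comp:
  "walk_target Q v = fst u \<Longrightarrow> inverse_walk Q (u \<cdot> v) = inverse_walk Q v \<cdot> inverse_walk Q u"
  by (simp add: prod_eq_iff inverse_walk_def)

context wf_digraph
begin

lemma inverse_walk_in_walks_between:
  assumes "w \<in> walks_between G x y"
  shows "inverse_walk G w \<in> walks_between G y x"
proof -
  interpret D: wf_digraph "double_quiver G" by (rule wf_double_quiver)
  show ?thesis
    using assms
  proof (induction "snd w" arbitrary: w x)
    case Nil
    then show ?case by (cases w) (auto simp: paths_between_iff)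
  next
    case (Cons l ls)
    let ?h = "head (double_quiver G) l" let ?t = "tail (double_quiver G) l"
    have w: "w = (x, l # ls)" using Cons(2,3) by (cases w) (auto simp: paths_between_iff)
    have l: "l \<in> arcs (double_quiver G)" "?t = x" "(?h, ls) \<in> walks_between G ?h y"
      using Cons(3) by (auto simp: w paths_between_iff)
    then have IH: "inverse_walk G (?h, ls) \<in> walks_between G y ?h"
      using Cons(1)[of "(?h, ls)" ?h] by simp
    have "x \<in> verts G" using D.tail_in_verts[OF l(1)] l(2) by simp
    then have "(?h, [inverse_letter l]) \<in> walks_between G ?h x"
      using l(1,2) by (simp add: paths_between_iff)
    with IH show ?case
      unfolding w inverse_walk_Cons
      by (auto simp: paths_between_iff D.path_comp_in_paths)
  qed
qed

lemma inverse_walk_inverse_walk: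
  assumes "w \<in> walks_between G x y"
  shows "inverse_walk G (inverse_walk G w) = w"
  using assms inverse_walk_in_walks_between[OF assms]
  by (auto simp: paths_between_iff inverse_walk_def prod_eq_iff rev_map comp_def)

lemma comp_in_walks_between:
  assumes "u \<in> walks_between G y z" "v \<in> walks_between G x y"
  shows "u \<cdot> v \<in> walks_between G x z"
proof -
  interpret D: wf_digraph "double_quiver G" by (rule wf_double_quiver)
  show ?thesis using assms by (auto simp: paths_between_iff D.path_comp_in_paths)
qed

lemma trivial_in_walks_between: "x \<in> verts G \<Longrightarrow> (x, []) \<in> walks_between G x x"
  using wf_digraph.paths_Nil[OF wf_double_quiver] by (simp add: paths_between_iff)

lemma walks_between_verts:
  assumes "w \<in> walks_between G x y"
  shows "x \<in> verts G" "y \<in> verts G"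
proof -
  interpret D: wf_digraph "double_quiver G" by (rule wf_double_quiver)
  show "x \<in> verts G" "y \<in> verts G"
    using assms D.fst_in_verts[of w] D.path_target_in_verts[of w] by (auto simp: paths_between_iff)
qed

lemma walk_of_path_in_walks_between:
  "walk_of_path p \<in> walks_between G x y \<longleftrightarrow> p \<in> paths_between G x y"
  by (simp add: paths_between_iff walk_of_path_in_walks)

end

lemma subgraph_double_quiver:
  assumes "subgraph H G"
  shows "subgraph (double_quiver H) (double_quiver G)"
  using assms wf_digraph.wf_double_quiver[of H] wf_digraph.wf_double_quiver[of G]
  by (auto simp: subgraph_def compatible_def double_quiver_def)

lemma paths_between_subgraph:
  assumes "subgraph H G" and "p \<in> paths_between H x y"
  shows "p \<in> paths_between G x y"
proof -
  have th: "head G = head H" using assms(1) by (simp add: subgraph_def compatible_def)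
  then have target: "path_target G p = path_target H p" by (simp add: path_target_def)
  interpret wf_digraph G using assms(1) by (auto simp: subgraph_def)
  show ?thesis
    using assms(2) subgraph_awalk_imp_awalk[OF _ assms(1), of "fst p" "snd p" "path_target H p"]
    by (auto simp: paths_between_iff paths_def target)
qed

text \<open>Isolates the one property of the set of relations on which the theory of walks rests.
  For the ideal of a presentation it follows from the orthogonality of the vertices, in
  \<open>minimal_relation_parallel\<close>.\<close>

locale bound_quiver = wf_digraph Q
  for Q :: "('v, 'e) pre_digraph"
    and I :: "(('v, 'e) path \<Rightarrow>\<^sub>0 'k::field) set" +
  assumes relation_parallel:
    "minimal_relation I r \<Longrightarrow> p \<in> Poly_Mapping.keys r \<Longrightarrow> q \<in> Poly_Mapping.keys r \<Longrightarrow>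
      q \<in> paths_between Q (fst p) (path_target Q p)"
begin

sublocale double: wf_digraph "double_quiver Q"
  by (rule wf_double_quiver)

text \<open>The rule \<open>relation\<close> is the only one that could identify walks with
  different endpoints; \<open>relation_parallel\<close> prevents this.\<close>

lemma homotopic_endpoints:
  "homotopic Q I u v \<Longrightarrow> u \<in> walks_between Q (fst u) (walk_target Q u) \<and>
    v \<in> walks_between Q (fst u) (walk_target Q u)"
proof (induction rule: homotopic.induct)
  case (comp u u' v v')
  have "u \<cdot> v \<in> walks_between Q (fst v) (walk_target Q u)"
    using comp by (intro comp_in_walks_between[of _ "fst u"]) auto
  moreover have "u' \<cdot> v' \<in> walks_between Q (fst v) (walk_target Q u)"
    using comp by (intro comp_in_walks_between[of _ "fst u"]) (auto simp: paths_between_iff)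
  ultimately show ?case by (auto simp: paths_between_iff)
next
  case (relation r p q)
  then have "p \<in> paths_between Q (fst p) (path_target Q p)"
    "q \<in> paths_between Q (fst p) (path_target Q p)"
    using relation_parallel by blast+
  then show ?case by (simp add: walk_of_path_in_walks_between)
qed (auto simp: paths_between_iff path_comp_def)

lemma homotopic_comp:
  assumes "homotopic Q I u u'" "homotopic Q I v v'" "walk_target Q v = fst u"
  shows "homotopic Q I (u \<cdot> v) (u' \<cdot> v')"
  using assms homotopic_endpoints[OF assms(1)] homotopic_endpoints[OF assms(2)]
  by (intro homotopic.comp) (auto simp: paths_between_iff)

lemma homotopic_refl: "w \<in> walks_between Q x y \<Longrightarrow> homotopic Q I w w"
  by (intro homotopic.refl) (simp add: paths_between_iff)

lemma homotopic_inverse_letter: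
  assumes "l \<in> arcs (double_quiver Q)"
  shows "homotopic Q I ((head (double_quiver Q) l, [inverse_letter l]) \<cdot> (tail (double_quiver Q) l, [l]))
    (tail (double_quiver Q) l, [])"
proof (cases l)
  case (Arrow a)
  then show ?thesis using assms homotopic.inverse_left[of a Q I] by simp
next
  case (Inverse a)
  then show ?thesis using assms homotopic.inverse_right[of a Q I] by simp
qed

text \<open>The first letter of the walk and its inverse form the outermost pair of the product, so
  the induction cancels the inner product first and the outer pair last.\<close>

lemma homotopic_inverse_walk:
  assumes "w \<in> walks_between Q x y"
  shows "homotopic Q I (inverse_walk Q w \<cdot> w) (x, [])"
  using assms
proof (induction "snd w" arbitrary: w x)
  case Nil
  then have "w = (x, [])" "x \<in> verts Q"
    using walks_between_verts by (cases w; auto simp: paths_between_iff)+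
  then show ?case
    using homotopic_refl[OF trivial_in_walks_between] by simp
next
  case (Cons l ls)
  let ?h = "head (double_quiver Q) l"
  have w: "w = (x, l # ls)" using Cons(2,3) by (cases w) (auto simp: paths_between_iff)
  have l: "l \<in> arcs (double_quiver Q)" "tail (double_quiver Q) l = x"
    "(?h, ls) \<in> walks_between Q ?h y"
    using Cons(3) by (auto simp: w paths_between_iff)
  have x: "x \<in> verts Q" using walks_between_verts Cons(3) by blast
  have h: "?h \<in> verts Q" using walks_between_verts l(3) by blast
  have IH: "homotopic Q I (inverse_walk Q (?h, ls) \<cdot> (?h, ls)) (?h, [])"
    using Cons(1)[of "(?h, ls)" ?h] l(3) by simp
  have letter: "(x, [l]) \<in> walks_between Q x ?h" "(?h, [inverse_letter l]) \<in> walks_between Q ?h x"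
    using l(1,2) x h by (auto simp: paths_between_iff)
  have inv: "inverse_walk Q (?h, ls) \<in> walks_between Q y ?h"
    using l(3) by (rule inverse_walk_in_walks_between)
  have "homotopic Q I ((inverse_walk Q (?h, ls) \<cdot> (?h, ls)) \<cdot> (x, [l])) ((?h, []) \<cdot> (x, [l]))"
    by (intro homotopic_comp[OF IH] homotopic_refl[OF letter(1)]) simp
  then have "homotopic Q I ((?h, [inverse_letter l]) \<cdot> (inverse_walk Q (?h, ls) \<cdot> (?h, ls)) \<cdot> (x, [l]))
      ((?h, [inverse_letter l]) \<cdot> (x, [l]))"
    using inv l(3)
    by (intro homotopic_comp[OF homotopic_refl[OF letter(2)]])
      (auto simp: path_comp_assoc paths_between_iff)
  moreover have "homotopic Q I ((?h, [inverse_letter l]) \<cdot> (x, [l])) (x, [])"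
    using homotopic_inverse_letter[OF l(1)] l(2) by simp
  ultimately have "homotopic Q I ((?h, [inverse_letter l]) \<cdot> (inverse_walk Q (?h, ls) \<cdot> (?h, ls)) \<cdot> (x, [l])) (x, [])"
    by (rule homotopic.trans)
  moreover have "inverse_walk Q w \<cdot> w =
      (?h, [inverse_letter l]) \<cdot> (inverse_walk Q (?h, ls) \<cdot> (?h, ls)) \<cdot> (x, [l])"
    by (simp add: w) (simp add: path_comp_def)
  ultimately show ?case by simp
qed

lemma homotopic_inverse_walk_right:
  assumes "w \<in> walks_between Q x y"
  shows "homotopic Q I (w \<cdot> inverse_walk Q w) (y, [])"
  using homotopic_inverse_walk[OF inverse_walk_in_walks_between[OF assms]]
  by (simp add: inverse_walk_inverse_walk[OF assms])

lemma homotopic_cancel: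
  assumes "p \<in> walks_between Q y z" "m \<in> walks_between Q x y" "q \<in> walks_between Q w y"
  shows "homotopic Q I (p \<cdot> m \<cdot> inverse_walk Q m \<cdot> q) (p \<cdot> q)"
proof -
  have "homotopic Q I ((m \<cdot> inverse_walk Q m) \<cdot> q) ((y, []) \<cdot> q)"
    using assms inverse_walk_in_walks_between[OF assms(2)]
    by (intro homotopic_comp[OF homotopic_inverse_walk_right[OF assms(2)] homotopic_refl[OF assms(3)]])
      (simp add: paths_between_iff)
  then have "homotopic Q I (p \<cdot> ((m \<cdot> inverse_walk Q m) \<cdot> q)) (p \<cdot> (y, []) \<cdot> q)"
    using assms inverse_walk_in_walks_between[OF assms(2)]
    by (intro homotopic_comp[OF homotopic_refl[OF assms(1)]]) (auto simp: paths_between_iff)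
  then show ?thesis by (simp add: path_comp_assoc)
qed

lemma walk_class_eq: "homotopic Q I u v \<Longrightarrow> walk_class Q I u = walk_class Q I v"
  unfolding walk_class_def using homotopic.sym homotopic.trans by blast

lemma mem_walk_class: "w \<in> walks_between Q x y \<Longrightarrow> w \<in> walk_class Q I w"
  by (simp add: walk_class_def homotopic_refl)

end

locale pointed_bound_quiver = bound_quiver Q I
  for Q :: "('v, 'e) pre_digraph"
    and I :: "(('v, 'e) path \<Rightarrow>\<^sub>0 'k::field) set" +
  fixes b :: 'v
  assumes base: "b \<in> verts Q"
begin

section \<open>The group of homotopy classes of closed walks\<close>

abbreviation "\<pi> \<equiv> fundamental_group Q I b"

lemma carrier_fundamental_group: "carrier \<pi> = walk_class Q I ` walks_between Q b b"
  by (simp add: fundamental_group_def)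

lemma one_fundamental_group: "\<one>\<^bsub>\<pi>\<^esub> = walk_class Q I (b, [])"
  by (simp add: fundamental_group_def)

lemma walk_class_in_carrier: "w \<in> walks_between Q b b \<Longrightarrow> walk_class Q I w \<in> carrier \<pi>"
  by (simp add: carrier_fundamental_group)

text \<open>The product is a union over all pairs of representatives; since concatenation respects
  homotopy, every term of that union is the same class.\<close>

lemma mult_fundamental_group:
  assumes "u \<in> walks_between Q b b" "v \<in> walks_between Q b b"
  shows "walk_class Q I u \<otimes>\<^bsub>\<pi>\<^esub> walk_class Q I v = walk_class Q I (u \<cdot> v)"
proof -
  have "walk_class Q I (u' \<cdot> v') = walk_class Q I (u \<cdot> v)"
    if "u' \<in> walk_class Q I u" "v' \<in> walk_class Q I v" for u' v'
  proof -
    have "homotopic Q I (u \<cdot> v) (u' \<cdot> v')"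
      using that assms by (intro homotopic_comp) (auto simp: walk_class_def paths_between_iff)
    then show ?thesis by (rule walk_class_eq[symmetric])
  qed
  moreover have "u \<in> walk_class Q I u" "v \<in> walk_class Q I v"
    by (rule mem_walk_class[OF assms(1)], rule mem_walk_class[OF assms(2)])
  ultimately have "(\<Union>u'\<in>walk_class Q I u. \<Union>v'\<in>walk_class Q I v. walk_class Q I (u' \<cdot> v')) =
      walk_class Q I (u \<cdot> v)"
    by blast
  then show ?thesis by (simp add: fundamental_group_def)
qed

lemma group_fundamental_group: "group \<pi>"
proof (rule groupI)
  show "\<one>\<^bsub>\<pi>\<^esub> \<in> carrier \<pi>"
    unfolding one_fundamental_group by (intro walk_class_in_carrier trivial_in_walks_between base)
next
  fix U V assume "U \<in> carrier \<pi>" "V \<in> carrier \<pi>"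
  then show "U \<otimes>\<^bsub>\<pi>\<^esub> V \<in> carrier \<pi>"
    by (auto simp: carrier_fundamental_group mult_fundamental_group intro: comp_in_walks_between)
next
  fix U V W assume "U \<in> carrier \<pi>" "V \<in> carrier \<pi>" "W \<in> carrier \<pi>"
  then show "U \<otimes>\<^bsub>\<pi>\<^esub> V \<otimes>\<^bsub>\<pi>\<^esub> W = U \<otimes>\<^bsub>\<pi>\<^esub> (V \<otimes>\<^bsub>\<pi>\<^esub> W)"
    by (auto simp: carrier_fundamental_group mult_fundamental_group comp_in_walks_between
        path_comp_assoc)
next
  fix U assume "U \<in> carrier \<pi>"
  then obtain u where u: "u \<in> walks_between Q b b" "U = walk_class Q I u"
    by (auto simp: carrier_fundamental_group)
  then show "\<one>\<^bsub>\<pi>\<^esub> \<otimes>\<^bsub>\<pi>\<^esub> U = U"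
    by (simp add: one_fundamental_group mult_fundamental_group trivial_in_walks_between base)
  show "\<exists>V\<in>carrier \<pi>. V \<otimes>\<^bsub>\<pi>\<^esub> U = \<one>\<^bsub>\<pi>\<^esub>"
    using u inverse_walk_in_walks_between[OF u(1)] walk_class_eq[OF homotopic_inverse_walk[OF u(1)]]
    by (intro bexI[of _ "walk_class Q I (inverse_walk Q u)"])
      (simp_all add: mult_fundamental_group one_fundamental_group walk_class_in_carrier)
qed

sublocale group \<pi>
  by (rule group_fundamental_group)

lemma inv_fundamental_group:
  assumes "w \<in> walks_between Q b b"
  shows "inv\<^bsub>\<pi>\<^esub> (walk_class Q I w) = walk_class Q I (inverse_walk Q w)"
  using assms inverse_walk_in_walks_between[OF assms] walk_class_eq[OF homotopic_inverse_walk[OF assms]]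
  by (intro inv_equality)
    (simp_all add: mult_fundamental_group one_fundamental_group walk_class_in_carrier)

text \<open>On paths this is the factor by which the derivation of \<open>f\<close> rescales. It is
  set up for all walks so that inverse letters and the generators of the relative subgroup can be
  evaluated too.\<close>

definition parade_value ::
  "('v \<Rightarrow> ('v, 'e letter) path) \<Rightarrow> (('v, 'e letter) path set \<Rightarrow> 'k) \<Rightarrow> ('v, 'e letter) path \<Rightarrow> 'k" where
  "parade_value \<gamma> f w = f (walk_class Q I (inverse_walk Q (\<gamma> (walk_target Q w)) \<cdot> w \<cdot> \<gamma> (fst w)))"

lemma parade_walk_closed:
  assumes "parade_data Q b \<gamma>" "w \<in> walks_between Q x y"
  shows "inverse_walk Q (\<gamma> y) \<cdot> w \<cdot> \<gamma> x \<in> walks_between Q b b"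
proof -
  have "\<gamma> x \<in> walks_between Q b x" "\<gamma> y \<in> walks_between Q b y"
    using assms walks_between_verts[OF assms(2)] by (auto simp: parade_data_def)
  then show ?thesis
    by (rule comp_in_walks_between[OF inverse_walk_in_walks_between
          comp_in_walks_between[OF assms(2)], rotated])
qed

text \<open>Between the two closed walks stand \<open>\<gamma> y\<close> and its inverse, which
  cancel up to homotopy.\<close>

lemma parade_value_comp:
  assumes \<gamma>: "parade_data Q b \<gamma>" and f: "f \<in> carrier (hom_space \<pi>)"
    and u: "u \<in> walks_between Q y z" and v: "v \<in> walks_between Q x y"
  shows "parade_value \<gamma> f (u \<cdot> v) = parade_value \<gamma> f u + parade_value \<gamma> f v"
proof -
  have \<gamma>': "\<gamma> x \<in> walks_between Q b x" "\<gamma> y \<in> walks_between Q b y" "\<gamma> z \<in> walks_between Q b z"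
    using \<gamma> walks_between_verts[OF u] walks_between_verts[OF v] by (auto simp: parade_data_def)
  let ?u = "inverse_walk Q (\<gamma> z) \<cdot> u \<cdot> \<gamma> y" and ?v = "inverse_walk Q (\<gamma> y) \<cdot> v \<cdot> \<gamma> x"
  note closed = parade_walk_closed[OF \<gamma> u] parade_walk_closed[OF \<gamma> v]
  have zu: "inverse_walk Q (\<gamma> z) \<cdot> u \<in> walks_between Q y b"
    by (rule comp_in_walks_between[OF inverse_walk_in_walks_between[OF \<gamma>'(3)] u])
  have vx: "v \<cdot> \<gamma> x \<in> walks_between Q b y"
    by (rule comp_in_walks_between[OF v \<gamma>'(1)])
  have "homotopic Q I (?u \<cdot> ?v) (inverse_walk Q (\<gamma> z) \<cdot> u \<cdot> v \<cdot> \<gamma> x)"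
    using homotopic_cancel[OF zu \<gamma>'(2) vx] by (simp add: path_comp_assoc)
  then have "walk_class Q I (inverse_walk Q (\<gamma> z) \<cdot> u \<cdot> v \<cdot> \<gamma> x) = walk_class Q I ?u \<otimes>\<^bsub>\<pi>\<^esub> walk_class Q I ?v"
    by (simp add: mult_fundamental_group closed walk_class_eq)
  then show ?thesis
    using u v hom_space_mult[OF f closed[THEN walk_class_in_carrier]]
    by (auto simp: parade_value_def paths_between_iff path_comp_assoc)
qed

lemma parade_value_trivial:
  assumes "parade_data Q b \<gamma>" "f \<in> carrier (hom_space \<pi>)" "x \<in> verts Q"
  shows "parade_value \<gamma> f (x, []) = 0"
proof -
  note x = trivial_in_walks_between[OF assms(3)]
  have "parade_value \<gamma> f (x, []) = parade_value \<gamma> f (x, []) + parade_value \<gamma> f (x, [])"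
    using parade_value_comp[OF assms(1,2) x x] by (simp only: path_comp_trivial)
  then show ?thesis by (simp only: add_cancel_right_right)
qed

lemma parade_value_homotopic:
  assumes \<gamma>: "parade_data Q b \<gamma>" and h: "homotopic Q I u v"
  shows "parade_value \<gamma> f u = parade_value \<gamma> f v"
proof -
  have uv: "u \<in> walks_between Q (fst u) (walk_target Q u)" "v \<in> walks_between Q (fst u) (walk_target Q u)"
    using homotopic_endpoints[OF h] by auto
  then have \<gamma>': "\<gamma> (fst u) \<in> walks_between Q b (fst u)"
    "inverse_walk Q (\<gamma> (walk_target Q u)) \<in> walks_between Q (walk_target Q u) b"
    using \<gamma> walks_between_verts[OF uv(1)]
    by (auto simp: parade_data_def intro: inverse_walk_in_walks_between)
  have "homotopic Q I (inverse_walk Q (\<gamma> (walk_target Q u)) \<cdot> u \<cdot> \<gamma> (fst u))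
      (inverse_walk Q (\<gamma> (walk_target Q u)) \<cdot> v \<cdot> \<gamma> (fst u))"
    using uv \<gamma>'
    by (intro homotopic_comp h homotopic_refl[OF \<gamma>'(1)] homotopic_refl[OF \<gamma>'(2)])
      (auto simp: paths_between_iff)
  then show ?thesis
    using uv by (auto simp: parade_value_def paths_between_iff dest!: walk_class_eq)
qed

lemma parade_value_inverse:
  assumes \<gamma>: "parade_data Q b \<gamma>" and f: "f \<in> carrier (hom_space \<pi>)" and w: "w \<in> walks_between Q x y"
  shows "parade_value \<gamma> f (inverse_walk Q w) = - parade_value \<gamma> f w"
proof -
  have "parade_value \<gamma> f (inverse_walk Q w) + parade_value \<gamma> f w = 0"
    using parade_value_comp[OF \<gamma> f inverse_walk_in_walks_between[OF w] w]
      parade_value_homotopic[OF \<gamma> homotopic_inverse_walk[OF w]]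
      parade_value_trivial[OF \<gamma> f, of x] walks_between_verts[OF w] by simp
  then show ?thesis by (simp add: eq_neg_iff_add_eq_0)
qed

text \<open>The walk \<open>\<gamma> b\<close> may be non-trivial, but conjugation by its class is
  invisible to a homomorphism into an abelian group.\<close>

lemma parade_value_closed:
  assumes \<gamma>: "parade_data Q b \<gamma>" and f: "f \<in> carrier (hom_space \<pi>)" and w: "w \<in> walks_between Q b b"
  shows "parade_value \<gamma> f w = f (walk_class Q I w)"
proof -
  have \<gamma>b: "\<gamma> b \<in> walks_between Q b b" using \<gamma> base by (simp add: parade_data_def)
  note inv = inverse_walk_in_walks_between[OF \<gamma>b]
  have eq: "walk_class Q I (inverse_walk Q (\<gamma> b) \<cdot> w \<cdot> \<gamma> b) =
      inv\<^bsub>\<pi>\<^esub> (walk_class Q I (\<gamma> b)) \<otimes>\<^bsub>\<pi>\<^esub> (walk_class Q I w \<otimes>\<^bsub>\<pi>\<^esub> walk_class Q I (\<gamma> b))"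
    using w \<gamma>b inv by (simp add: inv_fundamental_group mult_fundamental_group comp_in_walks_between)
  note car = walk_class_in_carrier[OF \<gamma>b] walk_class_in_carrier[OF w]
  have "f (walk_class Q I (inverse_walk Q (\<gamma> b) \<cdot> w \<cdot> \<gamma> b)) = f (walk_class Q I w)"
    unfolding eq using car by (simp add: hom_space_mult[OF f] hom_space_inv[OF f])
  then show ?thesis using w by (simp add: parade_value_def paths_between_iff)
qed

text \<open>The contributions of the letters telescope along the walk, an inverse letter counting
  with the opposite sign. Only arrows of the subquiver have to be controlled, while the walks are
  evaluated in the large quiver.\<close>

lemma parade_value_potential:
  assumes \<gamma>: "parade_data Q b \<gamma>" and f: "f \<in> carrier (hom_space \<pi>)" and sub: "subgraph Q' Q"
    and arrow: "\<And>a. a \<in> arcs Q' \<Longrightarrow>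
      parade_value \<gamma> f (tail Q a, [Arrow a]) = \<phi> (head Q a) - \<phi> (tail Q a)"
    and w: "w \<in> walks_between Q' x y"
  shows "parade_value \<gamma> f w = \<phi> y - \<phi> x"
proof -
  interpret Q': wf_digraph Q' using sub by (auto simp: subgraph_def)
  interpret D': wf_digraph "double_quiver Q'" by (rule Q'.wf_double_quiver)
  have letter_value: "parade_value \<gamma> f (tail (double_quiver Q) l, [l]) =
      \<phi> (head (double_quiver Q) l) - \<phi> (tail (double_quiver Q) l)"
    if l: "l \<in> arcs (double_quiver Q')" for l
  proof (cases l)
    case (Inverse a)
    then have a: "a \<in> arcs Q'" "a \<in> arcs Q" using l sub by (auto simp: subgraph_def)
    have "(tail Q a, [Arrow a]) \<in> walks_between Q (tail Q a) (head Q a)"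
      using a by (simp add: paths_between_iff)
    from parade_value_inverse[OF \<gamma> f this] show ?thesis
      using arrow[OF a(1)] by (simp add: Inverse path_comp_def)
  qed (use l arrow in auto)
  have "(x, ls) \<in> walks_between Q' x y \<Longrightarrow> parade_value \<gamma> f (x, ls) = \<phi> y - \<phi> x" for ls
  proof (induction ls arbitrary: x)
    case Nil
    then have "x = y" "x \<in> verts Q"
      using sub by (auto simp: paths_between_iff subgraph_def)
    then show ?case by (simp add: parade_value_trivial[OF \<gamma> f])
  next
    case (Cons l ls)
    let ?h = "head (double_quiver Q) l"
    have th: "tail (double_quiver Q') = tail (double_quiver Q)" "head (double_quiver Q') = head (double_quiver Q)"
      using subgraph_double_quiver[OF sub] by (auto simp: subgraph_def compatible_def)
    have l: "l \<in> arcs (double_quiver Q')" "tail (double_quiver Q) l = x"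
      "(?h, ls) \<in> walks_between Q' ?h y"
      using Cons(2) by (auto simp: paths_between_iff th)
    have "l \<in> arcs (double_quiver Q)"
      using l(1) subgraph_double_quiver[OF sub] by (auto simp: subgraph_def)
    moreover have "?h \<in> verts Q"
      using Q'.walks_between_verts(1)[OF l(3)] sub by (auto simp: subgraph_def)
    ultimately have "(x, [l]) \<in> walks_between Q x ?h"
      using l(2) by (simp add: paths_between_iff)
    from parade_value_comp[OF \<gamma> f paths_between_subgraph[OF subgraph_double_quiver[OF sub] l(3)] this]
    show ?case using letter_value[OF l(1)] l(2) Cons(1)[OF l(3)] by (simp add: path_comp_def)
  qed
  moreover have "w = (x, snd w)" using w by (simp add: paths_between_iff prod_eq_iff)
  ultimately show ?thesis using w by metis
qed

section \<open>The subgroup of a subquiver and relative parades\<close>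

lemma relative_generator:
  assumes sub: "subgraph Q' Q" and u: "u \<in> walks_between Q' x y" "u' \<in> walks_between Q' x y"
    and v: "v \<in> walks_between Q b x"
  shows "inverse_walk Q v \<cdot> inverse_walk Q u' \<cdot> u \<cdot> v \<in> walks_between Q b b"
proof -
  have "u \<in> walks_between Q x y" "u' \<in> walks_between Q x y"
    using u paths_between_subgraph[OF subgraph_double_quiver[OF sub]] by auto
  then show ?thesis
    using v comp_in_walks_between inverse_walk_in_walks_between by metis
qed

text \<open>Conjugating a generator by the class of \<open>w\<close> replaces its tail
  \<open>v\<close> by \<open>v\<close> composed with the inverse of \<open>w\<close>, which is again
  a walk from \<open>b\<close>. The generating set itself is therefore stable under
  conjugation.\<close>

lemma normal_relative_subgroup:
  assumes sub: "subgraph Q' Q"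
  shows "relative_subgroup Q I b Q' \<lhd> \<pi>"
  unfolding relative_subgroup_def
proof (rule normal_generateI)
  let ?S = "{walk_class Q I (inverse_walk Q v \<cdot> inverse_walk Q u' \<cdot> u \<cdot> v) | u u' v x y.
    u \<in> walks_between Q' x y \<and> u' \<in> walks_between Q' x y \<and> v \<in> walks_between Q b x}"
  show "?S \<subseteq> carrier \<pi>"
    using relative_generator[OF sub] by (auto intro: walk_class_in_carrier)
  fix h g assume "h \<in> ?S" and g: "g \<in> carrier \<pi>"
  then obtain u u' v x y where h: "h = walk_class Q I (inverse_walk Q v \<cdot> inverse_walk Q u' \<cdot> u \<cdot> v)"
    and u: "u \<in> walks_between Q' x y" "u' \<in> walks_between Q' x y" and v: "v \<in> walks_between Q b x"
    by blast
  obtain w where w: "w \<in> walks_between Q b b" "g = walk_class Q I w"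
    using g by (auto simp: carrier_fundamental_group)
  note inv = inverse_walk_in_walks_between[OF w(1)]
  have vw: "v \<cdot> inverse_walk Q w \<in> walks_between Q b x"
    using v inv by (rule comp_in_walks_between)
  have "inverse_walk Q (v \<cdot> inverse_walk Q w) = w \<cdot> inverse_walk Q v"
    using v inv inverse_walk_inverse_walk[OF w(1)]
    by (subst inverse_walk_comp) (auto simp: paths_between_iff)
  then have "g \<otimes>\<^bsub>\<pi>\<^esub> h \<otimes>\<^bsub>\<pi>\<^esub> inv\<^bsub>\<pi>\<^esub> g =
      walk_class Q I (inverse_walk Q (v \<cdot> inverse_walk Q w) \<cdot> inverse_walk Q u' \<cdot> u \<cdot> (v \<cdot> inverse_walk Q w))"
    using relative_generator[OF sub u v] w inv
    by (simp add: h inv_fundamental_group mult_fundamental_group comp_in_walks_between path_comp_assoc)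
  moreover have "\<dots> \<in> ?S"
    unfolding mem_Collect_eq
    by (intro exI conjI, rule HOL.refl, rule u(1), rule u(2), rule vw)
  ultimately show "g \<otimes>\<^bsub>\<pi>\<^esub> h \<otimes>\<^bsub>\<pi>\<^esub> inv\<^bsub>\<pi>\<^esub> g \<in> ?S" by (rule ssubst)
qed

text \<open>On a generator the two contributions of \<open>v\<close> cancel and the difference of
  the values of \<open>u\<close> and \<open>u'\<close> remains.\<close>

lemma hom_zero_on_relative_subgroup:
  assumes \<gamma>: "parade_data Q b \<gamma>" and f: "f \<in> carrier (hom_space \<pi>)" and sub: "subgraph Q' Q"
    and eq: "\<And>u u' x y. u \<in> walks_between Q' x y \<Longrightarrow> u' \<in> walks_between Q' x y \<Longrightarrow>
      parade_value \<gamma> f u = parade_value \<gamma> f u'"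
    and g: "g \<in> relative_subgroup Q I b Q'"
  shows "f g = 0"
proof -
  let ?S = "{walk_class Q I (inverse_walk Q v \<cdot> inverse_walk Q u' \<cdot> u \<cdot> v) | u u' v x y.
    u \<in> walks_between Q' x y \<and> u' \<in> walks_between Q' x y \<and> v \<in> walks_between Q b x}"
  have S: "h \<in> carrier \<pi> \<and> f h = 0" if "h \<in> ?S" for h
  proof -
    obtain u u' v x y where h: "h = walk_class Q I (inverse_walk Q v \<cdot> inverse_walk Q u' \<cdot> u \<cdot> v)"
      and u: "u \<in> walks_between Q' x y" "u' \<in> walks_between Q' x y" and v: "v \<in> walks_between Q b x"
      using \<open>h \<in> ?S\<close> by blast
    have uQ: "u \<in> walks_between Q x y" "u' \<in> walks_between Q x y"
      using u paths_between_subgraph[OF subgraph_double_quiver[OF sub]] by auto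
    note cl = relative_generator[OF sub u v]
    note inv = inverse_walk_in_walks_between
    have "f h = parade_value \<gamma> f (inverse_walk Q v \<cdot> inverse_walk Q u' \<cdot> u \<cdot> v)"
      unfolding h by (rule parade_value_closed[OF \<gamma> f cl, symmetric])
    also have "\<dots> = - parade_value \<gamma> f v + (- parade_value \<gamma> f u' + (parade_value \<gamma> f u + parade_value \<gamma> f v))"
      by (simp add: parade_value_comp[OF \<gamma> f inv[OF v] comp_in_walks_between[OF inv[OF uQ(2)]
              comp_in_walks_between[OF uQ(1) v]]]
          parade_value_comp[OF \<gamma> f inv[OF uQ(2)] comp_in_walks_between[OF uQ(1) v]]
          parade_value_comp[OF \<gamma> f uQ(1) v] parade_value_inverse[OF \<gamma> f v]
          parade_value_inverse[OF \<gamma> f uQ(2)])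
    also have "\<dots> = 0" using eq[OF u] by simp
    finally show ?thesis using cl by (simp add: h walk_class_in_carrier)
  qed
  have "g \<in> generate \<pi> ?S" using g by (simp add: relative_subgroup_def)
  then have "g \<in> carrier \<pi> \<and> f g = 0"
  proof (induction rule: generate.induct)
    case one
    then show ?case using hom_space_one[OF f] by simp
  next
    case (incl h)
    then show ?case using S by blast
  next
    case (inv h)
    then show ?case using S[of h] hom_space_inv[OF f] by simp
  next
    case (eng h1 h2)
    then show ?case using hom_space_mult[OF f] by simp
  qed
  then show ?thesis by simp
qed

text \<open>Source and target of \<open>p\<close> lie in one component \<open>C\<close>, so both
  parade walks begin with the same \<open>to_base C\<close>. In the shape of a generator this common
  part is \<open>v\<close>, the walk \<open>inside C\<close> to the source followed by
  \<open>p\<close> is \<open>u\<close>, and \<open>inside C\<close> to the target is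
  \<open>u'\<close>.\<close>

lemma relative_parade_class:
  assumes sub: "subgraph Q' Q" and \<gamma>: "relative_parade_data Q b Q' \<gamma>" and p: "p \<in> paths Q'"
  shows "parade_class Q I \<gamma> p \<in> relative_subgroup Q I b Q'"
proof -
  interpret Q': wf_digraph Q' using sub by (auto simp: subgraph_def)
  obtain bs to_base inside where parade: "\<And>C. C \<in> components Q' \<Longrightarrow> bs C \<in> C \<and>
      to_base C \<in> walks_between Q b (bs C) \<and>
      (\<forall>y\<in>C. inside C y \<in> walks_between Q' (bs C) y \<and> \<gamma> y = inside C y \<cdot> to_base C)"
    using \<gamma> unfolding relative_parade_data_def by blast
  let ?x = "fst p" let ?y = "path_target Q' p"
  have xy: "?x \<in> verts Q'" "?y \<in> verts Q'"
    using p Q'.fst_in_verts Q'.path_target_in_verts by auto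
  have target: "path_target Q p = ?y"
    using sub by (simp add: path_target_def subgraph_def compatible_def)
  have wp: "walk_of_path p \<in> walks_between Q' ?x ?y"
    using p by (simp add: Q'.walk_of_path_in_walks paths_between_iff)
  define C where "C = {y. walks_between Q' ?x y \<noteq> {}}"
  have "C \<in> components Q'" using xy by (auto simp: C_def components_def)
  note parade = parade[OF this]
  have "?x \<in> C" "?y \<in> C"
    using wp Q'.trivial_in_walks_between[OF xy(1)] by (auto simp: C_def)
  then have x: "inside C ?x \<in> walks_between Q' (bs C) ?x" "\<gamma> ?x = inside C ?x \<cdot> to_base C"
    and y: "inside C ?y \<in> walks_between Q' (bs C) ?y" "\<gamma> ?y = inside C ?y \<cdot> to_base C"
    and t: "to_base C \<in> walks_between Q b (bs C)"
    using parade by auto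
  have yQ: "inside C ?y \<in> walks_between Q (bs C) ?y"
    using y(1) by (rule paths_between_subgraph[OF subgraph_double_quiver[OF sub]])
  have "inverse_walk Q (\<gamma> ?y) = inverse_walk Q (to_base C) \<cdot> inverse_walk Q (inside C ?y)"
    unfolding y(2) using t yQ by (intro inverse_walk_comp) (simp add: paths_between_iff)
  then have "parade_class Q I \<gamma> p = walk_class Q I (inverse_walk Q (to_base C) \<cdot>
      inverse_walk Q (inside C ?y) \<cdot> (walk_of_path p \<cdot> inside C ?x) \<cdot> to_base C)"
    by (simp add: parade_class_def target x(2) path_comp_assoc)
  moreover have wx: "walk_of_path p \<cdot> inside C ?x \<in> walks_between Q' (bs C) ?y"
    using wp x(1) by (rule Q'.comp_in_walks_between)
  ultimately show ?thesis
    unfolding relative_subgroup_def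
    by (intro generate.incl, unfold mem_Collect_eq)
      (intro exI conjI, assumption, rule wx, rule y(1), rule t)
qed

lemma parade_class_eq:
  "p \<in> paths Q \<Longrightarrow> f (parade_class Q I \<gamma> p) = parade_value \<gamma> f (walk_of_path p)"
  by (simp add: parade_class_def parade_value_def)

lemma parade_class_in_carrier:
  "parade_data Q b \<gamma> \<Longrightarrow> p \<in> paths Q \<Longrightarrow> parade_class Q I \<gamma> p \<in> carrier \<pi>"
  unfolding parade_class_def
  by (intro walk_class_in_carrier parade_walk_closed)
    (simp_all add: walk_of_path_in_walks paths_between_iff)

end

section \<open>Derivations that rescale paths\<close>

locale algebra_presentation = associative_algebra scale
  for scale :: "'k::field \<Rightarrow> 'a::ring_1 \<Rightarrow> 'a" +
  fixes E :: "'a set" and Q :: "('v, 'e) pre_digraph" and \<nu> :: "(('v, 'e) path \<Rightarrow>\<^sub>0 'k) \<Rightarrow> 'a"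
  assumes pres: "presentation scale UNIV E Q \<nu>"
    and idempotents: "complete_orthogonal_idempotents E"
begin

abbreviation path_val :: "('v, 'e) path \<Rightarrow> 'a" where
  "path_val p \<equiv> \<nu> (path_elem p)"

abbreviation vertex_val :: "'v \<Rightarrow> 'a" where
  "vertex_val v \<equiv> path_val (v, [])"

abbreviation ideal :: "(('v, 'e) path \<Rightarrow>\<^sub>0 'k) set" where
  "ideal \<equiv> presentation_ideal scale Q \<nu>"

sublocale wf_digraph Q
  using pres by (simp add: presentation_def)

lemma hom: "\<nu> \<in> ring_hom (path_algebra Q) (algebra_on scale UNIV)"
  and mod_hom: "\<nu> \<in> LinearCombinations.module_hom ring_of_type_algebra (path_algebra Q) (algebra_on scale UNIV)"
  using pres by (simp_all add: presentation_def)

lemma \<nu>_add: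
  "Poly_Mapping.keys x \<subseteq> paths Q \<Longrightarrow> Poly_Mapping.keys y \<subseteq> paths Q \<Longrightarrow> \<nu> (x + y) = \<nu> x + \<nu> y"
  using ring_hom_add[OF hom, of x y] by (simp add: path_algebra_def algebra_on_def)

lemma \<nu>_smult:
  "Poly_Mapping.keys x \<subseteq> paths Q \<Longrightarrow> \<nu> (Poly_Mapping.map ((*) c) x) = scale c (\<nu> x)"
  using module_hom_smult[OF mod_hom, of c x] by (simp add: path_algebra_def algebra_on_def)

lemma \<nu>_0 [simp]: "\<nu> 0 = 0"
  using \<nu>_add[of 0 0] by simp

lemma \<nu>_sum:
  "(\<And>i. i \<in> S \<Longrightarrow> Poly_Mapping.keys (x i) \<subseteq> paths Q) \<Longrightarrow> \<nu> (sum x S) = (\<Sum>i\<in>S. \<nu> (x i))"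
proof (induction S rule: infinite_finite_induct)
  case (insert i S)
  have "Poly_Mapping.keys (sum x S) \<subseteq> (\<Union>i\<in>S. Poly_Mapping.keys (x i))"
    by (rule Poly_Mapping.keys_sum)
  also have "\<dots> \<subseteq> paths Q" using insert.prems by auto
  finally show ?case using insert by (simp add: \<nu>_add)
qed simp_all

lemma \<nu>_single: "p \<in> paths Q \<Longrightarrow> \<nu> (Poly_Mapping.single p c) = scale c (path_val p)"
  using \<nu>_smult[of "path_elem p" c] by (simp add: map_single)

lemma poly_mapping_sum_single:
  fixes x :: "('v, 'e) path \<Rightarrow>\<^sub>0 'k"
  shows "x = (\<Sum>p\<in>Poly_Mapping.keys x. Poly_Mapping.single p (Poly_Mapping.lookup x p))"
  by (rule poly_mapping_eqI)
    (simp add: lookup_sum lookup_single when_def in_keys_iff)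

lemma \<nu>_expand:
  assumes "Poly_Mapping.keys x \<subseteq> paths Q"
  shows "\<nu> x = (\<Sum>p\<in>Poly_Mapping.keys x. scale (Poly_Mapping.lookup x p) (path_val p))"
proof -
  have "\<nu> x = \<nu> (\<Sum>p\<in>Poly_Mapping.keys x. Poly_Mapping.single p (Poly_Mapping.lookup x p))"
    by (rule arg_cong[OF poly_mapping_sum_single])
  also have "\<dots> = (\<Sum>p\<in>Poly_Mapping.keys x. \<nu> (Poly_Mapping.single p (Poly_Mapping.lookup x p)))"
    using assms by (intro \<nu>_sum) auto
  also have "\<dots> = (\<Sum>p\<in>Poly_Mapping.keys x. scale (Poly_Mapping.lookup x p) (path_val p))"
    by (rule sum.cong[OF HOL.refl], rule \<nu>_single) (use assms in blast)
  finally show ?thesis .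
qed

lemma \<nu>_surj:
  obtains x where "Poly_Mapping.keys x \<subseteq> paths Q" "\<nu> x = a"
proof -
  have "a \<in> \<nu> ` carrier (path_algebra Q)" using pres by (simp add: presentation_def)
  then show thesis using that by (auto simp: path_algebra_def)
qed

text \<open>Surjectivity of \<open>\<nu>\<close> means that the values of paths span the algebra; a
  property stable under linear combinations need only be checked on them.\<close>

lemma path_induct [case_names path zero add scale]:
  assumes "\<And>p. p \<in> paths Q \<Longrightarrow> P (path_val p)" "P 0" "\<And>x y. P x \<Longrightarrow> P y \<Longrightarrow> P (x + y)"
    and "\<And>c x. P x \<Longrightarrow> P (scale c x)"
  shows "P a"
proof -
  obtain x where x: "Poly_Mapping.keys x \<subseteq> paths Q" "\<nu> x = a" by (rule \<nu>_surj)
  have "P (\<Sum>p\<in>S. scale (Poly_Mapping.lookup x p) (path_val p))" if "finite S" "S \<subseteq> paths Q" for S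
    using that by (induction S rule: finite_induct) (auto intro: assms)
  from this[OF finite_keys x(1)] show ?thesis using \<nu>_expand[OF x(1)] x(2) by simp
qed

lemma path_val_mult:
  assumes "p \<in> paths Q" "q \<in> paths Q"
  shows "path_val q * path_val p = (if path_target Q p = fst q then path_val (q \<cdot> p) else 0)"
  using ring_hom_mult[OF hom, of "path_elem q" "path_elem p"] assms
  by (auto simp: path_algebra_def algebra_on_def lookup_single when_def)

lemma vertex_val_mult:
  "v \<in> verts Q \<Longrightarrow> w \<in> verts Q \<Longrightarrow> vertex_val v * vertex_val w = (if v = w then vertex_val v else 0)"
  by (simp add: path_val_mult path_comp_def)

lemma target_val_mult:
  "p \<in> paths Q \<Longrightarrow> v \<in> verts Q \<Longrightarrow>
     vertex_val v * path_val p = (if v = path_target Q p then path_val p else 0)"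
  by (auto simp: path_val_mult)

lemma source_val_mult:
  "p \<in> paths Q \<Longrightarrow> v \<in> verts Q \<Longrightarrow> path_val p * vertex_val v = (if v = fst p then path_val p else 0)"
  by (auto simp: path_val_mult)

lemma finite_verts: "finite (verts Q)"
  and vertex_val_in: "v \<in> verts Q \<Longrightarrow> vertex_val v \<in> E"
proof -
  have bij: "bij_betw vertex_val (verts Q) E" using pres by (simp add: presentation_def)
  have "finite E" using idempotents by (simp add: complete_orthogonal_idempotents_def)
  then show "finite (verts Q)" using bij_betw_finite[OF bij] by simp
  show "v \<in> verts Q \<Longrightarrow> vertex_val v \<in> E" using bij by (auto simp: bij_betw_def)
qed

lemma vertex_val_nonzero: "v \<in> verts Q \<Longrightarrow> vertex_val v \<noteq> 0"
  using vertex_val_in[of v] idempotents by (auto simp: complete_orthogonal_idempotents_def)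

section \<open>Relations, subsums and minimal relations\<close>

lemma mem_ideal_iff: "x \<in> ideal \<longleftrightarrow> Poly_Mapping.keys x \<subseteq> paths Q \<and> \<nu> x = 0"
  by (simp add: presentation_ideal_def a_kernel_def' path_algebra_def algebra_on_def)

definition subsum :: "(('v, 'e) path \<Rightarrow>\<^sub>0 'k) \<Rightarrow> ('v, 'e) path set \<Rightarrow> (('v, 'e) path \<Rightarrow>\<^sub>0 'k)" where
  "subsum x S = (\<Sum>p\<in>S. Poly_Mapping.single p (Poly_Mapping.lookup x p))"

lemma lookup_subsum:
  "finite S \<Longrightarrow> Poly_Mapping.lookup (subsum x S) p = (if p \<in> S then Poly_Mapping.lookup x p else 0)"
  by (simp add: subsum_def lookup_sum lookup_single when_def)

lemma keys_subsum: "S \<subseteq> Poly_Mapping.keys x \<Longrightarrow> Poly_Mapping.keys (subsum x S) = S"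
  using finite_subset[OF _ finite_keys, of S x]
  by (auto simp: in_keys_iff lookup_subsum split: if_splits)

lemma minimal_relation_iff:
  "minimal_relation I r \<longleftrightarrow> r \<in> I \<and> (\<forall>S. S \<noteq> {} \<and> S \<subset> Poly_Mapping.keys r \<longrightarrow> subsum r S \<notin> I)"
  by (simp add: minimal_relation_def subsum_def)

lemma \<nu>_subsum:
  "S \<subseteq> Poly_Mapping.keys x \<Longrightarrow> Poly_Mapping.keys x \<subseteq> paths Q \<Longrightarrow>
     \<nu> (subsum x S) = (\<Sum>p\<in>S. scale (Poly_Mapping.lookup x p) (path_val p))"
proof -
  assume "S \<subseteq> Poly_Mapping.keys x" "Poly_Mapping.keys x \<subseteq> paths Q"
  then have S: "S \<subseteq> paths Q" by blast
  have "\<nu> (subsum x S) = (\<Sum>p\<in>S. \<nu> (Poly_Mapping.single p (Poly_Mapping.lookup x p)))"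
    unfolding subsum_def using S by (intro \<nu>_sum) auto
  also have "\<dots> = (\<Sum>p\<in>S. scale (Poly_Mapping.lookup x p) (path_val p))"
    by (rule sum.cong[OF HOL.refl], rule \<nu>_single) (use S in blast)
  finally show ?thesis .
qed

text \<open>
  Cutting a relation down by the idempotents of the endpoints of one of its paths leaves a
  subsum, which is again a relation.
\<close>

lemma minimal_relation_parallel:
  assumes r: "minimal_relation ideal r" and p: "p \<in> Poly_Mapping.keys r" and q: "q \<in> Poly_Mapping.keys r"
  shows "q \<in> paths_between Q (fst p) (path_target Q p)"
proof -
  have r': "Poly_Mapping.keys r \<subseteq> paths Q" "\<nu> r = 0"
    using r by (auto simp: minimal_relation_iff mem_ideal_iff)
  define S where "S = {q \<in> Poly_Mapping.keys r. fst q = fst p \<and> path_target Q q = path_target Q p}"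
  have S: "S \<subseteq> Poly_Mapping.keys r" by (auto simp: S_def)
  have pQ: "p \<in> paths Q" using p r' by auto
  note v = fst_in_verts[OF pQ] path_target_in_verts[OF pQ]
  have "0 = vertex_val (path_target Q p) * \<nu> r * vertex_val (fst p)"
    using r' by simp
  also have "\<dots> = (\<Sum>q\<in>Poly_Mapping.keys r. scale (Poly_Mapping.lookup r q)
      (vertex_val (path_target Q p) * path_val q * vertex_val (fst p)))"
    by (simp add: \<nu>_expand[OF r'(1)] sum_distrib_left sum_distrib_right scale_mult_left scale_mult_right)
  also have "\<dots> = (\<Sum>q\<in>Poly_Mapping.keys r. if q \<in> S then scale (Poly_Mapping.lookup r q) (path_val q) else 0)"
  proof (rule sum.cong)
    fix q assume q: "q \<in> Poly_Mapping.keys r"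
    then have "q \<in> paths Q" using r'(1) by auto
    then have "vertex_val (path_target Q p) * path_val q * vertex_val (fst p) = (if q \<in> S then path_val q else 0)"
      using v q by (cases "path_target Q q = path_target Q p")
        (auto simp: S_def target_val_mult source_val_mult)
    then show "scale (Poly_Mapping.lookup r q) (vertex_val (path_target Q p) * path_val q * vertex_val (fst p)) =
        (if q \<in> S then scale (Poly_Mapping.lookup r q) (path_val q) else 0)"
      by simp
  qed simp
  also have "\<dots> = (\<Sum>q\<in>S. scale (Poly_Mapping.lookup r q) (path_val q))"
    using S by (intro sum.mono_neutral_cong_right) auto
  also have "\<dots> = \<nu> (subsum r S)"
    by (rule \<nu>_subsum[OF S r'(1), symmetric])
  finally have "subsum r S \<in> ideal"
    using S r' keys_subsum[OF S] by (auto simp: mem_ideal_iff)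
  moreover have "p \<in> S" using p by (simp add: S_def)
  \<comment> \<open>\<open>S\<close> contains \<open>p\<close>, so it is a non-empty support of a
    subsum in the ideal; minimality leaves no room for it to be proper.\<close>
  ultimately have "\<not> S \<subset> Poly_Mapping.keys r"
    using r unfolding minimal_relation_iff by blast
  then have "S = Poly_Mapping.keys r" using S by auto
  then have "q \<in> S" using q by simp
  then show ?thesis using q r'(1) by (auto simp: S_def paths_between_iff)
qed

sublocale bound_quiver Q ideal
  by unfold_locales (rule minimal_relation_parallel)

definition rescale :: "(('v, 'e) path \<Rightarrow> 'k) \<Rightarrow> (('v, 'e) path \<Rightarrow>\<^sub>0 'k) \<Rightarrow> (('v, 'e) path \<Rightarrow>\<^sub>0 'k)" where
  "rescale \<chi> = Poly_Mapping.mapp (\<lambda>p c. \<chi> p * c)"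

lemma lookup_rescale [simp]: "Poly_Mapping.lookup (rescale \<chi> x) p = \<chi> p * Poly_Mapping.lookup x p"
  by (simp add: rescale_def lookup_mapp when_def in_keys_iff)

lemma keys_rescale: "Poly_Mapping.keys (rescale \<chi> x) \<subseteq> Poly_Mapping.keys x"
  by (auto simp: in_keys_iff)

lemma rescale_add: "rescale \<chi> (x + y) = rescale \<chi> x + rescale \<chi> y"
  by (rule poly_mapping_eqI) (simp add: lookup_add algebra_simps)

lemma rescale_map: "rescale \<chi> (Poly_Mapping.map ((*) c) x) = Poly_Mapping.map ((*) c) (rescale \<chi> x)"
  by (rule poly_mapping_eqI) (simp add: Poly_Mapping.map.rep_eq when_def)

text \<open>
  Every relation is a sum of minimal relations with disjoint supports, on each of which \<open>\<chi>\<close> is constant.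
\<close>

lemma \<nu>_rescale_0:
  assumes \<chi>: "\<And>r p q. minimal_relation ideal r \<Longrightarrow> p \<in> Poly_Mapping.keys r \<Longrightarrow>
      q \<in> Poly_Mapping.keys r \<Longrightarrow> \<chi> p = \<chi> q"
    and "r \<in> ideal"
  shows "\<nu> (rescale \<chi> r) = 0"
  using assms(2)
proof (induction "card (Poly_Mapping.keys r)" arbitrary: r rule: less_induct)
  case less
  show ?case
  proof (cases "r = 0")
    case True
    then have "rescale \<chi> r = 0" by (intro poly_mapping_eqI) simp
    then show ?thesis by simp
  next
    case False
    define \<S> where "\<S> = {S. S \<noteq> {} \<and> S \<subseteq> Poly_Mapping.keys r \<and> subsum r S \<in> ideal}"
    have "subsum r (Poly_Mapping.keys r) = r"
      unfolding subsum_def by (rule poly_mapping_sum_single[symmetric])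
    then have "Poly_Mapping.keys r \<in> \<S>" using False less.prems by (simp add: \<S>_def)
    moreover have "finite \<S>" by (rule finite_subset[of _ "Pow (Poly_Mapping.keys r)"]) (auto simp: \<S>_def)
    \<comment> \<open>An inclusion-minimal non-empty support of a subsum in the ideal carries a
      minimal relation. It is split off, and the induction applies to the remainder, which has fewer
      paths.\<close>
    ultimately obtain S where S: "S \<in> \<S>" and least: "\<And>T. T \<in> \<S> \<Longrightarrow> T \<subseteq> S \<Longrightarrow> S = T"
      using finite_has_minimal[of \<S>] by blast
    have S': "S \<noteq> {}" "S \<subseteq> Poly_Mapping.keys r" "subsum r S \<in> ideal" using S by (auto simp: \<S>_def)
    have finS: "finite S" using S'(2) finite_keys finite_subset by blast
    \<comment> \<open>Subsums of the part on \<open>S\<close> are subsums of \<open>r\<close>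
      itself, so the choice of \<open>S\<close> rules them out.\<close>
    have sub: "subsum (subsum r S) T = subsum r T" if "T \<subseteq> S" for T
      unfolding subsum_def
    proof (rule sum.cong)
      fix p assume "p \<in> T"
      then show "Poly_Mapping.single p (Poly_Mapping.lookup (\<Sum>p\<in>S. Poly_Mapping.single p (Poly_Mapping.lookup r p)) p)
          = Poly_Mapping.single p (Poly_Mapping.lookup r p)"
        using lookup_subsum[OF finS, of r p] that by (auto simp: subsum_def)
    qed simp
    have "minimal_relation ideal (subsum r S)"
      unfolding minimal_relation_iff keys_subsum[OF S'(2)]
    proof (intro conjI allI impI S'(3))
      fix T assume "T \<noteq> {} \<and> T \<subset> S"
      then show "subsum (subsum r S) T \<notin> ideal"
        using least[of T] S'(2) sub[of T] by (auto simp: \<S>_def)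
    qed
    then have const: "\<chi> p = \<chi> q" if "p \<in> S" "q \<in> S" for p q
      using \<chi>[of "subsum r S" p q] keys_subsum[OF S'(2)] that by simp
    obtain p where p: "p \<in> S" using S'(1) by blast
    define t where "t = r - subsum r S"
    have rt: "r = subsum r S + t" by (simp add: t_def)
    have keys_t: "Poly_Mapping.keys t = Poly_Mapping.keys r - S"
      using S'(2) finS by (auto simp: t_def in_keys_iff lookup_minus lookup_subsum split: if_splits)
    have sub_paths: "Poly_Mapping.keys (subsum r S) \<subseteq> paths Q" "Poly_Mapping.keys t \<subseteq> paths Q"
      using S'(3) less.prems keys_t by (auto simp: mem_ideal_iff)
    have "\<nu> r = \<nu> (subsum r S) + \<nu> t"
      by (subst rt) (rule \<nu>_add[OF sub_paths])
    then have "t \<in> ideal"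
      using S'(3) less.prems sub_paths by (simp add: mem_ideal_iff)
    moreover have "card (Poly_Mapping.keys t) < card (Poly_Mapping.keys r)"
      unfolding keys_t using S'(1,2) by (intro psubset_card_mono) auto
    ultimately have IH: "\<nu> (rescale \<chi> t) = 0" using less.hyps by blast
    \<comment> \<open>On \<open>S\<close> the weight is constant, so rescaling is multiplication by
      one scalar and stays in the kernel.\<close>
    have "rescale \<chi> (subsum r S) = Poly_Mapping.map ((*) (\<chi> p)) (subsum r S)"
      using const[OF _ p] finS
      by (intro poly_mapping_eqI) (simp add: lookup_subsum Poly_Mapping.map.rep_eq when_def)
    then have "\<nu> (rescale \<chi> (subsum r S)) = 0"
      using \<nu>_smult[OF sub_paths(1)] S'(3) by (simp add: mem_ideal_iff)
    moreover have "\<nu> (rescale \<chi> r) = \<nu> (rescale \<chi> (subsum r S)) + \<nu> (rescale \<chi> t)"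
      using sub_paths keys_rescale[of \<chi>]
      by (subst rt, subst rescale_add) (intro \<nu>_add; blast)
    ultimately show ?thesis using IH by simp
  qed
qed

lemma derivation_add: "D \<in> derivations scale \<Longrightarrow> D (x + y) = D x + D y"
  and derivation_scale: "D \<in> derivations scale \<Longrightarrow> D (scale c x) = scale c (D x)"
  by (auto simp: derivations_def Vector_Spaces.linear_iff)

lemma derivation_0: "D \<in> derivations scale \<Longrightarrow> D 0 = 0"
  using derivation_add[of D 0 0] by simp

lemma scales_paths_unique:
  assumes D: "D \<in> derivations scale" "scales_paths scale Q \<nu> \<chi> D"
    and D': "D' \<in> derivations scale" "scales_paths scale Q \<nu> \<chi> D'"
  shows "D = D'"
proof
  fix a
  show "D a = D' a"
    by (induction a rule: path_induct)
      (use D D' in \<open>auto simp: scales_paths_def derivation_add derivation_scale derivation_0\<close>)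
qed

text \<open>Rescaling by an additive weight satisfies the Leibniz rule on paths. The first
  hypothesis lets it preserve the kernel of \<open>\<nu>\<close>, by \<open>\<nu>_rescale_0\<close>,
  so it descends to the algebra.\<close>

lemma scales_paths_exists:
  assumes \<chi>: "\<And>r p q. minimal_relation ideal r \<Longrightarrow> p \<in> Poly_Mapping.keys r \<Longrightarrow>
      q \<in> Poly_Mapping.keys r \<Longrightarrow> \<chi> p = \<chi> q"
    and comp: "\<And>p q. p \<in> paths Q \<Longrightarrow> q \<in> paths Q \<Longrightarrow> path_target Q p = fst q \<Longrightarrow>
      \<chi> (q \<cdot> p) = \<chi> q + \<chi> p"
  obtains D where "D \<in> derivations scale" "scales_paths scale Q \<nu> \<chi> D"
proof -
  define D where "D a = \<nu> (rescale \<chi> (SOME x. Poly_Mapping.keys x \<subseteq> paths Q \<and> \<nu> x = a))" for a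
  have D: "D (\<nu> x) = \<nu> (rescale \<chi> x)" if x: "Poly_Mapping.keys x \<subseteq> paths Q" for x
  proof -
    \<comment> \<open>The preimage selected by \<open>SOME\<close> may differ from \<open>x\<close>,
      but the difference is a relation, and rescaling sends relations to the kernel.\<close>
    define y where "y = (SOME y. Poly_Mapping.keys y \<subseteq> paths Q \<and> \<nu> y = \<nu> x)"
    have y: "Poly_Mapping.keys y \<subseteq> paths Q" "\<nu> y = \<nu> x"
      using someI[of "\<lambda>y. Poly_Mapping.keys y \<subseteq> paths Q \<and> \<nu> y = \<nu> x" x] x by (auto simp: y_def)
    have k: "Poly_Mapping.keys (x - y) \<subseteq> paths Q"
      using x y(1) Poly_Mapping.keys_diff[of x y] by blast
    have "\<nu> x = \<nu> (x - y) + \<nu> y" using \<nu>_add[OF k y(1)] by simp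
    then have "x - y \<in> ideal" using k y by (simp add: mem_ideal_iff)
    then have "\<nu> (rescale \<chi> (x - y)) = 0" using \<chi> by (rule \<nu>_rescale_0[rotated])
    moreover have "\<nu> (rescale \<chi> (x - y + y)) = \<nu> (rescale \<chi> (x - y)) + \<nu> (rescale \<chi> y)"
      unfolding rescale_add using keys_rescale[of \<chi>] k y(1) by (intro \<nu>_add; blast)
    ultimately show ?thesis by (simp add: D_def y_def)
  qed
  have path_D: "D (path_val p) = scale (\<chi> p) (path_val p)" if p: "p \<in> paths Q" for p
  proof -
    have "rescale \<chi> (path_elem p) = Poly_Mapping.single p (\<chi> p)"
      by (rule poly_mapping_eqI) (simp add: lookup_single when_def)
    then show ?thesis using D[of "path_elem p"] \<nu>_single[OF p, of "\<chi> p"] p by simp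
  qed
  have add: "D (a + c) = D a + D c" for a c
  proof -
    obtain x y where x: "Poly_Mapping.keys x \<subseteq> paths Q" "\<nu> x = a"
      and y: "Poly_Mapping.keys y \<subseteq> paths Q" "\<nu> y = c" using \<nu>_surj by metis
    have "Poly_Mapping.keys (x + y) \<subseteq> paths Q"
      using x y Poly_Mapping.keys_add[of x y] by blast
    from D[OF this] have "D (\<nu> (x + y)) = \<nu> (rescale \<chi> x + rescale \<chi> y)"
      by (simp only: rescale_add)
    also have "\<dots> = \<nu> (rescale \<chi> x) + \<nu> (rescale \<chi> y)"
      using x y keys_rescale[of \<chi>] by (intro \<nu>_add; blast)
    finally show ?thesis using D[OF x(1)] D[OF y(1)] x y \<nu>_add[OF x(1) y(1)] by simp
  qed
  have scl: "D (scale c a) = scale c (D a)" for c a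
  proof -
    obtain x where x: "Poly_Mapping.keys x \<subseteq> paths Q" "\<nu> x = a" by (rule \<nu>_surj)
    have k: "Poly_Mapping.keys (Poly_Mapping.map ((*) c) x) \<subseteq> paths Q"
      using x(1) by (auto simp: in_keys_iff Poly_Mapping.map.rep_eq when_def split: if_splits)
    have k': "Poly_Mapping.keys (rescale \<chi> x) \<subseteq> paths Q" using x(1) keys_rescale[of \<chi> x] by blast
    show ?thesis
      using D[OF k] D[OF x(1)] \<nu>_smult[OF x(1), of c] \<nu>_smult[OF k', of c] x(2)
      by (simp add: rescale_map)
  qed
  have zero: "D 0 = 0" using scl[of 0 0] by simp
  \<comment> \<open>Both sides are bilinear, hence two nested inductions over paths. Additivity of
    the weight settles composable pairs; for other pairs every term is a multiple of a vanishing
    product.\<close>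
  have "D (a * c) = D a * c + a * D c" for a c
  proof (induction a rule: path_induct)
    case (path q)
    show ?case
    proof (induction c rule: path_induct)
      case (path p)
      show ?case
      proof (cases "path_target Q p = fst q")
        case True
        then have "q \<cdot> p \<in> paths Q" using path \<open>q \<in> paths Q\<close> by (simp add: path_comp_in_paths)
        moreover have "path_val q * path_val p = path_val (q \<cdot> p)"
          using True path \<open>q \<in> paths Q\<close> by (simp add: path_val_mult)
        ultimately show ?thesis
          using True path \<open>q \<in> paths Q\<close> comp[of p q]
          by (simp add: path_D scale_mult_left scale_mult_right scale_left_distrib)
      next
        case False
        then have "path_val q * path_val p = 0"
          using path \<open>q \<in> paths Q\<close> by (simp add: path_val_mult)
        then show ?thesis
          using path \<open>q \<in> paths Q\<close> by (simp add: path_D zero scale_mult_left scale_mult_right)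
      qed
    qed (simp_all add: zero add scl algebra_simps scale_right_distrib scale_mult_right)
  qed (simp_all add: zero add scl algebra_simps scale_right_distrib scale_mult_left)
  then have "D \<in> derivations scale"
    using add scl vector_space_axioms by (auto simp: derivations_def Vector_Spaces.linear_iff)
  moreover have "scales_paths scale Q \<nu> \<chi> D" using path_D by (simp add: scales_paths_def)
  ultimately show thesis by (rule that)
qed

text \<open>By orthogonality, left multiplication by \<open>a\<close> sees only the vertex at the
  target of the path and right multiplication only the vertex at its source.\<close>

lemma commutator_potential:
  fixes \<phi> :: "'v \<Rightarrow> 'k"
  assumes "p \<in> paths Q"
  defines "a \<equiv> \<Sum>v\<in>verts Q. scale (\<phi> v) (vertex_val v)"
  shows "a * path_val p - path_val p * a = scale (\<phi> (path_target Q p) - \<phi> (fst p)) (path_val p)"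
proof -
  have "a * path_val p = (\<Sum>v\<in>verts Q. if v = path_target Q p then scale (\<phi> v) (path_val p) else 0)"
    unfolding a_def sum_distrib_right
    by (intro sum.cong) (auto simp: scale_mult_left target_val_mult assms(1))
  moreover have "path_val p * a = (\<Sum>v\<in>verts Q. if v = fst p then scale (\<phi> v) (path_val p) else 0)"
    unfolding a_def sum_distrib_left
    by (intro sum.cong) (auto simp: scale_mult_right source_val_mult assms(1))
  ultimately show ?thesis
    using fst_in_verts[OF assms(1)] path_target_in_verts[OF assms(1)]
    by (simp add: finite_verts scale_left_diff_distrib)
qed

end

section \<open>Eigenvalues of inner derivations\<close>

text \<open>Left multiplication by \<open>A\<close> and right multiplication by \<open>B\<close>
  commute and act nilpotently on \<open>z\<close>, so their difference can only have eigenvalue 0.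
  Concretely, the last non-zero \<open>y = A ^ j * z\<close> is killed by \<open>A\<close> and is
  still an eigenvector, whence \<open>y * B\<close> is \<open>- \<mu>\<close> times
  \<open>y\<close>, and a power of \<open>B\<close> kills \<open>y\<close>.\<close>

lemma (in associative_algebra) nilpotent_commutator_eigenvalue:
  assumes A: "A ^ m * z = 0" and B: "z * B ^ n = 0" and z: "z \<noteq> 0"
    and eig: "A * z - z * B = scale \<mu> z"
  shows "\<mu> = 0"
proof -
  define l where "l = (LEAST l. A ^ l * z = 0)"
  have l: "A ^ l * z = 0" unfolding l_def using A by (rule LeastI)
  then obtain j where j: "l = Suc j" using z by (cases l) auto
  define y where "y = A ^ j * z"
  have "y \<noteq> 0" unfolding y_def using not_less_Least[of j "\<lambda>l. A ^ l * z = 0"] j by (simp add: l_def)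
  have "A * y = 0" using l by (simp add: j y_def mult.assoc)
  have "y * B = A ^ j * (A * z - scale \<mu> z)"
    using eig by (simp add: y_def mult.assoc algebra_simps)
  also have "\<dots> = A * y - scale \<mu> y"
    by (simp add: y_def right_diff_distrib scale_mult_right mult.assoc[symmetric])
      (simp add: power_commutes)
  finally have yB: "y * B = scale (- \<mu>) y" using \<open>A * y = 0\<close> by simp
  have "y * B ^ k = scale ((- \<mu>) ^ k) y" for k
  proof (induction k)
    case (Suc k)
    have "y * B ^ Suc k = (y * B ^ k) * B" by (simp add: power_commutes mult.assoc)
    also have "\<dots> = scale ((- \<mu>) ^ Suc k) y"
      using yB by (simp add: Suc scale_mult_left mult.commute)
    finally show ?case .
  qed simp
  moreover have "y * B ^ n = 0" using B by (simp add: y_def mult.assoc)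
  ultimately have "scale ((- \<mu>) ^ n) y = 0" by simp
  then show ?thesis using \<open>y \<noteq> 0\<close> by simp
qed

text \<open>Nilpotency is found for the corner element \<open>e * a\<close>, whereas the eigenvalue
  argument multiplies by \<open>a\<close> itself. Under the factor \<open>e\<close> the two agree,
  on whichever side the factor stands.\<close>

lemma corner_power:
  fixes e a c :: "'a::ring_1"
  assumes "e * e = e" "e * a = a * e" "e * c = c * e"
  shows "e * (e * a - c) ^ m = e * (a - c) ^ m" "(a - c) ^ m * e = e * (a - c) ^ m"
proof -
  have step: "e * (e * a - c) = e * (a - c)"
    using assms(1) by (simp add: algebra_simps mult.assoc[symmetric])
  have comm: "e * (a - c) = (a - c) * e" "e * (e * a - c) = (e * a - c) * e"
    using assms by (simp_all add: algebra_simps) (metis mult.assoc)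
  show comm': "(a - c) ^ m * e = e * (a - c) ^ m"
    by (rule power_commuting_commutes) (rule comm(1)[symmetric])
  show "e * (e * a - c) ^ m = e * (a - c) ^ m"
  proof (induction m)
    case (Suc m)
    have "e * (e * a - c) ^ Suc m = (e * a - c) * (e * (e * a - c) ^ m)"
      using comm(2) by (simp add: mult.assoc[symmetric])
    also have "\<dots> = (e * (e * a - c)) * (a - c) ^ m"
      using Suc comm(2) by (simp add: mult.assoc)
    also have "\<dots> = e * (a - c) ^ Suc m" by (simp add: step mult.assoc)
    finally show ?case .
  qed simp
qed

section \<open>Cosets of derivations and the cohomology spaces\<close>

context associative_algebra
begin

lemma coset_operator_space:
  "N +>\<^bsub>operator_space scale S\<^esub> D = (\<lambda>n x. n x + D x) ` N"
  by (auto simp: a_r_coset_def r_coset_def operator_space_def)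

text \<open>Addition in \<open>operator_space\<close> is pointwise whatever the carrier is, so the
  carriers \<open>S\<close> and \<open>S'\<close> leave no trace in the cosets and may
  differ.\<close>

lemma coset_operator_space_eq_iff:
  assumes "(\<lambda>_. 0) \<in> N" "\<And>D D'. D \<in> N \<Longrightarrow> D' \<in> N \<Longrightarrow> (\<lambda>x. D x + D' x) \<in> N"
    and "\<And>c D. D \<in> N \<Longrightarrow> (\<lambda>x. scale c (D x)) \<in> N"
  shows "N +>\<^bsub>operator_space scale S\<^esub> D = N +>\<^bsub>operator_space scale S'\<^esub> D' \<longleftrightarrow>
    (\<lambda>x. D x - D' x) \<in> N"
proof
  assume eq: "N +>\<^bsub>operator_space scale S\<^esub> D = N +>\<^bsub>operator_space scale S'\<^esub> D'"
  have "D \<in> (\<lambda>n x. n x + D x) ` N" using assms(1) by (intro image_eqI[of _ _ "\<lambda>_. 0"]) auto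
  then have "D \<in> (\<lambda>n x. n x + D' x) ` N" using eq by (simp add: coset_operator_space)
  then show "(\<lambda>x. D x - D' x) \<in> N" by auto
next
  assume d: "(\<lambda>x. D x - D' x) \<in> N"
  then have d': "(\<lambda>x. D' x - D x) \<in> N" using assms(3)[OF d, of "- 1"] by simp
  have "(\<lambda>x. n x + D x) \<in> (\<lambda>n x. n x + D' x) ` N" if "n \<in> N" for n
    by (rule image_eqI[OF _ assms(2)[OF that d]]) auto
  moreover have "(\<lambda>x. n x + D' x) \<in> (\<lambda>n x. n x + D x) ` N" if "n \<in> N" for n
    by (rule image_eqI[OF _ assms(2)[OF that d']]) auto
  ultimately show "N +>\<^bsub>operator_space scale S\<^esub> D = N +>\<^bsub>operator_space scale S'\<^esub> D'"
    by (auto simp: coset_operator_space)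
qed

text \<open>The smaller subspace \<open>N'\<close> is absorbed by \<open>N\<close>. Two carriers
  occur because \<open>iota_HH\<close> adds, in the space of all derivations, to a coset formed in
  the space of relative ones.\<close>

lemma set_add_coset_operator_space:
  assumes "N' \<subseteq> N" "(\<lambda>_. 0) \<in> N'" "\<And>D D'. D \<in> N \<Longrightarrow> D' \<in> N \<Longrightarrow> (\<lambda>x. D x + D' x) \<in> N"
  shows "N <+>\<^bsub>operator_space scale S\<^esub> (N' +>\<^bsub>operator_space scale S'\<^esub> D) =
    N +>\<^bsub>operator_space scale S\<^esub> D"
proof -
  have "N <+>\<^bsub>operator_space scale S\<^esub> (N' +>\<^bsub>operator_space scale S'\<^esub> D) =
      {\<lambda>x. m x + (n x + D x) | m n. m \<in> N \<and> n \<in> N'}"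
    by (auto simp: set_add_def set_mult_def coset_operator_space) (auto simp: operator_space_def)
  also have "\<dots> = (\<lambda>n x. n x + D x) ` N"
  proof safe
    fix m n assume "m \<in> N" "n \<in> N'"
    then have "(\<lambda>x. m x + n x) \<in> N" using assms by blast
    then show "(\<lambda>x. m x + (n x + D x)) \<in> (\<lambda>n x. n x + D x) ` N"
      by (intro image_eqI) (auto simp: add.assoc)
  next
    fix n assume "n \<in> N"
    then show "\<exists>m n'. (\<lambda>x. n x + D x) = (\<lambda>x. m x + (n' x + D x)) \<and> m \<in> N \<and> n' \<in> N'"
      using assms(2) by (intro exI[of _ n] exI[of _ "\<lambda>_. 0"]) auto
  qed
  finally show ?thesis by (simp add: coset_operator_space)
qed

lemma derivations_iff: "D \<in> derivations scale \<longleftrightarrow> (\<forall>x y. D (x + y) = D x + D y) \<and>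
    (\<forall>c x. D (scale c x) = scale c (D x)) \<and> (\<forall>x y. D (x * y) = D x * y + x * D y)"
  using vector_space_axioms by (auto simp: derivations_def Vector_Spaces.linear_iff)

lemma derivations_subspace:
  "(\<lambda>_. 0) \<in> derivations scale"
  "D \<in> derivations scale \<Longrightarrow> D' \<in> derivations scale \<Longrightarrow> (\<lambda>x. D x + D' x) \<in> derivations scale"
  "D \<in> derivations scale \<Longrightarrow> (\<lambda>x. scale c (D x)) \<in> derivations scale"
  by (auto simp: derivations_iff algebra_simps scale_right_distrib scale_mult_left scale_mult_right)

lemma bimodule_operators_subspace:
  "(\<lambda>_. 0) \<in> bimodule_operators B"
  "D \<in> bimodule_operators B \<Longrightarrow> D' \<in> bimodule_operators B \<Longrightarrow> (\<lambda>x. D x + D' x) \<in> bimodule_operators B"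
  "D \<in> bimodule_operators B \<Longrightarrow> (\<lambda>x. scale c (D x)) \<in> bimodule_operators B"
  by (auto simp: bimodule_operators_def algebra_simps scale_mult_left scale_mult_right)

lemma inner_derivations_subspace:
  "(\<lambda>_. 0) \<in> inner_derivations"
  "D \<in> inner_derivations \<Longrightarrow> D' \<in> inner_derivations \<Longrightarrow> (\<lambda>x. D x + D' x) \<in> inner_derivations"
  "D \<in> inner_derivations \<Longrightarrow> (\<lambda>x. scale c (D x)) \<in> inner_derivations"
proof -
  show "(\<lambda>_. 0) \<in> inner_derivations"
    unfolding inner_derivations_def by (rule range_eqI[of _ _ 0]) simp
  show "D \<in> inner_derivations \<Longrightarrow> D' \<in> inner_derivations \<Longrightarrow> (\<lambda>x. D x + D' x) \<in> inner_derivations"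
    unfolding inner_derivations_def
  proof (elim rangeE)
    fix a c assume "D = (\<lambda>x. a * x - x * a)" "D' = (\<lambda>x. c * x - x * c)"
    then show "(\<lambda>x. D x + D' x) \<in> range (\<lambda>a x. a * x - x * a)"
      by (intro range_eqI[of _ _ "a + c"]) (auto simp: algebra_simps)
  qed
  show "D \<in> inner_derivations \<Longrightarrow> (\<lambda>x. scale c (D x)) \<in> inner_derivations"
    unfolding inner_derivations_def
  proof (elim rangeE)
    fix a assume "D = (\<lambda>x. a * x - x * a)"
    then show "(\<lambda>x. scale c (D x)) \<in> range (\<lambda>a x. a * x - x * a)"
      by (intro range_eqI[of _ _ "scale c a"])
        (auto simp: algebra_simps scale_mult_left scale_mult_right scale_right_diff_distrib)
  qed
qed

lemma inner_coset_eq_iff: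
  "inner_derivations +>\<^bsub>operator_space scale S\<^esub> D = inner_derivations +>\<^bsub>operator_space scale S'\<^esub> D' \<longleftrightarrow>
     (\<lambda>x. D x - D' x) \<in> inner_derivations"
  by (rule coset_operator_space_eq_iff) (rule inner_derivations_subspace; assumption?)+

lemma inner_derivations_subset: "inner_derivations \<subseteq> derivations scale"
  by (auto simp: inner_derivations_def derivations_iff algebra_simps scale_mult_left scale_mult_right
      scale_right_diff_distrib)

lemma relative_derivations_subspace:
  "(\<lambda>_. 0) \<in> relative_derivations scale B"
  "D \<in> relative_derivations scale B \<Longrightarrow> D' \<in> relative_derivations scale B \<Longrightarrow>
     (\<lambda>x. D x + D' x) \<in> relative_derivations scale B"
  "D \<in> relative_derivations scale B \<Longrightarrow> (\<lambda>x. scale c (D x)) \<in> relative_derivations scale B"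
  using derivations_subspace bimodule_operators_subspace[where B = B] by (auto simp: relative_derivations_def)

lemma relative_inner_derivations_subspace:
  "(\<lambda>_. 0) \<in> relative_inner_derivations B"
  "D \<in> relative_inner_derivations B \<Longrightarrow> D' \<in> relative_inner_derivations B \<Longrightarrow>
     (\<lambda>x. D x + D' x) \<in> relative_inner_derivations B"
  "D \<in> relative_inner_derivations B \<Longrightarrow> (\<lambda>x. scale c (D x)) \<in> relative_inner_derivations B"
  using inner_derivations_subspace bimodule_operators_subspace[where B = B]
  by (auto simp: relative_inner_derivations_def)

lemma relative_inner_coset_eq_iff:
  "relative_inner_derivations B +>\<^bsub>operator_space scale S\<^esub> D =
     relative_inner_derivations B +>\<^bsub>operator_space scale S'\<^esub> D' \<longleftrightarrow>
     (\<lambda>x. D x - D' x) \<in> relative_inner_derivations B"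
  by (rule coset_operator_space_eq_iff) (rule relative_inner_derivations_subspace; assumption?)+

text \<open>The Leibniz rule gives \<open>D 1 = 0\<close>, and linearity over \<open>B\<close> gives
  \<open>D x = x * D 1\<close> for \<open>x\<close> in \<open>B\<close>. Conversely, the Leibniz
  rule turns vanishing on \<open>B\<close> into linearity over \<open>B\<close>.\<close>

lemma relative_derivations_iff:
  "D \<in> relative_derivations scale B \<longleftrightarrow> D \<in> derivations scale \<and> (\<forall>x\<in>B. D x = 0)"
proof -
  have "D x = 0" if D: "D \<in> derivations scale" "D \<in> bimodule_operators B" and x: "x \<in> B" for x
  proof -
    have "D 1 = D 1 + D 1" using D(1) by (metis derivations_iff mult.left_neutral mult.right_neutral)
    moreover have "D (x * 1) = x * D 1" using D(2) x unfolding bimodule_operators_def by blast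
    ultimately show ?thesis by simp
  qed
  moreover have "D \<in> bimodule_operators B" if "D \<in> derivations scale" "\<forall>x\<in>B. D x = 0"
    using that by (auto simp: derivations_iff bimodule_operators_def)
  ultimately show ?thesis by (auto simp: relative_derivations_def)
qed

lemma linear_map_HH1:
  "linear_map ring_of_type_algebra (operator_space scale (derivations scale)) (HH1 scale)
     (\<lambda>D. inner_derivations +>\<^bsub>operator_space scale (derivations scale)\<^esub> D)"
  unfolding HH1_def
proof (rule linear_map_quotient_space)
  show "vectorspace ring_of_type_algebra (operator_space scale (derivations scale))"
    by (rule vectorspace_operator_space) (rule derivations_subspace; assumption?)+
qed (use inner_derivations_subset inner_derivations_subspace in
    \<open>auto simp: operator_space_def\<close>)

lemma linear_map_relative_HH1:
  "linear_map ring_of_type_algebra (operator_space scale (relative_derivations scale B)) (relative_HH1 scale B)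
     (\<lambda>D. relative_inner_derivations B +>\<^bsub>operator_space scale (relative_derivations scale B)\<^esub> D)"
  unfolding relative_HH1_def
proof (rule linear_map_quotient_space)
  show "vectorspace ring_of_type_algebra (operator_space scale (relative_derivations scale B))"
    by (rule vectorspace_operator_space) (rule relative_derivations_subspace; assumption?)+
qed (use inner_derivations_subset relative_inner_derivations_subspace in
    \<open>auto simp: operator_space_def relative_derivations_def relative_inner_derivations_def\<close>)

lemma relative_HH1_cases:
  assumes "U \<in> carrier (relative_HH1 scale B)"
  obtains D where "D \<in> relative_derivations scale B"
    "U = relative_inner_derivations B +>\<^bsub>operator_space scale (relative_derivations scale B)\<^esub> D"
  using assms by (auto simp: relative_HH1_def quotient_space_def A_RCOSETS_def' operator_space_def)

lemma iota_HH_coset: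
  "iota_HH scale (relative_inner_derivations B +>\<^bsub>operator_space scale (relative_derivations scale B)\<^esub> D) =
     inner_derivations +>\<^bsub>operator_space scale (derivations scale)\<^esub> D"
  unfolding iota_HH_def
  by (rule set_add_coset_operator_space)
    (auto simp: relative_inner_derivations_def inner_derivations_subspace bimodule_operators_subspace)

lemma linear_map_iota_HH:
  "linear_map ring_of_type_algebra (relative_HH1 scale B) (HH1 scale) (iota_HH scale)"
proof (rule linear_mapI)
  note HH = linear_mapD[OF linear_map_HH1] and rel = linear_mapD[OF linear_map_relative_HH1[where B = B]]
  show "vectorspace ring_of_type_algebra (relative_HH1 scale B)" by (rule rel(2))
  show "vectorspace ring_of_type_algebra (HH1 scale)" by (rule HH(2))
  let ?P = "\<lambda>D. inner_derivations +>\<^bsub>operator_space scale (derivations scale)\<^esub> D"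
  let ?R = "\<lambda>D. relative_inner_derivations B +>\<^bsub>operator_space scale (relative_derivations scale B)\<^esub> D"
  have P_closed: "?P D \<in> carrier (HH1 scale)" if "D \<in> derivations scale" for D
    using HH(3)[of D] that by (simp add: operator_space_def)
  have P_add: "?P (\<lambda>x. D x + D' x) = ?P D \<oplus>\<^bsub>HH1 scale\<^esub> ?P D'"
    if "D \<in> derivations scale" "D' \<in> derivations scale" for D D'
    using HH(4)[of D D'] that by (simp add: operator_space_def)
  have R_add: "?R (\<lambda>x. D x + D' x) = ?R D \<oplus>\<^bsub>relative_HH1 scale B\<^esub> ?R D'"
    if "D \<in> relative_derivations scale B" "D' \<in> relative_derivations scale B" for D D'
    using rel(4)[of D D'] that by (simp add: operator_space_def)
  have P_smult: "?P (\<lambda>x. scale c (D x)) = c \<odot>\<^bsub>HH1 scale\<^esub> ?P D" if "D \<in> derivations scale" for c D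
    using HH(5)[of c D] that by (simp add: operator_space_def)
  have R_smult: "?R (\<lambda>x. scale c (D x)) = c \<odot>\<^bsub>relative_HH1 scale B\<^esub> ?R D"
    if "D \<in> relative_derivations scale B" for c D
    using rel(5)[of c D] that by (simp add: operator_space_def)
  have sub: "D \<in> derivations scale" if "D \<in> relative_derivations scale B" for D
    using that by (simp add: relative_derivations_def)
  fix U assume "U \<in> carrier (relative_HH1 scale B)"
  then obtain D where D: "D \<in> relative_derivations scale B" "U = ?R D" by (rule relative_HH1_cases)
  show "iota_HH scale U \<in> carrier (HH1 scale)"
    unfolding D(2) iota_HH_coset by (rule P_closed[OF sub[OF D(1)]])
  show "iota_HH scale (c \<odot>\<^bsub>relative_HH1 scale B\<^esub> U) = c \<odot>\<^bsub>HH1 scale\<^esub> iota_HH scale U" for c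
    unfolding D(2) R_smult[OF D(1), symmetric] iota_HH_coset by (rule P_smult[OF sub[OF D(1)]])
  fix V assume "V \<in> carrier (relative_HH1 scale B)"
  then obtain D' where D': "D' \<in> relative_derivations scale B" "V = ?R D'" by (rule relative_HH1_cases)
  show "iota_HH scale (U \<oplus>\<^bsub>relative_HH1 scale B\<^esub> V) = iota_HH scale U \<oplus>\<^bsub>HH1 scale\<^esub> iota_HH scale V"
    unfolding D(2) D'(2) R_add[OF D(1) D'(1), symmetric] iota_HH_coset
    by (rule P_add[OF sub[OF D(1)] sub[OF D'(1)]])
qed

end

section \<open>The derivation of a homomorphism\<close>

locale pointed_presentation = algebra_presentation scale E Q \<nu>
  for scale :: "'k::field \<Rightarrow> 'a::ring_1 \<Rightarrow> 'a" and E :: "'a set" and Q :: "('v, 'e) pre_digraph"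
    and \<nu> :: "(('v, 'e) path \<Rightarrow>\<^sub>0 'k) \<Rightarrow> 'a" +
  fixes b :: 'v
  assumes base_vertex: "b \<in> verts Q"
begin

sublocale pointed_bound_quiver Q ideal b
  by unfold_locales (rule base_vertex)

text \<open>The derivation \<open>D_f\<close> of the overview, named separately from its class
  because the argument compares derivations and not only classes.\<close>

definition hom_derivation ::
  "('v \<Rightarrow> ('v, 'e letter) path) \<Rightarrow> (('v, 'e letter) path set \<Rightarrow> 'k) \<Rightarrow> 'a \<Rightarrow> 'a" where
  "hom_derivation \<gamma> f = (THE D. D \<in> derivations scale \<and>
     scales_paths scale Q \<nu> (\<lambda>p. f (parade_class Q ideal \<gamma> p)) D)"

text \<open>Homotopy invariance and additivity of \<open>parade_value\<close> are precisely the two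
  conditions under which a weight on paths defines a derivation.\<close>

lemma hom_derivation_ex1:
  assumes \<gamma>: "parade_data Q b \<gamma>" and f: "f \<in> carrier (hom_space \<pi>)"
  shows "\<exists>!D. D \<in> derivations scale \<and> scales_paths scale Q \<nu> (\<lambda>p. f (parade_class Q ideal \<gamma> p)) D"
proof -
  let ?\<chi> = "\<lambda>p. f (parade_class Q ideal \<gamma> p)"
  have \<chi>: "?\<chi> p = parade_value \<gamma> f (walk_of_path p)" if "p \<in> paths Q" for p
    using that by (rule parade_class_eq)
  obtain D where "D \<in> derivations scale" "scales_paths scale Q \<nu> ?\<chi> D"
  proof (rule scales_paths_exists[of ?\<chi>])
    fix r p q assume r: "minimal_relation ideal r" "p \<in> Poly_Mapping.keys r" "q \<in> Poly_Mapping.keys r"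
    then have pq: "p \<in> paths Q" "q \<in> paths Q"
      using minimal_relation_parallel by (auto simp: paths_between_iff)
    show "?\<chi> p = ?\<chi> q"
      unfolding \<chi>[OF pq(1)] \<chi>[OF pq(2)]
      by (rule parade_value_homotopic[OF \<gamma> homotopic.relation[OF r]])
  next
    fix p q assume pq: "p \<in> paths Q" "q \<in> paths Q" "path_target Q p = fst q"
    then have "q \<cdot> p \<in> paths Q" by (simp add: path_comp_in_paths)
    moreover have "walk_of_path q \<in> walks_between Q (fst q) (path_target Q q)"
      "walk_of_path p \<in> walks_between Q (fst p) (fst q)"
      using pq by (simp_all add: walk_of_path_in_walks_between) (simp_all add: paths_between_iff)
    ultimately show "?\<chi> (q \<cdot> p) = ?\<chi> q + ?\<chi> p"
      using pq by (simp only: \<chi> walk_of_path_comp parade_value_comp[OF \<gamma> f])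
  qed
  then show ?thesis using scales_paths_unique by blast
qed

lemma
  assumes \<gamma>: "parade_data Q b \<gamma>" and f: "f \<in> carrier (hom_space \<pi>)"
  shows hom_derivation_in: "hom_derivation \<gamma> f \<in> derivations scale"
    and scales_paths_hom_derivation:
      "scales_paths scale Q \<nu> (\<lambda>p. f (parade_class Q ideal \<gamma> p)) (hom_derivation \<gamma> f)"
  using theI'[OF hom_derivation_ex1[OF assms]] by (simp_all add: hom_derivation_def)

lemma hom_derivation_path_class:
  assumes "parade_data Q b \<gamma>" "f \<in> carrier (hom_space \<pi>)" "p \<in> paths Q"
  shows "hom_derivation \<gamma> f (path_val p) = scale (f (parade_class Q ideal \<gamma> p)) (path_val p)"
  using scales_paths_hom_derivation[OF assms(1,2)] assms(3) by (simp add: scales_paths_def)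

lemma hom_derivation_path:
  assumes "parade_data Q b \<gamma>" "f \<in> carrier (hom_space \<pi>)" "p \<in> paths Q"
  shows "hom_derivation \<gamma> f (path_val p) = scale (parade_value \<gamma> f (walk_of_path p)) (path_val p)"
  by (simp only: hom_derivation_path_class[OF assms] parade_class_eq[OF assms(3)])

lemma hom_derivation_vertex:
  assumes "parade_data Q b \<gamma>" "f \<in> carrier (hom_space \<pi>)" "v \<in> verts Q"
  shows "hom_derivation \<gamma> f (vertex_val v) = 0"
  using hom_derivation_path[OF assms(1,2), of "(v, [])"] assms(3) parade_value_trivial[OF assms]
  by (simp add: walk_of_path_def)

text \<open>A derivation is determined by its factors on paths, so linearity in \<open>f\<close>
  becomes a comparison of factors.\<close>

lemma hom_derivation_unique:
  assumes "parade_data Q b \<gamma>" "f \<in> carrier (hom_space \<pi>)" "D \<in> derivations scale"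
    and "\<And>p. p \<in> paths Q \<Longrightarrow> D (path_val p) = scale (f (parade_class Q ideal \<gamma> p)) (path_val p)"
  shows "hom_derivation \<gamma> f = D"
  using scales_paths_unique[OF hom_derivation_in[OF assms(1,2)] scales_paths_hom_derivation[OF assms(1,2)]
      assms(3)] assms(4) by (simp add: scales_paths_def)

lemma hom_derivation_add:
  assumes \<gamma>: "parade_data Q b \<gamma>" and f: "f \<in> carrier (hom_space \<pi>)" and g: "g \<in> carrier (hom_space \<pi>)"
  shows "hom_derivation \<gamma> (f \<oplus>\<^bsub>hom_space \<pi>\<^esub> g) = (\<lambda>x. hom_derivation \<gamma> f x + hom_derivation \<gamma> g x)"
proof (rule hom_derivation_unique[OF \<gamma>])
  interpret H: vectorspace ring_of_type_algebra "hom_space \<pi> :: ('k, _) module" by (rule vectorspace_hom_space)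
  show "f \<oplus>\<^bsub>hom_space \<pi>\<^esub> g \<in> carrier (hom_space \<pi>)" using f g by simp
  show "(\<lambda>x. hom_derivation \<gamma> f x + hom_derivation \<gamma> g x) \<in> derivations scale"
    using hom_derivation_in[OF \<gamma>] f g by (intro derivations_subspace)
  fix p assume p: "p \<in> paths Q"
  have "(f \<oplus>\<^bsub>hom_space \<pi>\<^esub> g) (parade_class Q ideal \<gamma> p) =
      f (parade_class Q ideal \<gamma> p) + g (parade_class Q ideal \<gamma> p)"
    using parade_class_in_carrier[OF \<gamma> p] by (simp add: hom_space_def)
  then show "hom_derivation \<gamma> f (path_val p) + hom_derivation \<gamma> g (path_val p) =
      scale ((f \<oplus>\<^bsub>hom_space \<pi>\<^esub> g) (parade_class Q ideal \<gamma> p)) (path_val p)"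
    by (simp add: hom_derivation_path_class[OF \<gamma> _ p] f g scale_left_distrib)
qed

lemma hom_derivation_smult:
  assumes \<gamma>: "parade_data Q b \<gamma>" and f: "f \<in> carrier (hom_space \<pi>)"
  shows "hom_derivation \<gamma> (c \<odot>\<^bsub>hom_space \<pi>\<^esub> f) = (\<lambda>x. scale c (hom_derivation \<gamma> f x))"
proof (rule hom_derivation_unique[OF \<gamma>])
  interpret H: vectorspace ring_of_type_algebra "hom_space \<pi> :: ('k, _) module" by (rule vectorspace_hom_space)
  show "c \<odot>\<^bsub>hom_space \<pi>\<^esub> f \<in> carrier (hom_space \<pi>)" using f by simp
  show "(\<lambda>x. scale c (hom_derivation \<gamma> f x)) \<in> derivations scale"
    using hom_derivation_in[OF \<gamma> f] by (rule derivations_subspace)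
  fix p assume p: "p \<in> paths Q"
  have "(c \<odot>\<^bsub>hom_space \<pi>\<^esub> f) (parade_class Q ideal \<gamma> p) = c * f (parade_class Q ideal \<gamma> p)"
    using parade_class_in_carrier[OF \<gamma> p] by (simp add: hom_space_def)
  then show "scale c (hom_derivation \<gamma> f (path_val p)) =
      scale ((c \<odot>\<^bsub>hom_space \<pi>\<^esub> f) (parade_class Q ideal \<gamma> p)) (path_val p)"
    by (simp add: hom_derivation_path_class[OF \<gamma> f p])
qed

lemma theta_eq:
  "theta scale Q \<nu> \<gamma> f = inner_derivations +>\<^bsub>operator_space scale (derivations scale)\<^esub> hom_derivation \<gamma> f"
  by (simp add: theta_def hom_derivation_def)

lemma linear_map_theta:
  assumes \<gamma>: "parade_data Q b \<gamma>"
  shows "linear_map ring_of_type_algebra (hom_space \<pi>) (HH1 scale) (theta scale Q \<nu> \<gamma>)"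
proof (rule linear_mapI)
  note HH = linear_mapD[OF linear_map_HH1]
  show "vectorspace ring_of_type_algebra (hom_space \<pi> :: ('k, _) module)" by (rule vectorspace_hom_space)
  show "vectorspace ring_of_type_algebra (HH1 scale)" by (rule HH(2))
  have car: "hom_derivation \<gamma> f \<in> carrier (operator_space scale (derivations scale))"
    if "f \<in> carrier (hom_space \<pi>)" for f
    using hom_derivation_in[OF \<gamma> that] by (simp add: operator_space_def)
  fix f :: "('v, 'e letter) path set \<Rightarrow> 'k" assume f: "f \<in> carrier (hom_space \<pi>)"
  show "theta scale Q \<nu> \<gamma> f \<in> carrier (HH1 scale)"
    unfolding theta_eq by (rule HH(3)[OF car[OF f]])
  show "theta scale Q \<nu> \<gamma> (c \<odot>\<^bsub>hom_space \<pi>\<^esub> f) = c \<odot>\<^bsub>HH1 scale\<^esub> theta scale Q \<nu> \<gamma> f" for c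
    using HH(5)[OF _ car[OF f], of c]
    unfolding theta_eq hom_derivation_smult[OF \<gamma> f] by (simp add: operator_space_def)
  fix g :: "('v, 'e letter) path set \<Rightarrow> 'k" assume g: "g \<in> carrier (hom_space \<pi>)"
  show "theta scale Q \<nu> \<gamma> (f \<oplus>\<^bsub>hom_space \<pi>\<^esub> g) = theta scale Q \<nu> \<gamma> f \<oplus>\<^bsub>HH1 scale\<^esub> theta scale Q \<nu> \<gamma> g"
    using HH(4)[OF car[OF f] car[OF g]]
    unfolding theta_eq hom_derivation_add[OF \<gamma> f g] by (simp add: operator_space_def)
qed

text \<open>Two choices of \<open>\<gamma>\<close> differ by the potential \<open>y \<mapsto> parade_value \<gamma> f (\<gamma>' y)\<close> on the vertices.\<close>

lemma hom_derivation_parade_change: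
  assumes \<gamma>: "parade_data Q b \<gamma>" and \<gamma>': "parade_data Q b \<gamma>'" and f: "f \<in> carrier (hom_space \<pi>)"
  shows "(\<lambda>x. hom_derivation \<gamma> f x - hom_derivation \<gamma>' f x) \<in> inner_derivations"
proof -
  define \<phi> where "\<phi> y = parade_value \<gamma> f (\<gamma>' y)" for y
  define a where "a = (\<Sum>v\<in>verts Q. scale (\<phi> v) (vertex_val v))"
  have diff: "parade_value \<gamma> f w - parade_value \<gamma>' f w = \<phi> y - \<phi> x" if w: "w \<in> walks_between Q x y" for w x y
  proof -
    have x: "\<gamma>' x \<in> walks_between Q b x" and y: "\<gamma>' y \<in> walks_between Q b y"
      using \<gamma>' walks_between_verts[OF w] by (auto simp: parade_data_def)
    note iy = inverse_walk_in_walks_between[OF y]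
    \<comment> \<open>The value for \<open>\<gamma>'\<close> is \<open>f\<close> on a closed walk at
      \<open>b\<close>, and any parade evaluates closed walks correctly. Evaluating this one with
      \<open>\<gamma>\<close> produces the potential at both ends.\<close>
    have "parade_value \<gamma>' f w = f (walk_class Q ideal (inverse_walk Q (\<gamma>' y) \<cdot> w \<cdot> \<gamma>' x))"
      using w by (simp add: parade_value_def paths_between_iff)
    also have "\<dots> = parade_value \<gamma> f (inverse_walk Q (\<gamma>' y) \<cdot> w \<cdot> \<gamma>' x)"
      by (rule parade_value_closed[OF \<gamma> f parade_walk_closed[OF \<gamma>' w], symmetric])
    also have "\<dots> = - \<phi> y + (parade_value \<gamma> f w + \<phi> x)"
      using parade_value_comp[OF \<gamma> f iy comp_in_walks_between[OF w x]] parade_value_comp[OF \<gamma> f w x]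
        parade_value_inverse[OF \<gamma> f y] by (simp add: \<phi>_def)
    finally show ?thesis by simp
  qed
  have "hom_derivation \<gamma> f x - hom_derivation \<gamma>' f x = a * x - x * a" for x
  proof (induction x rule: path_induct)
    case (path p)
    have "walk_of_path p \<in> walks_between Q (fst p) (path_target Q p)"
      using path by (simp add: walk_of_path_in_walks_between) (simp add: paths_between_iff)
    from diff[OF this] show ?case
      using path commutator_potential[OF path, of \<phi>]
      by (simp add: hom_derivation_path[OF \<gamma> f] hom_derivation_path[OF \<gamma>' f] a_def
          flip: scale_left_diff_distrib)
  next
    case zero
    show ?case using hom_derivation_in[OF \<gamma> f] hom_derivation_in[OF \<gamma>' f] by (simp add: derivation_0)
  next
    case (add x y)
    have "hom_derivation \<gamma> f (x + y) - hom_derivation \<gamma>' f (x + y) =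
        (hom_derivation \<gamma> f x - hom_derivation \<gamma>' f x) + (hom_derivation \<gamma> f y - hom_derivation \<gamma>' f y)"
      using hom_derivation_in[OF \<gamma> f] hom_derivation_in[OF \<gamma>' f] by (simp add: derivation_add)
    then show ?case by (simp add: add algebra_simps)
  next
    case (scale c x)
    then show ?case
      using hom_derivation_in[OF \<gamma> f] hom_derivation_in[OF \<gamma>' f]
      by (simp add: derivation_scale scale_mult_left scale_mult_right flip: scale_right_diff_distrib)
  qed
  then show ?thesis by (auto simp: inner_derivations_def)
qed

end

text \<open>
  The corner algebra at a primitive idempotent is local, so an element \<open>a\<close> that commutes with the
  vertices is a scalar \<open>\<phi> v\<close> plus a nilpotent there; if \<open>[a, \<cdot>]\<close> multiplies a non-zero path by \<open>c\<close>,
  then comparing eigenvalues gives \<open>c = \<phi> (target) - \<phi> (source)\<close>.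
\<close>

lemma commutator_eigenvalue_potential:
  fixes scale :: "'k::alg_closed_field \<Rightarrow> 'a::ring_1 \<Rightarrow> 'a"
    and Q :: "('v, 'e) pre_digraph"
    and \<nu> :: "(('v, 'e) path \<Rightarrow>\<^sub>0 'k) \<Rightarrow> 'a"
  assumes fd: "finite_dimensional_algebra scale" and P: "algebra_presentation scale E Q \<nu>"
    and prim: "\<And>e. e \<in> E \<Longrightarrow> primitive_idempotent e"
    and comm: "\<And>v. v \<in> verts Q \<Longrightarrow> a * \<nu> (path_elem (v, [])) = \<nu> (path_elem (v, [])) * a"
  obtains \<phi> where "\<And>p c. p \<in> paths Q \<Longrightarrow> \<nu> (path_elem p) \<noteq> 0 \<Longrightarrow>
    a * \<nu> (path_elem p) - \<nu> (path_elem p) * a = scale c (\<nu> (path_elem p)) \<Longrightarrow>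
    c = \<phi> (path_target Q p) - \<phi> (fst p)"
proof -
  interpret algebra_presentation scale E Q \<nu> by fact
  have "\<exists>c m. vertex_val v * (a - scale c 1) ^ m = 0" if v: "v \<in> verts Q" for v
  proof -
    let ?e = "vertex_val v"
    have e: "?e * ?e = ?e" using v by (simp add: vertex_val_mult)
    \<comment> \<open>\<open>R\<close> annihilates \<open>e * a\<close> in the whole algebra, hence
      also after multiplication by \<open>e\<close>. Since \<open>a\<close> commutes with
      \<open>e\<close>, the product \<open>e * a\<close> does lie in the corner.\<close>
    obtain R where R: "R \<noteq> 0" "poly_apply R (?e * a) = 0"
      using finite_dimensional_annihilating_poly[OF fd] by blast
    have "?e * (?e * a) = ?e * a" "?e * a * ?e = ?e * a"
      using e comm[OF v] by (metis mult.assoc)+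
    then have "\<exists>c m. ?e * (?e * a - scale c 1) ^ m = 0"
      by (rule primitive_corner_nilpotent[OF associative_algebra_axioms prim[OF vertex_val_in[OF v]] _ _ R(1)])
        (simp add: R(2))
    then obtain c m where "?e * (?e * a - scale c 1) ^ m = 0" by blast
    moreover have "?e * (?e * a - scale c 1) ^ m = ?e * (a - scale c 1) ^ m"
      by (rule corner_power(1)[OF e comm[OF v, symmetric]]) (simp add: scale_mult_left scale_mult_right)
    ultimately show ?thesis by auto
  qed
  then obtain \<phi> m where nil: "\<And>v. v \<in> verts Q \<Longrightarrow> vertex_val v * (a - scale (\<phi> v) 1) ^ m v = 0"
    by metis
  show thesis
  proof (rule that[of \<phi>])
    fix p c assume p: "p \<in> paths Q" and nz: "path_val p \<noteq> 0"
      and eig: "a * path_val p - path_val p * a = scale c (path_val p)"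
    let ?s = "fst p" and ?t = "path_target Q p"
    note s = fst_in_verts[OF p] and t = path_target_in_verts[OF p]
    have idem: "vertex_val ?t * vertex_val ?t = vertex_val ?t" using t by (simp add: vertex_val_mult)
    have "(a - scale (\<phi> ?t) 1) ^ m ?t * path_val p = ((a - scale (\<phi> ?t) 1) ^ m ?t * vertex_val ?t) * path_val p"
      using target_val_mult[OF p t] by (simp add: mult.assoc)
    also have "(a - scale (\<phi> ?t) 1) ^ m ?t * vertex_val ?t = 0"
      using corner_power(2)[OF idem comm[OF t, symmetric], of "scale (\<phi> ?t) 1" "m ?t"] nil[OF t]
      by (simp add: scale_mult_left scale_mult_right)
    finally have A: "(a - scale (\<phi> ?t) 1) ^ m ?t * path_val p = 0" by simp
    have "path_val p * (a - scale (\<phi> ?s) 1) ^ m ?s = path_val p * (vertex_val ?s * (a - scale (\<phi> ?s) 1) ^ m ?s)"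
      using source_val_mult[OF p s] by (simp add: mult.assoc[symmetric])
    then have B: "path_val p * (a - scale (\<phi> ?s) 1) ^ m ?s = 0" using nil[OF s] by simp
    \<comment> \<open>Shifting \<open>a\<close> by its eigenvalue at the target on the left and at
      the source on the right makes both factors nilpotent on the path and moves the eigenvalue to
      \<open>c - \<phi> ?t + \<phi> ?s\<close>, which must vanish.\<close>
    have "(a - scale (\<phi> ?t) 1) * path_val p - path_val p * (a - scale (\<phi> ?s) 1) =
        (a * path_val p - path_val p * a) - scale (\<phi> ?t) (path_val p) + scale (\<phi> ?s) (path_val p)"
      by (simp add: algebra_simps scale_mult_left scale_mult_right)
    also have "\<dots> = scale (c - \<phi> ?t + \<phi> ?s) (path_val p)"
      by (simp add: eig scale_left_distrib scale_left_diff_distrib)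
    finally have "c - \<phi> ?t + \<phi> ?s = 0"
      by (rule nilpotent_commutator_eigenvalue[OF A B nz])
    then show "c = \<phi> ?t - \<phi> ?s" by (simp add: algebra_simps)
  qed
qed

section \<open>The relative square\<close>

locale relative_pointed_presentation = pointed_presentation scale E Q \<nu> b
  for scale :: "'k::field \<Rightarrow> 'a::ring_1 \<Rightarrow> 'a" and E :: "'a set" and Q :: "('v, 'e) pre_digraph"
    and \<nu> :: "(('v, 'e) path \<Rightarrow>\<^sub>0 'k) \<Rightarrow> 'a" and b :: 'v +
  fixes B E\<^sub>B :: "'a set" and Q\<^sub>B :: "('v, 'e) pre_digraph"
    and \<nu>\<^sub>B :: "(('v, 'e) path \<Rightarrow>\<^sub>0 'k) \<Rightarrow> 'a"
  assumes relative: "relative_presentation scale B E E\<^sub>B Q \<nu> Q\<^sub>B \<nu>\<^sub>B"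
begin

lemma sub: "subgraph Q\<^sub>B Q"
  and restrict: "Poly_Mapping.keys x \<subseteq> paths Q\<^sub>B \<Longrightarrow> \<nu> x = \<nu>\<^sub>B x"
  and pres_B: "presentation scale B E\<^sub>B Q\<^sub>B \<nu>\<^sub>B"
  using relative by (auto simp: relative_presentation_def path_algebra_def)

sublocale B: wf_digraph Q\<^sub>B
  using sub by (auto simp: subgraph_def)

lemma paths_B_subset: "paths Q\<^sub>B \<subseteq> paths Q"
  using paths_between_subgraph[OF sub] by (auto simp: paths_between_iff)

lemma B_eq: "B = \<nu> ` {x. Poly_Mapping.keys x \<subseteq> paths Q\<^sub>B}"
proof -
  have "B = \<nu>\<^sub>B ` {x. Poly_Mapping.keys x \<subseteq> paths Q\<^sub>B}"
    using pres_B by (simp add: presentation_def path_algebra_def)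
  then show ?thesis using restrict by (auto simp: image_iff)
qed

lemma path_val_in_B: "p \<in> paths Q\<^sub>B \<Longrightarrow> path_val p \<in> B"
  unfolding B_eq by (rule imageI) simp

text \<open>\<open>B\<close> contains the unit of the algebra, so 1 is the sum of the vertices of
  the subquiver; a vertex outside it would be orthogonal to 1 and hence zero. The lifting argument
  uses this to make \<open>a\<close> commute with every vertex.\<close>

lemma verts_B: "verts Q\<^sub>B = verts Q"
proof
  show "verts Q\<^sub>B \<subseteq> verts Q" using sub by (auto simp: subgraph_def)
  show "verts Q \<subseteq> verts Q\<^sub>B"
  proof
    fix w assume w: "w \<in> verts Q"
    define u :: "('v, 'e) path \<Rightarrow>\<^sub>0 'k" where "u = (\<Sum>v\<in>verts Q\<^sub>B. path_elem (v, []))"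
    have "Poly_Mapping.keys u \<subseteq> (\<Union>v\<in>verts Q\<^sub>B. Poly_Mapping.keys (path_elem (v, []) :: ('v, 'e) path \<Rightarrow>\<^sub>0 'k))"
      unfolding u_def by (rule Poly_Mapping.keys_sum)
    then have u: "Poly_Mapping.keys u \<subseteq> paths Q\<^sub>B" by auto
    have hom_B: "\<nu>\<^sub>B \<in> ring_hom (path_algebra Q\<^sub>B) (algebra_on scale B)"
      using pres_B by (simp add: presentation_def)
    have "\<nu>\<^sub>B u = 1"
      using ring_hom_one[OF hom_B] by (simp add: u_def path_algebra_def algebra_on_def)
    then have "1 = \<nu> u" using restrict[OF u] by simp
    also have "\<dots> = (\<Sum>v\<in>verts Q\<^sub>B. vertex_val v)"
      unfolding u_def using \<open>verts Q\<^sub>B \<subseteq> verts Q\<close> by (intro \<nu>_sum) auto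
    finally have one: "1 = (\<Sum>v\<in>verts Q\<^sub>B. vertex_val v)" .
    have "vertex_val w = vertex_val w * (\<Sum>v\<in>verts Q\<^sub>B. vertex_val v)"
      by (simp only: one[symmetric] mult_1_right)
    also have "\<dots> = (\<Sum>v\<in>verts Q\<^sub>B. if w = v then vertex_val w else 0)"
      unfolding sum_distrib_left using w \<open>verts Q\<^sub>B \<subseteq> verts Q\<close>
      by (intro sum.cong[OF HOL.refl] vertex_val_mult) auto
    finally have eq: "vertex_val w = (\<Sum>v\<in>verts Q\<^sub>B. if w = v then vertex_val w else 0)" .
    show "w \<in> verts Q\<^sub>B"
    proof (rule ccontr)
      assume "w \<notin> verts Q\<^sub>B"
      then have "(\<Sum>v\<in>verts Q\<^sub>B. if w = v then vertex_val w else 0) = 0"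
        by (intro sum.neutral) auto
      then show False using eq vertex_val_nonzero[OF w] by simp
    qed
  qed
qed

abbreviation "N \<equiv> relative_subgroup Q ideal b Q\<^sub>B"

lemma normal_N: "N \<lhd> \<pi>"
  by (rule normal_relative_subgroup[OF sub])

sublocale N: normal N \<pi>
  by (rule normal_N)

lemma derivation_zero_on_B:
  assumes D: "D \<in> derivations scale" and zero: "\<And>p. p \<in> paths Q\<^sub>B \<Longrightarrow> D (path_val p) = 0" and x: "x \<in> B"
  shows "D x = 0"
proof -
  obtain y where y: "Poly_Mapping.keys y \<subseteq> paths Q\<^sub>B" "x = \<nu> y" using x by (auto simp: B_eq)
  have "D (\<Sum>p\<in>S. scale (Poly_Mapping.lookup y p) (path_val p)) = 0" if "finite S" "S \<subseteq> paths Q\<^sub>B" for S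
    using that
    by (induction S rule: finite_induct)
      (simp_all add: derivation_0[OF D] derivation_add[OF D] derivation_scale[OF D] zero)
  from this[OF finite_keys y(1)] show ?thesis
    using y \<nu>_expand[of y] paths_B_subset by auto
qed

lemma iota_parade_class:
  assumes "parade_data Q b \<gamma>" "p \<in> paths Q"
  shows "iota \<pi> N f (parade_class Q ideal \<gamma> p) = f (N #>\<^bsub>\<pi>\<^esub> parade_class Q ideal \<gamma> p)"
  using parade_class_in_carrier[OF assms] by (simp add: iota_def)

context
  fixes \<gamma> :: "'v \<Rightarrow> ('v, 'e letter) path"
  assumes rel_parade: "relative_parade_data Q b Q\<^sub>B \<gamma>"
begin

lemma parade: "parade_data Q b \<gamma>"
  using rel_parade by (simp add: relative_parade_data_def)

text \<open>The class of a path of the subquiver lies in \<open>N\<close>, so its coset is the unit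
  of the quotient and the factor is 0; such paths span \<open>B\<close>.\<close>

lemma hom_derivation_iota_relative:
  assumes f: "f \<in> carrier (hom_space (\<pi> Mod N))"
  shows "hom_derivation \<gamma> (iota \<pi> N f) \<in> relative_derivations scale B"
  unfolding relative_derivations_iff
proof (intro conjI ballI)
  interpret QG: group "\<pi> Mod N" by (rule N.factorgroup_is_group)
  note if' = N.iota_closed[OF f]
  show D: "hom_derivation \<gamma> (iota \<pi> N f) \<in> derivations scale"
    by (rule hom_derivation_in[OF parade if'])
  fix x assume "x \<in> B"
  show "hom_derivation \<gamma> (iota \<pi> N f) x = 0"
  proof (rule derivation_zero_on_B[OF D _ \<open>x \<in> B\<close>])
    fix p assume p: "p \<in> paths Q\<^sub>B"
    then have pQ: "p \<in> paths Q" using paths_B_subset by blast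
    have "parade_class Q ideal \<gamma> p \<in> N" by (rule relative_parade_class[OF sub rel_parade p])
    then have "N #>\<^bsub>\<pi>\<^esub> parade_class Q ideal \<gamma> p = N"
      by (intro coset_join2 N.is_subgroup parade_class_in_carrier[OF parade pQ])
    then have "f (N #>\<^bsub>\<pi>\<^esub> parade_class Q ideal \<gamma> p) = 0"
      using QG.hom_space_one[OF f] by simp
    then show "hom_derivation \<gamma> (iota \<pi> N f) (path_val p) = 0"
      by (simp add: hom_derivation_path_class[OF parade if' pQ] iota_parade_class[OF parade pQ])
  qed
qed

lemma scales_paths_iota:
  "scales_paths scale Q \<nu> (\<lambda>p. f (N #>\<^bsub>\<pi>\<^esub> parade_class Q ideal \<gamma> p)) D \<longleftrightarrow>
     scales_paths scale Q \<nu> (\<lambda>p. iota \<pi> N f (parade_class Q ideal \<gamma> p)) D"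
  by (simp add: scales_paths_def iota_parade_class[OF parade])

text \<open>The derivation of \<open>iota \<pi> N f\<close> is the candidate, and uniqueness already
  holds among all derivations. The relative map thereby inherits its properties from the absolute
  construction.\<close>

lemma relative_derivation_ex1:
  assumes f: "f \<in> carrier (hom_space (\<pi> Mod N))"
  shows "\<exists>!D. D \<in> relative_derivations scale B \<and>
    scales_paths scale Q \<nu> (\<lambda>p. f (N #>\<^bsub>\<pi>\<^esub> parade_class Q ideal \<gamma> p)) D"
proof (rule ex1I)
  note if' = N.iota_closed[OF f]
  show "hom_derivation \<gamma> (iota \<pi> N f) \<in> relative_derivations scale B \<and>
      scales_paths scale Q \<nu> (\<lambda>p. f (N #>\<^bsub>\<pi>\<^esub> parade_class Q ideal \<gamma> p)) (hom_derivation \<gamma> (iota \<pi> N f))"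
    using hom_derivation_iota_relative[OF f] scales_paths_hom_derivation[OF parade if']
    by (simp add: scales_paths_iota)
  fix D assume "D \<in> relative_derivations scale B \<and>
      scales_paths scale Q \<nu> (\<lambda>p. f (N #>\<^bsub>\<pi>\<^esub> parade_class Q ideal \<gamma> p)) D"
  then show "D = hom_derivation \<gamma> (iota \<pi> N f)"
    using scales_paths_unique[OF _ _ hom_derivation_in[OF parade if'] scales_paths_hom_derivation[OF parade if']]
    by (simp add: scales_paths_iota relative_derivations_def)
qed

lemma relative_theta_eq:
  assumes f: "f \<in> carrier (hom_space (\<pi> Mod N))"
  shows "relative_theta scale B Q \<nu> Q\<^sub>B b \<gamma> f =
    relative_inner_derivations B +>\<^bsub>operator_space scale (relative_derivations scale B)\<^esub>
      hom_derivation \<gamma> (iota \<pi> N f)"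
proof -
  note if' = N.iota_closed[OF f]
  have "(THE D. D \<in> relative_derivations scale B \<and>
      scales_paths scale Q \<nu> (\<lambda>p. f (N #>\<^bsub>\<pi>\<^esub> parade_class Q ideal \<gamma> p)) D) = hom_derivation \<gamma> (iota \<pi> N f)"
    using hom_derivation_iota_relative[OF f] scales_paths_hom_derivation[OF parade if']
    by (intro the1_equality[OF relative_derivation_ex1[OF f]]) (simp add: scales_paths_iota)
  then show ?thesis by (simp add: relative_theta_def Let_def)
qed

lemma linear_map_relative_theta:
  "linear_map ring_of_type_algebra (hom_space (\<pi> Mod N)) (relative_HH1 scale B)
     (relative_theta scale B Q \<nu> Q\<^sub>B b \<gamma>)"
proof (rule linear_mapI)
  note HH = linear_mapD[OF linear_map_relative_HH1[where B = B]]
  show vs: "vectorspace ring_of_type_algebra (hom_space (\<pi> Mod N) :: ('k, _) module)"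
    by (rule linear_mapD(1)[OF N.linear_map_iota])
  show "vectorspace ring_of_type_algebra (relative_HH1 scale B)" by (rule HH(2))
  interpret V: vectorspace ring_of_type_algebra "hom_space (\<pi> Mod N) :: ('k, _) module" by (rule vs)
  have car: "hom_derivation \<gamma> (iota \<pi> N f) \<in> carrier (operator_space scale (relative_derivations scale B))"
    if "f \<in> carrier (hom_space (\<pi> Mod N))" for f
    using hom_derivation_iota_relative[OF that] by (simp add: operator_space_def)
  fix f :: "('v, 'e letter) path set set \<Rightarrow> 'k" assume f: "f \<in> carrier (hom_space (\<pi> Mod N))"
  show "relative_theta scale B Q \<nu> Q\<^sub>B b \<gamma> f \<in> carrier (relative_HH1 scale B)"
    unfolding relative_theta_eq[OF f] by (rule HH(3)[OF car[OF f]])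
  show "relative_theta scale B Q \<nu> Q\<^sub>B b \<gamma> (c \<odot>\<^bsub>hom_space (\<pi> Mod N)\<^esub> f) =
      c \<odot>\<^bsub>relative_HH1 scale B\<^esub> relative_theta scale B Q \<nu> Q\<^sub>B b \<gamma> f" for c
  proof -
    have cf: "c \<odot>\<^bsub>hom_space (\<pi> Mod N)\<^esub> f \<in> carrier (hom_space (\<pi> Mod N))" using f by simp
    have "hom_derivation \<gamma> (iota \<pi> N (c \<odot>\<^bsub>hom_space (\<pi> Mod N)\<^esub> f)) =
        (\<lambda>x. scale c (hom_derivation \<gamma> (iota \<pi> N f) x))"
      using linear_mapD(5)[OF N.linear_map_iota _ f, of c]
        hom_derivation_smult[OF parade N.iota_closed[OF f], of c] by simp
    then show ?thesis
      using HH(5)[OF _ car[OF f], of c]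
      unfolding relative_theta_eq[OF f] relative_theta_eq[OF cf] by (simp add: operator_space_def)
  qed
  fix g :: "('v, 'e letter) path set set \<Rightarrow> 'k" assume g: "g \<in> carrier (hom_space (\<pi> Mod N))"
  have fg: "f \<oplus>\<^bsub>hom_space (\<pi> Mod N)\<^esub> g \<in> carrier (hom_space (\<pi> Mod N))" using f g by simp
  have "hom_derivation \<gamma> (iota \<pi> N (f \<oplus>\<^bsub>hom_space (\<pi> Mod N)\<^esub> g)) =
      (\<lambda>x. hom_derivation \<gamma> (iota \<pi> N f) x + hom_derivation \<gamma> (iota \<pi> N g) x)"
    using linear_mapD(4)[OF N.linear_map_iota f g]
      hom_derivation_add[OF parade N.iota_closed[OF f] N.iota_closed[OF g]] by simp
  then show "relative_theta scale B Q \<nu> Q\<^sub>B b \<gamma> (f \<oplus>\<^bsub>hom_space (\<pi> Mod N)\<^esub> g) =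
      relative_theta scale B Q \<nu> Q\<^sub>B b \<gamma> f \<oplus>\<^bsub>relative_HH1 scale B\<^esub> relative_theta scale B Q \<nu> Q\<^sub>B b \<gamma> g"
    using HH(4)[OF car[OF f] car[OF g]]
    unfolding relative_theta_eq[OF f] relative_theta_eq[OF g] relative_theta_eq[OF fg]
    by (simp add: operator_space_def)
qed

text \<open>Both sides are classes of the derivation of the same homomorphism
  \<open>iota \<pi> N f\<close>, formed with the parades \<open>\<gamma>'\<close> and
  \<open>\<gamma>\<close>; these two derivations differ by an inner one.\<close>

lemma theta_iota:
  assumes \<gamma>': "parade_data Q b \<gamma>'" and f: "f \<in> carrier (hom_space (\<pi> Mod N))"
  shows "theta scale Q \<nu> \<gamma>' (iota \<pi> N f) = iota_HH scale (relative_theta scale B Q \<nu> Q\<^sub>B b \<gamma> f)"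
  unfolding relative_theta_eq[OF f] iota_HH_coset theta_eq inner_coset_eq_iff
  by (rule hom_derivation_parade_change[OF \<gamma>' parade N.iota_closed[OF f]])

end

end

text \<open>
  The arguments for injectivity of \<open>\<theta>\<close> and for the lifting property of the square coincide: they
  apply this to \<open>Q' = Q\<close> and to \<open>Q' = Q\<^sub>B\<close>, respectively.
\<close>

lemma (in pointed_presentation) parade_value_parallel:
  assumes \<gamma>: "parade_data Q b \<gamma>" and u: "u \<in> carrier (hom_space \<pi>)" and sub: "subgraph Q' Q"
    and potential: "\<And>p c. p \<in> paths Q \<Longrightarrow> path_val p \<noteq> 0 \<Longrightarrow>
      a * path_val p - path_val p * a = scale c (path_val p) \<Longrightarrow> c = \<phi> (path_target Q p) - \<phi> (fst p)"
    and nz: "\<And>a. a \<in> arcs Q \<Longrightarrow> path_val (tail Q a, [a]) \<noteq> 0"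
    and inner: "\<And>e. e \<in> arcs Q' \<Longrightarrow> hom_derivation \<gamma> u (path_val (tail Q e, [e])) =
      a * path_val (tail Q e, [e]) - path_val (tail Q e, [e]) * a"
    and w: "w \<in> walks_between Q' x y" "w' \<in> walks_between Q' x y"
  shows "parade_value \<gamma> u w = parade_value \<gamma> u w'"
proof -
  have arrow: "parade_value \<gamma> u (tail Q e, [Arrow e]) = \<phi> (head Q e) - \<phi> (tail Q e)" if e: "e \<in> arcs Q'" for e
  proof -
    let ?p = "(tail Q e, [e])"
    have eQ: "e \<in> arcs Q" using e sub by (auto simp: subgraph_def)
    then have p: "?p \<in> paths Q" by simp
    have "walk_of_path ?p = (tail Q e, [Arrow e])" by (simp add: walk_of_path_def)
    then have "a * path_val ?p - path_val ?p * a = scale (parade_value \<gamma> u (tail Q e, [Arrow e])) (path_val ?p)"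
      using inner[OF e] hom_derivation_path[OF \<gamma> u p] by simp
    \<comment> \<open>An eigenvalue is determined only on a non-zero vector, which is where the
      non-vanishing of the arrow enters.\<close>
    from potential[OF p nz[OF eQ] this] show ?thesis by simp
  qed
  show ?thesis
    using parade_value_potential[OF \<gamma> u sub arrow w(1)] parade_value_potential[OF \<gamma> u sub arrow w(2)] by simp
qed

text \<open>Derivations of homomorphisms kill the vertices, so a commutator that agrees with one at
  a vertex is zero there. This supplies the commutation hypothesis of
  \<open>commutator_eigenvalue_potential\<close>.\<close>

lemma (in pointed_presentation) commute_vertex:
  assumes \<gamma>: "parade_data Q b \<gamma>" and u: "u \<in> carrier (hom_space \<pi>)" and v: "v \<in> verts Q"
    and "hom_derivation \<gamma> u (vertex_val v) = a * vertex_val v - vertex_val v * a"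
  shows "a * vertex_val v = vertex_val v * a"
  using assms hom_derivation_vertex[OF \<gamma> u v] by simp

lemma inj_on_theta:
  fixes scale :: "'k::alg_closed_field \<Rightarrow> 'a::ring_1 \<Rightarrow> 'a"
    and Q :: "('v, 'e) pre_digraph" and \<nu> :: "(('v, 'e) path \<Rightarrow>\<^sub>0 'k) \<Rightarrow> 'a"
  assumes fd: "finite_dimensional_algebra scale" and P: "pointed_presentation scale E Q \<nu> b"
    and prim: "\<And>e. e \<in> E \<Longrightarrow> primitive_idempotent e"
    and nz: "\<And>a. a \<in> arcs Q \<Longrightarrow> \<nu> (path_elem (tail Q a, [a])) \<noteq> 0"
    and \<gamma>: "parade_data Q b \<gamma>"
  shows "inj_on (theta scale Q \<nu> \<gamma>)
    (carrier (hom_space (fundamental_group Q (presentation_ideal scale Q \<nu>) b)))"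
proof -
  interpret pointed_presentation scale E Q \<nu> b by fact
  show ?thesis
  proof (rule inj_onI)
    fix f g :: "('v, 'e letter) path set \<Rightarrow> 'k"
    assume f: "f \<in> carrier (hom_space \<pi>)" and g: "g \<in> carrier (hom_space \<pi>)"
      and eq: "theta scale Q \<nu> \<gamma> f = theta scale Q \<nu> \<gamma> g"
    interpret H: vectorspace ring_of_type_algebra "hom_space \<pi> :: ('k, _) module" by (rule vectorspace_hom_space)
    \<comment> \<open>By linearity it suffices to treat the difference of \<open>f\<close> and
      \<open>g\<close>, whose derivation is inner.\<close>
    define u where "u = f \<oplus>\<^bsub>hom_space \<pi>\<^esub> (- 1) \<odot>\<^bsub>hom_space \<pi>\<^esub> g"
    have g': "(- 1) \<odot>\<^bsub>hom_space \<pi>\<^esub> g \<in> carrier (hom_space \<pi>)" using g by simp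
    have u: "u \<in> carrier (hom_space \<pi>)" unfolding u_def using f g' by simp
    have "hom_derivation \<gamma> u = (\<lambda>x. hom_derivation \<gamma> f x - hom_derivation \<gamma> g x)"
      by (simp add: u_def hom_derivation_add[OF \<gamma> f g'] hom_derivation_smult[OF \<gamma> g])
    then have "hom_derivation \<gamma> u \<in> inner_derivations"
      using eq by (simp add: theta_eq inner_coset_eq_iff)
    then obtain a where a: "hom_derivation \<gamma> u x = a * x - x * a" for x
      by (auto simp: inner_derivations_def)
    obtain \<phi> where \<phi>: "\<And>p c. p \<in> paths Q \<Longrightarrow> path_val p \<noteq> 0 \<Longrightarrow>
        a * path_val p - path_val p * a = scale c (path_val p) \<Longrightarrow> c = \<phi> (path_target Q p) - \<phi> (fst p)"
      using commutator_eigenvalue_potential[OF fd algebra_presentation_axioms prim commute_vertex[OF \<gamma> u _ a]]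
      by blast
    have subQ: "subgraph Q Q" using wf_digraph_axioms by (auto simp: subgraph_def compatible_def)
    have "u (walk_class Q ideal w) = 0" if w: "w \<in> walks_between Q b b" for w
    proof -
      \<comment> \<open>A closed walk at \<open>b\<close> is parallel to the trivial walk, whose
        value is 0.\<close>
      have "parade_value \<gamma> u w = parade_value \<gamma> u (b, [])"
      proof (rule parade_value_parallel[where a = a and \<phi> = \<phi>, OF \<gamma> u subQ])
        show "(b, []) \<in> walks_between Q b b" by (rule trivial_in_walks_between[OF base])
        show "hom_derivation \<gamma> u (path_val (tail Q e, [e])) =
            a * path_val (tail Q e, [e]) - path_val (tail Q e, [e]) * a" for e
          by (rule a)
      qed (fact \<phi> nz w)+
      then show ?thesis by (simp add: parade_value_closed[OF \<gamma> u w] parade_value_trivial[OF \<gamma> u base])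
    qed
    then have "u x = 0" if "x \<in> carrier \<pi>" for x
      using that by (auto simp: carrier_fundamental_group)
    moreover have "u x = f x - g x" if "x \<in> carrier \<pi>" for x
      using that by (simp add: u_def hom_space_def)
    ultimately have zero: "f x = g x" if "x \<in> carrier \<pi>" for x
      using that by simp
    show "f = g"
      using f g zero by (intro extensionalityI[of f "carrier \<pi>"]) (auto simp: hom_space_carrier_iff)
  qed
qed

lemma relative_theta_lift:
  fixes scale :: "'k::alg_closed_field \<Rightarrow> 'a::ring_1 \<Rightarrow> 'a"
    and Q Q\<^sub>B :: "('v, 'e) pre_digraph" and \<nu> :: "(('v, 'e) path \<Rightarrow>\<^sub>0 'k) \<Rightarrow> 'a" and b :: 'v
  defines "G \<equiv> fundamental_group Q (presentation_ideal scale Q \<nu>) b"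
  defines "H \<equiv> relative_subgroup Q (presentation_ideal scale Q \<nu>) b Q\<^sub>B"
  assumes fd: "finite_dimensional_algebra scale"
    and P: "relative_pointed_presentation scale E Q \<nu> b B E\<^sub>B Q\<^sub>B \<nu>\<^sub>B"
    and prim: "\<And>e. e \<in> E \<Longrightarrow> primitive_idempotent e"
    and nz: "\<And>a. a \<in> arcs Q \<Longrightarrow> \<nu> (path_elem (tail Q a, [a])) \<noteq> 0"
    and \<gamma>': "parade_data Q b \<gamma>'" and \<gamma>: "relative_parade_data Q b Q\<^sub>B \<gamma>"
    and u: "u \<in> carrier (hom_space G)" and U: "U \<in> carrier (relative_HH1 scale B)"
    and eq: "theta scale Q \<nu> \<gamma>' u = iota_HH scale U"
  shows "\<exists>f\<in>carrier (hom_space (G Mod H)). iota G H f = u \<and> relative_theta scale B Q \<nu> Q\<^sub>B b \<gamma> f = U"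
proof -
  interpret relative_pointed_presentation scale E Q \<nu> b B E\<^sub>B Q\<^sub>B \<nu>\<^sub>B by fact
  note u = u[unfolded G_def]
  note rel = relative_derivations_iff
  obtain D where D: "D \<in> relative_derivations scale B"
    "U = relative_inner_derivations B +>\<^bsub>operator_space scale (relative_derivations scale B)\<^esub> D"
    using U by (rule relative_HH1_cases)
  have inner: "(\<lambda>x. hom_derivation \<gamma>' u x - D x) \<in> inner_derivations"
    using eq by (simp add: D(2) iota_HH_coset theta_eq inner_coset_eq_iff)
  then obtain a where a: "hom_derivation \<gamma>' u x - D x = a * x - x * a" for x
    by (auto simp: inner_derivations_def fun_eq_iff)
  \<comment> \<open>\<open>D\<close> vanishes on \<open>B\<close>, so there the derivation of
    \<open>u\<close> is the commutator with \<open>a\<close> alone.\<close>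
  have on_B: "hom_derivation \<gamma>' u (path_val p) = a * path_val p - path_val p * a" if "p \<in> paths Q\<^sub>B" for p
    using a[of "path_val p"] D(1) path_val_in_B[OF that] by (simp add: rel)
  \<comment> \<open>Every vertex of the large quiver belongs to the subquiver by
    \<open>verts_B\<close>, so the identity on \<open>B\<close> reaches all of them.\<close>
  have "a * vertex_val v = vertex_val v * a" if "v \<in> verts Q" for v
    using that on_B[of "(v, [])"] by (intro commute_vertex[OF \<gamma>' u]) (auto simp: verts_B)
  from commutator_eigenvalue_potential[OF fd algebra_presentation_axioms prim this]
  obtain \<phi> where \<phi>: "\<And>p c. p \<in> paths Q \<Longrightarrow> path_val p \<noteq> 0 \<Longrightarrow>
      a * path_val p - path_val p * a = scale c (path_val p) \<Longrightarrow> c = \<phi> (path_target Q p) - \<phi> (fst p)"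
    by blast
  have tail: "tail Q\<^sub>B = tail Q" using sub by (simp add: subgraph_def compatible_def)
  have on_arcs: "hom_derivation \<gamma>' u (path_val (tail Q e, [e])) =
      a * path_val (tail Q e, [e]) - path_val (tail Q e, [e]) * a" if "e \<in> arcs Q\<^sub>B" for e
    using that by (intro on_B) (simp add: tail)
  have parallel: "parade_value \<gamma>' u w = parade_value \<gamma>' u w'"
    if "w \<in> walks_between Q\<^sub>B x y" "w' \<in> walks_between Q\<^sub>B x y" for w w' x y
    by (rule parade_value_parallel[where a = a and \<phi> = \<phi>, OF \<gamma>' u sub]) (fact \<phi> nz on_arcs that)+
  have "u g = 0" if "g \<in> H" for g
  proof (rule hom_zero_on_relative_subgroup[OF \<gamma>' u sub])
    show "g \<in> relative_subgroup Q ideal b Q\<^sub>B" using that by (simp add: H_def)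
  qed (rule parallel)
  then obtain f where f: "f \<in> carrier (hom_space (G Mod H))" "iota G H f = u"
    using normal.iota_surj[OF normal_N u] unfolding G_def H_def by blast
  have "relative_theta scale B Q \<nu> Q\<^sub>B b \<gamma> f = U"
    unfolding D(2) relative_theta_eq[OF \<gamma> f(1)[unfolded G_def H_def]]
      f(2)[unfolded G_def H_def] relative_inner_coset_eq_iff
  proof -
    note \<gamma>0 = parade[OF \<gamma>]
    \<comment> \<open>The difference of the two derivations is inner by the change of parade, and it
      is linear over \<open>B\<close> because both are relative. Relative inner derivations are an
      intersection, so these facts are established separately.\<close>
    have "(\<lambda>x. (hom_derivation \<gamma> u x - hom_derivation \<gamma>' u x) + (hom_derivation \<gamma>' u x - D x)) \<in> inner_derivations"
      using hom_derivation_parade_change[OF \<gamma>0 \<gamma>' u] inner by (rule inner_derivations_subspace)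
    moreover have "hom_derivation \<gamma> u \<in> relative_derivations scale B"
      using hom_derivation_iota_relative[OF \<gamma> f(1)[unfolded G_def H_def]] f(2)[unfolded G_def H_def] by simp
    then have "(\<lambda>x. hom_derivation \<gamma> u x + scale (- 1) (D x)) \<in> relative_derivations scale B"
      using D(1) by (intro relative_derivations_subspace)
    ultimately show "(\<lambda>x. hom_derivation \<gamma> u x - D x) \<in> relative_inner_derivations B"
      by (simp add: relative_inner_derivations_def relative_derivations_def)
  qed
  then show ?thesis using f by blast
qed

text \<open>The two \<open>\<exists>!\<close> clauses certify the definite descriptions inside
  \<open>theta\<close> and \<open>relative_theta\<close>, so that both maps are classes of the
  intended derivations. The parade \<open>\<gamma>'\<close> is arbitrary and only
  \<open>\<gamma>\<close> is relative, so commutativity of the square includes independence of the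
  parade.\<close>

theorem theorem3:
  fixes scale :: "'k::alg_closed_field \<Rightarrow> 'a::ring_1 \<Rightarrow> 'a"
    and B E\<^sub>A E\<^sub>B :: "'a set"
    and Q\<^sub>A Q\<^sub>B :: "('v, 'e) pre_digraph"
    and \<nu>\<^sub>A \<nu>\<^sub>B :: "(('v, 'e) path \<Rightarrow>\<^sub>0 'k) \<Rightarrow> 'a"
    and b :: 'v
    and \<gamma> \<gamma>' :: "'v \<Rightarrow> ('v, 'e letter) path"
  defines "K \<equiv> (ring_of_type_algebra :: 'k ring)"
  defines "I\<^sub>A \<equiv> presentation_ideal scale Q\<^sub>A \<nu>\<^sub>A"
  defines "\<pi> \<equiv> fundamental_group Q\<^sub>A I\<^sub>A b"
  defines "N\<^sub>B \<equiv> relative_subgroup Q\<^sub>A I\<^sub>A b Q\<^sub>B"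
  defines "\<theta> \<equiv> theta scale Q\<^sub>A \<nu>\<^sub>A \<gamma>'"
  defines "\<theta>rel \<equiv> relative_theta scale B Q\<^sub>A \<nu>\<^sub>A Q\<^sub>B b \<gamma>"
  assumes "finite_dimensional_algebra scale"
    and "connected_algebra TYPE('a)"
    and "subalgebra scale B"
    and "complete_orthogonal_idempotents E\<^sub>A"
    and "complete_orthogonal_idempotents E\<^sub>B"
    and "relative_presentation scale B E\<^sub>A E\<^sub>B Q\<^sub>A \<nu>\<^sub>A Q\<^sub>B \<nu>\<^sub>B"
    and "connected Q\<^sub>A"
    and "b \<in> verts Q\<^sub>A"
    and "parade_data Q\<^sub>A b \<gamma>'"
    and "relative_parade_data Q\<^sub>A b Q\<^sub>B \<gamma>"
  shows "N\<^sub>B \<lhd> \<pi> \<and>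
    (\<forall>f\<in>carrier (hom_space \<pi>).
       \<exists>!D. D \<in> derivations scale \<and>
         scales_paths scale Q\<^sub>A \<nu>\<^sub>A (\<lambda>p. f (parade_class Q\<^sub>A I\<^sub>A \<gamma>' p)) D) \<and>
    (\<forall>f\<in>carrier (hom_space (\<pi> Mod N\<^sub>B)).
       \<exists>!D. D \<in> relative_derivations scale B \<and>
         scales_paths scale Q\<^sub>A \<nu>\<^sub>A (\<lambda>p. f (N\<^sub>B #>\<^bsub>\<pi>\<^esub> parade_class Q\<^sub>A I\<^sub>A \<gamma> p)) D) \<and>
    commutative_square K
      (hom_space (\<pi> Mod N\<^sub>B)) (hom_space \<pi>) (relative_HH1 scale B) (HH1 scale)
      (iota \<pi> N\<^sub>B) \<theta>rel \<theta> (iota_HH scale) \<and>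
    ((\<forall>e\<in>E\<^sub>A. primitive_idempotent e) \<and>
     (\<forall>a\<in>arcs Q\<^sub>A. \<nu>\<^sub>A (path_elem (tail Q\<^sub>A a, [a])) \<noteq> 0) \<longrightarrow>
       inj_on \<theta>rel (carrier (hom_space (\<pi> Mod N\<^sub>B))) \<and>
       pullback_square TYPE('t) K
         (hom_space (\<pi> Mod N\<^sub>B)) (hom_space \<pi>) (relative_HH1 scale B) (HH1 scale)
         (iota \<pi> N\<^sub>B) \<theta>rel \<theta> (iota_HH scale))"
proof -
  have fd: "finite_dimensional_algebra scale" by fact
  then have "associative_algebra scale" by (simp add: finite_dimensional_algebra_def)
  have rel: "relative_presentation scale B E\<^sub>A E\<^sub>B Q\<^sub>A \<nu>\<^sub>A Q\<^sub>B \<nu>\<^sub>B" by fact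
  have P: "relative_pointed_presentation scale E\<^sub>A Q\<^sub>A \<nu>\<^sub>A b B E\<^sub>B Q\<^sub>B \<nu>\<^sub>B"
    unfolding relative_pointed_presentation_def relative_pointed_presentation_axioms_def
      pointed_presentation_def pointed_presentation_axioms_def
      algebra_presentation_def algebra_presentation_axioms_def
    using \<open>associative_algebra scale\<close> rel assms by (simp add: relative_presentation_def)
  then interpret P: relative_pointed_presentation scale E\<^sub>A Q\<^sub>A \<nu>\<^sub>A b B E\<^sub>B Q\<^sub>B \<nu>\<^sub>B .
  have \<gamma>': "parade_data Q\<^sub>A b \<gamma>'" and \<gamma>: "relative_parade_data Q\<^sub>A b Q\<^sub>B \<gamma>" by fact+
  have square: "commutative_square K
      (hom_space (\<pi> Mod N\<^sub>B)) (hom_space \<pi>) (relative_HH1 scale B) (HH1 scale)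
      (iota \<pi> N\<^sub>B) \<theta>rel \<theta> (iota_HH scale)"
    unfolding commutative_square_def K_def \<pi>_def N\<^sub>B_def I\<^sub>A_def \<theta>_def \<theta>rel_def
    using P.N.linear_map_iota P.linear_map_relative_theta[OF \<gamma>] P.linear_map_theta[OF \<gamma>']
      P.linear_map_iota_HH P.theta_iota[OF \<gamma> \<gamma>']
    by blast
  have inj_iota: "inj_on (iota \<pi> N\<^sub>B :: _ \<Rightarrow> _ \<Rightarrow> 'k) (carrier (hom_space (\<pi> Mod N\<^sub>B)))"
    unfolding \<pi>_def N\<^sub>B_def I\<^sub>A_def by (rule P.N.inj_on_iota)
  have "inj_on \<theta>rel (carrier (hom_space (\<pi> Mod N\<^sub>B))) \<and>
       pullback_square TYPE('t) K
         (hom_space (\<pi> Mod N\<^sub>B)) (hom_space \<pi>) (relative_HH1 scale B) (HH1 scale)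
         (iota \<pi> N\<^sub>B) \<theta>rel \<theta> (iota_HH scale)"
    if prim: "\<And>e. e \<in> E\<^sub>A \<Longrightarrow> primitive_idempotent e"
      and nz: "\<And>a. a \<in> arcs Q\<^sub>A \<Longrightarrow> \<nu>\<^sub>A (path_elem (tail Q\<^sub>A a, [a])) \<noteq> 0"
  proof
    have inj_theta: "inj_on \<theta> (carrier (hom_space \<pi>))"
      unfolding \<theta>_def \<pi>_def I\<^sub>A_def
      by (rule inj_on_theta[OF fd P.pointed_presentation_axioms _ _ \<gamma>']) (fact prim nz)+
    have iota_closed: "iota \<pi> N\<^sub>B f \<in> carrier (hom_space \<pi>)" if "f \<in> carrier (hom_space (\<pi> Mod N\<^sub>B))"
      for f :: "_ \<Rightarrow> 'k"
      using P.N.iota_closed[of f] that unfolding \<pi>_def N\<^sub>B_def I\<^sub>A_def .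
    have comm: "\<theta> (iota \<pi> N\<^sub>B f) = iota_HH scale (\<theta>rel f)" if "f \<in> carrier (hom_space (\<pi> Mod N\<^sub>B))" for f
      using square that by (simp add: commutative_square_def)
    \<comment> \<open>By commutativity, equal relative classes have equal images under
      \<open>\<theta>\<close> after \<open>iota\<close>, and both of these maps are injective;
      injectivity of \<open>iota_HH\<close> does not enter.\<close>
    show "inj_on \<theta>rel (carrier (hom_space (\<pi> Mod N\<^sub>B)))"
    proof (rule inj_onI)
      fix f g assume f: "f \<in> carrier (hom_space (\<pi> Mod N\<^sub>B))" and g: "g \<in> carrier (hom_space (\<pi> Mod N\<^sub>B))"
        and "\<theta>rel f = \<theta>rel g"
      then have "\<theta> (iota \<pi> N\<^sub>B f) = \<theta> (iota \<pi> N\<^sub>B g)" by (simp add: comm)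
      then have "iota \<pi> N\<^sub>B f = iota \<pi> N\<^sub>B g"
        by (rule inj_onD[OF inj_theta _ iota_closed[OF f] iota_closed[OF g]])
      then show "f = g" by (rule inj_onD[OF inj_iota _ f g])
    qed
    show "pullback_square TYPE('t) K
         (hom_space (\<pi> Mod N\<^sub>B)) (hom_space \<pi>) (relative_HH1 scale B) (HH1 scale)
         (iota \<pi> N\<^sub>B) \<theta>rel \<theta> (iota_HH scale)"
    proof (rule pullback_squareI[OF square inj_iota])
      fix u U assume u: "u \<in> carrier (hom_space \<pi>)" "U \<in> carrier (relative_HH1 scale B)" "\<theta> u = iota_HH scale U"
      note u = u[unfolded \<pi>_def I\<^sub>A_def \<theta>_def]
      show "\<exists>f\<in>carrier (hom_space (\<pi> Mod N\<^sub>B)). iota \<pi> N\<^sub>B f = u \<and> \<theta>rel f = U"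
        unfolding \<pi>_def N\<^sub>B_def I\<^sub>A_def \<theta>rel_def
        by (rule relative_theta_lift[OF fd P _ _ \<gamma>' \<gamma> u]) (fact prim nz)+
    qed
  qed
  moreover have "N\<^sub>B \<lhd> \<pi>" unfolding \<pi>_def N\<^sub>B_def I\<^sub>A_def by (rule P.normal_N)
  moreover have "\<forall>f\<in>carrier (hom_space \<pi>). \<exists>!D. D \<in> derivations scale \<and>
      scales_paths scale Q\<^sub>A \<nu>\<^sub>A (\<lambda>p. f (parade_class Q\<^sub>A I\<^sub>A \<gamma>' p)) D"
    unfolding \<pi>_def I\<^sub>A_def by (rule ballI) (rule P.hom_derivation_ex1[OF \<gamma>'])
  moreover have "\<forall>f\<in>carrier (hom_space (\<pi> Mod N\<^sub>B)). \<exists>!D. D \<in> relative_derivations scale B \<and>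
      scales_paths scale Q\<^sub>A \<nu>\<^sub>A (\<lambda>p. f (N\<^sub>B #>\<^bsub>\<pi>\<^esub> parade_class Q\<^sub>A I\<^sub>A \<gamma> p)) D"
    unfolding \<pi>_def N\<^sub>B_def I\<^sub>A_def by (rule ballI) (rule P.relative_derivation_ex1[OF \<gamma>])
  ultimately show ?thesis using square by (intro conjI impI) simp_all
qed

end
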